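(* Suppose that $u(x)$ is an elliptic, simply-periodic or rational function and that $u$ does not have an isolated singularity at infinity. Let $a_1$ be the unique pole of $u$ in a fundamental parallelogram, in a period-strip or in the complex plane, respectively, and let $\varphi_{1,m}$ denote the coefficient of $(x-a_1)^m$ in the Laurent expansion of $u$ at $a_1$. Let $g\in\mathbb{N}$. The operator $L_4=\partial_x^4+u(x)$ commutes with a differential operator $M$ of order $4g+2$ and $M$, $L_4$ are operators of rank $2$ if and only if the pole of $u$ at $a_1$ has order $4$, $\varphi_{1,-4}=g(4g+1)(4g+3)(4g+4)$, and $\varphi_{1,4k-l}=0$ for all $k=0,\dots,g$ and $l=1,2,3$.
   Context: Differential operators are ordinary scalar linear differential operators in $x$; $\partial_x=d/dx$; $\mathbb{N}=\{1,2,3,\dots\}$. If two such operators $L,M$ commute, there is a nonzero polynomial $R(z,w)$ with $R(L,M)=0$; the curve $R(z,w)=0$ is called the spectral curve. If $L\psi=z\psi$ and $M\psi=w\psi$ with $\psi\neq 0$, then $(z,w)$ lies on the spectral curve. The rank of the pair is the dimension of the space of common eigenfunctions $\{\psi: L\psi=z\psi,\ M\psi=w\psi\}$, which is the same for almost all points $(z,w)$ of the spectral curve. For rational $u$, the condition at infinity means that $u$ is holomorphic at infinity.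
   Formalization: M is required to have least order among rank-2 partners of orders 4h+2 (otherwise L_4 composed with a smaller partner refutes "only if"); for simply-periodic u the condition at infinity is taken as holomorphy at both ends of the period-strip. *)

theory Defs
  imports
    "HOL-Complex_Analysis.Complex_Analysis"
    "HOL-Computational_Algebra.Computational_Algebra"
    "HOL-Library.Function_Algebras"
begin

text \<open>
  A meromorphic function on the plane is represented by its
  \<^const>\<open>nicely_meromorphic_on\<close> version: removable singularities are filled in and
  the value at a pole is 0.  Hence translation invariance can be tested pointwise, and the
  function is holomorphic on an open set exactly if it has no pole there.
\<close>

text \<open>The list \<open>[a\<^sub>0, \<dots>, a\<^sub>n]\<close> stands for the operator
  \<open>a\<^sub>n \<partial>\<^sup>n + \<dots> + a\<^sub>1 \<partial> + a\<^sub>0\<close>.\<close>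

type_synonym diffop = "(complex \<Rightarrow> complex) list"

definition diff_operator :: "diffop \<Rightarrow> bool" where
  "diff_operator A \<longleftrightarrow>
     (\<forall>a\<in>set A. a nicely_meromorphic_on UNIV) \<and> A \<noteq> [] \<and> last A \<noteq> (\<lambda>x. 0)"

definition diff_order :: "diffop \<Rightarrow> nat" where
  "diff_order A = length A - 1"

definition app :: "diffop \<Rightarrow> (complex \<Rightarrow> complex) \<Rightarrow> (complex \<Rightarrow> complex)" where
  "app A f = (\<lambda>x. \<Sum>i<length A. (A ! i) x * (deriv ^^ i) f x)"

definition regular_on :: "diffop \<Rightarrow> complex set \<Rightarrow> bool" where
  "regular_on A S \<longleftrightarrow> (\<forall>a\<in>set A. a holomorphic_on S)"

definition commuting :: "diffop \<Rightarrow> diffop \<Rightarrow> bool" where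
  "commuting A B \<longleftrightarrow>
     (\<forall>S f. open S \<and> regular_on A S \<and> regular_on B S \<and> f holomorphic_on S \<longrightarrow>
        (\<forall>x\<in>S. app A (app B f) x = app B (app A f) x))"

definition L4 :: "(complex \<Rightarrow> complex) \<Rightarrow> diffop" where
  "L4 u = [u, \<lambda>x. 0, \<lambda>x. 0, \<lambda>x. 0, \<lambda>x. 1]"

text \<open>A polynomial \<open>R(z,w)\<close> is an element of \<open>\<complex>[z][w]\<close>; the coefficient of
  \<open>z\<^sup>i w\<^sup>j\<close> is \<open>coeff (coeff R j) i\<close>.\<close>

definition eval2 :: "complex poly poly \<Rightarrow> complex \<Rightarrow> complex \<Rightarrow> complex" where
  "eval2 R z w = (\<Sum>j\<le>degree R. \<Sum>i\<le>degree (coeff R j). coeff (coeff R j) i * z ^ i * w ^ j)"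

definition eval2_op ::
  "complex poly poly \<Rightarrow> diffop \<Rightarrow> diffop \<Rightarrow> (complex \<Rightarrow> complex) \<Rightarrow> (complex \<Rightarrow> complex)" where
  "eval2_op R A B f =
     (\<lambda>x. \<Sum>j\<le>degree R. \<Sum>i\<le>degree (coeff R j).
        coeff (coeff R j) i * (app A ^^ i) ((app B ^^ j) f) x)"

definition annihilates :: "complex poly poly \<Rightarrow> diffop \<Rightarrow> diffop \<Rightarrow> bool" where
  "annihilates R A B \<longleftrightarrow>
     (\<forall>S f. open S \<and> regular_on A S \<and> regular_on B S \<and> f holomorphic_on S \<longrightarrow>
        (\<forall>x\<in>S. eval2_op R A B f x = 0))"

text \<open>A relation \<open>R(A,B) = 0\<close> may be multiplied by an arbitrary polynomial, which adds
  spurious components without eigenfunctions.  Taking the common zeros of all relations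
  gives the curve of the generating relation.\<close>

definition spectral_curve :: "diffop \<Rightarrow> diffop \<Rightarrow> (complex \<times> complex) set" where
  "spectral_curve A B = {(z, w). \<forall>R. annihilates R A B \<longrightarrow> eval2 R z w = 0}"

global_interpretation fun_space:
  vector_space "\<lambda>(c::complex) (f::complex \<Rightarrow> complex) (x::complex). c * f x"
  defines fun_dim = fun_space.dim
  by unfold_locales (auto simp: algebra_simps fun_eq_iff)

text \<open>Eigenfunctions are in general multivalued on the whole plane, so they are taken on a disc
  \<open>S\<close>.  They are set to 0 outside \<open>S\<close>, so that functions agreeing on \<open>S\<close> count once.\<close>

definition common_eigenspace ::
  "diffop \<Rightarrow> diffop \<Rightarrow> complex set \<Rightarrow> complex \<Rightarrow> complex \<Rightarrow> (complex \<Rightarrow> complex) set" where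
  "common_eigenspace A B S z w =
     {\<psi>. \<psi> holomorphic_on S \<and> (\<forall>x. x \<notin> S \<longrightarrow> \<psi> x = 0) \<and>
          (\<forall>x\<in>S. app A \<psi> x = z * \<psi> x \<and> app B \<psi> x = w * \<psi> x)}"

definition has_rank :: "diffop \<Rightarrow> diffop \<Rightarrow> nat \<Rightarrow> bool" where
  "has_rank A B r \<longleftrightarrow>
     (\<forall>c \<epsilon>. \<epsilon> > 0 \<and> regular_on A (ball c \<epsilon>) \<and> regular_on B (ball c \<epsilon>) \<longrightarrow>
        finite {(z, w) \<in> spectral_curve A B.
                  fun_dim (common_eigenspace A B (ball c \<epsilon>) z w) \<noteq> r})"

text \<open>If \<open>M\<close> is a partner of \<open>L4 u\<close> for \<open>g\<close>, then the composition of \<open>L4 u\<close> and \<open>M\<close> is one for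
  \<open>g + 1\<close>: it has order \<open>4(g+1)+2\<close> and, at \<open>(z, z w)\<close>, the same common eigenfunctions as the
  original pair at \<open>(z, w)\<close>.  Only the least \<open>g\<close> is therefore determined by \<open>u\<close>.\<close>

definition rank2_partner :: "(complex \<Rightarrow> complex) \<Rightarrow> nat \<Rightarrow> diffop \<Rightarrow> bool" where
  "rank2_partner u g M \<longleftrightarrow>
     diff_operator M \<and> diff_order M = 4 * g + 2 \<and> commuting (L4 u) M \<and> has_rank (L4 u) M 2"

definition period_group :: "(complex \<Rightarrow> complex) \<Rightarrow> complex set" where
  "period_group u = {\<omega>. \<forall>x. u (x + \<omega>) = u x}"

definition elliptic :: "(complex \<Rightarrow> complex) \<Rightarrow> complex \<Rightarrow> complex \<Rightarrow> bool" where
  "elliptic u \<omega>\<^sub>1 \<omega>\<^sub>2 \<longleftrightarrow>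
     u nicely_meromorphic_on UNIV \<and> \<omega>\<^sub>1 \<noteq> 0 \<and> Im (\<omega>\<^sub>2 / \<omega>\<^sub>1) \<noteq> 0 \<and>
     period_group u = {of_int m * \<omega>\<^sub>1 + of_int n * \<omega>\<^sub>2 | m n. True}"

definition simply_periodic :: "(complex \<Rightarrow> complex) \<Rightarrow> complex \<Rightarrow> bool" where
  "simply_periodic u \<omega> \<longleftrightarrow>
     u nicely_meromorphic_on UNIV \<and> \<omega> \<noteq> 0 \<and> period_group u = {of_int m * \<omega> | m. True}"

definition rational_function :: "(complex \<Rightarrow> complex) \<Rightarrow> bool" where
  "rational_function u \<longleftrightarrow>
     u nicely_meromorphic_on UNIV \<and>
     (\<exists>p q. q \<noteq> 0 \<and> (\<forall>x. poly q x \<noteq> 0 \<longrightarrow> u x = poly p x / poly q x))"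

definition fundamental_parallelogram :: "complex \<Rightarrow> complex \<Rightarrow> complex \<Rightarrow> complex set" where
  "fundamental_parallelogram c \<omega>\<^sub>1 \<omega>\<^sub>2 =
     {c + of_real s * \<omega>\<^sub>1 + of_real t * \<omega>\<^sub>2 | s t. 0 \<le> s \<and> s < 1 \<and> 0 \<le> t \<and> t < 1}"

definition period_strip :: "complex \<Rightarrow> complex \<Rightarrow> complex set" where
  "period_strip c \<omega> = {c + s * \<omega> | s. 0 \<le> Re s \<and> Re s < 1}"

definition unique_pole_in :: "(complex \<Rightarrow> complex) \<Rightarrow> complex set \<Rightarrow> complex \<Rightarrow> bool" where
  "unique_pole_in u D a \<longleftrightarrow> a \<in> D \<and> is_pole u a \<and> (\<forall>b\<in>D. is_pole u b \<longrightarrow> b = a)"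

definition holomorphic_at_infinity :: "(complex \<Rightarrow> complex) \<Rightarrow> bool" where
  "holomorphic_at_infinity u \<longleftrightarrow>
     (\<exists>h. h analytic_on {0} \<and> (\<forall>\<^sub>F t in at 0. u (1 / t) = h t))"

text \<open>A function with period \<open>\<omega>\<close> is a function \<open>F\<close> of \<open>\<zeta> = exp (2 \<pi> \<i> x / \<omega>)\<close>.  The ends
  \<open>Im (x / \<omega>) \<rightarrow> \<plusminus>\<infinity>\<close> of the period strip are \<open>\<zeta> = 0\<close> and \<open>\<zeta> = \<infinity>\<close>, and \<open>F\<close> has to be
  holomorphic at both.  This is the condition at infinity for simply-periodic functions; it
  does not follow from the presence of poles, as \<open>exp (2 \<pi> \<i> x / \<omega>) + 1 / sin (\<pi> x / \<omega>)\<^sup>4\<close>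
  shows.\<close>

definition holomorphic_at_strip_ends :: "(complex \<Rightarrow> complex) \<Rightarrow> complex \<Rightarrow> bool" where
  "holomorphic_at_strip_ends u \<omega> \<longleftrightarrow>
     (\<exists>h B. h analytic_on {0} \<and>
        (\<forall>x. Im (x / \<omega>) > B \<longrightarrow> u x = h (exp (2 * pi * \<i> * x / \<omega>)))) \<and>
     (\<exists>h B. h analytic_on {0} \<and>
        (\<forall>x. Im (x / \<omega>) < B \<longrightarrow> u x = h (exp (- (2 * pi * \<i> * x / \<omega>)))))"

text \<open>For elliptic functions the poles accumulate at infinity, so there is no further condition
  there.\<close>

definition admissible_potential :: "(complex \<Rightarrow> complex) \<Rightarrow> complex \<Rightarrow> bool" where
  "admissible_potential u a \<longleftrightarrow>
     (\<exists>\<omega>\<^sub>1 \<omega>\<^sub>2 c. elliptic u \<omega>\<^sub>1 \<omega>\<^sub>2 \<and>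
        unique_pole_in u (fundamental_parallelogram c \<omega>\<^sub>1 \<omega>\<^sub>2) a) \<or>
     (\<exists>\<omega> c. simply_periodic u \<omega> \<and> holomorphic_at_strip_ends u \<omega> \<and>
        unique_pole_in u (period_strip c \<omega>) a) \<or>
     (rational_function u \<and> holomorphic_at_infinity u \<and> unique_pole_in u UNIV a)"

definition laurent_coeff :: "(complex \<Rightarrow> complex) \<Rightarrow> complex \<Rightarrow> int \<Rightarrow> complex" where
  "laurent_coeff u a m = fls_nth (laurent_expansion u a) m"

end

theory Submission
  imports Defs
begin

text \<open>
  Write \<open>L = \<partial>\<^sup>4 + u\<close>.  An operator \<open>M\<close> of order \<open>4g + 2\<close> acts on solutions of \<open>L \<psi> = z \<psi>\<close> as
  \<open>A \<partial>\<^sup>3 + B \<partial>\<^sup>2 + C \<partial> + D\<close> with coefficients polynomial in \<open>z\<close>, and if it commutes with \<open>L\<close>, then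
  \<open>Q = 2 B + A'\<close> solves \<open>Q''''' + 4 (z - u) Q' - 2 u' Q = 0\<close>.  The coefficients of \<open>Q\<close> with respect
  to \<open>z\<close> form a terminating sequence \<open>4 b\<^sub>j\<^sub>+\<^sub>1' = 4 u b\<^sub>j' + 2 u' b\<^sub>j - b\<^sub>j'''''\<close>.  Following the
  leading terms at the pole, termination forces a pole of order 4 with leading coefficient
  \<open>k (4k + 1) (4k + 3) (4k + 4)\<close> for some \<open>k \<le> g\<close>, and following the first terms at exponents not
  divisible by 4 forces the coefficients of \<open>u\<close> at the exponents \<open>\<plusminus>1, \<plusminus>2, \<plusminus>3\<close> to vanish.

  Conversely, under these conditions \<open>u'''' - A u\<^sup>2 - B u\<close> is constant by Liouville's theorem, so
  that \<open>u\<close> is a Laurent series in \<open>(x - a)\<^sup>4\<close>.  The recursion has a solution by differential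
  polynomials in \<open>u\<close>, a linear combination of which with constant coefficients has no pole at step
  \<open>g + 1\<close>, hence is constant, and the recursion terminates.  The resulting \<open>Q\<close> of degree \<open>g\<close> in
  \<open>z\<close> gives \<open>M = \<Sum>\<^sub>j (q\<^sub>j \<partial>\<^sup>2 - q\<^sub>j' \<partial> + q\<^sub>j'' / 2) L\<^sup>j\<close>, which commutes with \<open>L\<close> and satisfies
  \<open>M\<^sup>2 = F(L)\<close> for a polynomial \<open>F\<close>.  Where \<open>w\<^sup>2 = F(z)\<close> and \<open>Q \<noteq> 0\<close>, a common eigenfunction is
  determined by arbitrary values of \<open>\<psi>\<close> and \<open>\<psi>'\<close>, whence the rank 2.
\<close>

text \<open>The restrictions on the pole and on the exponents \<plusminus>1, \<plusminus>2,
  \<plusminus>3 are local: they use only expansions at the pole. The global hypotheses on u serve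
  Liouville's theorem, which yields the vanishing of the remaining coefficients and stops the
  recursion. Cancellation is the obstacle in the local part. At exponents not divisible by 4 each
  step adds a new term to the inherited one, so nonvanishing alone does not propagate; signs are
  tracked up to step \<open>k + 1\<close>, after which only the inherited term survives. Operators
  are not multiplied in a noncommutative ring. They are compared on local solutions of
  \<open>L \<psi> = z \<psi>\<close> for all \<open>z\<close>: since the 3-jet of \<psi> at a point
  and the number \<open>z\<close> are arbitrary, every coefficient is determined. This is why the
  equation is solved on discs. Composition with \<open>L\<close> raises the order of a partner, so
  the order alone does not fix \<open>k\<close>. As a partner of order \<open>4 k + 2\<close>
  exists, the least order singles out \<open>k = g\<close>.\<close>

unbundle fps_syntax

section \<open>The Lenard recursion for Laurent series\<close>

lemma fls_nth_mult_finite_support: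
  fixes f g :: "'a::comm_ring_1 fls"
  assumes "finite A" "\<And>i. i \<notin> A \<Longrightarrow> f $$ i * g $$ (n - i) = 0"
  shows "(f * g) $$ n = (\<Sum>i\<in>A. f $$ i * g $$ (n - i))"
proof -
  let ?I = "{fls_subdegree f..n - fls_subdegree g}"
  have "(f * g) $$ n = (\<Sum>i\<in>?I. f $$ i * g $$ (n - i))" by (rule fls_times_nth(2))
  also have "\<dots> = (\<Sum>i\<in>?I \<union> A. f $$ i * g $$ (n - i))"
  proof (rule sum.mono_neutral_left)
    have "f $$ i * g $$ (n - i) = 0" if "i \<notin> ?I" for i
    proof (cases "i < fls_subdegree f")
      case True then show ?thesis by simp
    next
      case False
      then have "n - i < fls_subdegree g" using that by auto
      then show ?thesis by simp
    qed
    then show "\<forall>i\<in>?I \<union> A - ?I. f $$ i * g $$ (n - i) = 0" by blast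
  qed (use assms in auto)
  also have "\<dots> = (\<Sum>i\<in>A. f $$ i * g $$ (n - i))"
    by (rule sum.mono_neutral_right) (use assms in auto)
  finally show ?thesis .
qed

text \<open>This is 2 (U d + d U) - d^5, the analogue of the third-order operator in the KdV
  recursion. It is formally skew-adjoint, so its product with the unknown is an exact derivative;
  this is the origin of the first integrals used later.\<close>

definition lenard :: "complex fls \<Rightarrow> complex fls \<Rightarrow> complex fls" where
  "lenard U b = 4 * (U * fls_deriv b) + 2 * (fls_deriv U * b) - (fls_deriv ^^ 5) b"

text \<open>The exponent is written \<open>n - 1\<close> so that \<open>n\<close> belongs to the
  antiderivative; the two products contribute 4 (n - i) + 2 i = 4 n - 2 i. The set \<open>A\<close>
  collects the indices of the convolution that may be nonzero, so that each use names only one or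
  two of them.\<close>

lemma lenard_nth:
  assumes "finite A" "\<And>i. i \<notin> A \<Longrightarrow> U $$ i * b $$ (n - i) = 0"
  shows "lenard U b $$ (n - 1) = (\<Sum>i\<in>A. of_int (4 * n - 2 * i) * U $$ i * b $$ (n - i))
           - of_int ((n + 4) * (n + 3) * (n + 2) * (n + 1) * n) * b $$ (n + 4)"
proof -
  have 1: "(U * fls_deriv b) $$ (n - 1) = (\<Sum>i\<in>A. of_int (n - i) * U $$ i * b $$ (n - i))"
    by (subst fls_nth_mult_finite_support[where A = A])
       (use assms in \<open>auto intro!: sum.cong simp: algebra_simps\<close>)
  have 2: "(fls_deriv U * b) $$ (n - 1) = (\<Sum>i\<in>A. of_int i * U $$ i * b $$ (n - i))"
  proof -
    have "(fls_deriv U * b) $$ (n - 1)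
        = (\<Sum>i\<in>(\<lambda>i. i - 1) ` A. fls_deriv U $$ i * b $$ (n - 1 - i))"
    proof (rule fls_nth_mult_finite_support)
      fix i assume "i \<notin> (\<lambda>i. i - 1) ` A"
      then have "i + 1 \<notin> A" by (metis add_diff_cancel_right' image_eqI)
      from assms(2)[OF this] show "fls_deriv U $$ i * b $$ (n - 1 - i) = 0"
        by (auto simp: algebra_simps)
    qed (use assms in auto)
    also have "\<dots> = (\<Sum>i\<in>A. of_int i * U $$ i * b $$ (n - i))"
      by (subst sum.reindex) (auto intro!: sum.cong simp: inj_on_def)
    finally show ?thesis .
  qed
  have 3: "(fls_deriv ^^ 5) b $$ (n - 1)
      = of_int ((n + 4) * (n + 3) * (n + 2) * (n + 1) * n) * b $$ (n + 4)"
    by (simp add: eval_nat_numeral add.commute mult.commute mult.left_commute)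
  show ?thesis
    unfolding lenard_def fls_minus_nth fls_plus_nth fls_mult_of_numeral_nth 1 2 3
    by (simp only: sum_distrib_left flip: sum.distrib)
       (intro arg_cong2[where f = "(-)"] sum.cong refl, simp add: algebra_simps)
qed


definition lenard_seq :: "complex fls \<Rightarrow> (nat \<Rightarrow> complex fls) \<Rightarrow> bool" where
  "lenard_seq U b \<longleftrightarrow> fls_deriv (b 0) = 0 \<and> (\<forall>j. 4 * fls_deriv (b (Suc j)) = lenard U (b j))"

text \<open>On \<open>x\<^sup>n\<close> with \<open>U = \<phi> x\<^sup>-\<^sup>4\<close> the recursion has the factor
  \<open>(n - 2) (4 \<phi> - n (n - 1) (n - 3) (n - 4))\<close>, and at the leading exponent \<open>n = - 4 k\<close> of \<open>b k\<close> the
  second product is \<open>4 * crit k\<close>.\<close>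

definition crit :: "nat \<Rightarrow> nat" where
  "crit k = k * (4 * k + 1) * (4 * k + 3) * (4 * k + 4)"

lemma lenard_seq_0_nth:
  assumes "lenard_seq U b" "n \<noteq> 0"
  shows "b 0 $$ n = 0"
proof -
  have "fls_deriv (b 0) $$ (n - 1) = 0" using assms by (simp add: lenard_seq_def)
  then show ?thesis using assms by simp
qed

lemma lenard_seq_nth:
  assumes "lenard_seq U b" "finite A" "\<And>i. i \<notin> A \<Longrightarrow> U $$ i * b j $$ (n - i) = 0"
  shows "of_int (4 * n) * b (Suc j) $$ n = (\<Sum>i\<in>A. of_int (4 * n - 2 * i) * U $$ i * b j $$ (n - i))
           - of_int ((n + 4) * (n + 3) * (n + 2) * (n + 1) * n) * b j $$ (n + 4)"
proof -
  have "(4 * fls_deriv (b (Suc j))) $$ (n - 1) = lenard U (b j) $$ (n - 1)"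
    using assms(1) by (simp add: lenard_seq_def)
  moreover have "lenard U (b j) $$ (n - 1) = (\<Sum>i\<in>A. of_int (4 * n - 2 * i) * U $$ i * b j $$ (n - i))
           - of_int ((n + 4) * (n + 3) * (n + 2) * (n + 1) * n) * b j $$ (n + 4)"
    by (rule lenard_nth) (use assms in auto)
  moreover have "(4 * fls_deriv (b (Suc j))) $$ (n - 1) = of_int (4 * n) * b (Suc j) $$ n"
    by (simp add: mult.assoc)
  ultimately show ?thesis by metis
qed

text \<open>At n = -4 nothing is asked of the constant term of \<open>b j\<close>, because the
  factor \<open>n + 4\<close> of the fifth derivative removes it.\<close>

lemma lenard_seq_nth_eq_0:
  assumes "lenard_seq U b" "n \<noteq> 0" "\<And>i. U $$ i * b j $$ (n - i) = 0" "n \<noteq> -4 \<Longrightarrow> b j $$ (n + 4) = 0"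
  shows "b (Suc j) $$ n = 0"
  using lenard_seq_nth[OF assms(1), of "{}" j n] assms by (cases "n = -4") auto

section \<open>Pole orders other than four, and the leading coefficients at order four\<close>

context
  fixes U :: "complex fls" and b :: "nat \<Rightarrow> complex fls"
  assumes seq: "lenard_seq U b"
begin

text \<open>For a pole of order above 4 the products with \<open>U\<close> dominate the fifth
  derivative. Each step lowers the leading exponent by the order of the pole, since the factor 4 n -
  2 s = (4 j + 2) s never vanishes. Such a sequence cannot terminate.\<close>

lemma lenard_seq_high_pole:
  assumes "s < -4" "\<forall>i<s. U $$ i = 0" "U $$ s \<noteq> 0" "b 0 $$ 0 \<noteq> 0"
  shows "(\<forall>n < int j * s. b j $$ n = 0) \<and> b j $$ (int j * s) \<noteq> 0"
proof (induction j)
  case 0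
  then show ?case using lenard_seq_0_nth[OF seq] assms by auto
next
  case (Suc j)
  have z: "U $$ i * b j $$ (n - i) = 0" if "n < s + int j * s" for n i
    using Suc assms that by (cases "i < s") auto
  have n0: "int (Suc j) * s < 0" using assms by (simp add: mult_pos_neg)
  have e: "int (Suc j) * s = s + int j * s" by (simp add: algebra_simps)
  have "b (Suc j) $$ n = 0" if "n < int (Suc j) * s" for n
    by (rule lenard_seq_nth_eq_0[OF seq])
       (use that n0 e z Suc assms in auto)
  moreover have "b (Suc j) $$ (int (Suc j) * s) \<noteq> 0"
  proof -
    define n where "n = s + int j * s"
    have "of_int (4 * n) * b (Suc j) $$ n = of_int (4 * n - 2 * s) * U $$ s * b j $$ (int j * s)"
    proof -
      have "U $$ i * b j $$ (n - i) = 0" if "i \<notin> {s}" for i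
        using Suc assms that by (cases "i < s") (auto simp: n_def)
      moreover have "b j $$ (n + 4) = 0" using Suc assms by (auto simp: n_def)
      ultimately show ?thesis
        using lenard_seq_nth[OF seq, of "{s}" j n] by (simp add: n_def)
    qed
    moreover have "4 * n - 2 * s \<noteq> 0"
    proof -
      have "int j * s \<le> 0" using assms by (simp add: mult_nonneg_nonpos)
      then show ?thesis using assms by (simp add: n_def)
    qed
    then have "complex_of_int (4 * n - 2 * s) \<noteq> 0" by (metis of_int_eq_0_iff)
    ultimately show ?thesis using Suc assms e n_def by (metis mult_eq_0_iff)
  qed
  ultimately show ?case by blast
qed

text \<open>For a pole of order 1, 2 or 3 the first step creates the leading exponent
  \<open>s\<close>; from then on the fifth derivative dominates and lowers it by 4. Its factors
  \<open>n\<close>, ..., \<open>n + 4\<close> are nonzero because \<open>n + 4\<close> is already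
  negative.\<close>

lemma lenard_seq_low_pole:
  assumes "-4 < s" "s < 0" "\<forall>i<s. U $$ i = 0" "U $$ s \<noteq> 0" "b 0 $$ 0 \<noteq> 0"
  shows "(\<forall>n < s - 4 * int j. b (Suc j) $$ n = 0) \<and> b (Suc j) $$ (s - 4 * int j) \<noteq> 0"
proof (induction j)
  case 0
  have "b (Suc 0) $$ n = 0" if "n < s" for n
  proof (rule lenard_seq_nth_eq_0[OF seq])
    show "U $$ i * b 0 $$ (n - i) = 0" for i
      using that assms lenard_seq_0_nth[OF seq, of "n - i"] by (cases "i = n") auto
  qed (use that assms lenard_seq_0_nth[OF seq] in auto)
  moreover have "of_int (4 * s) * b (Suc 0) $$ s = of_int (4 * s - 2 * s) * U $$ s * b 0 $$ 0"
    using lenard_seq_nth[OF seq, of "{s}" 0 s] lenard_seq_0_nth[OF seq] assms by simp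
  ultimately show ?case using assms by auto
next
  case (Suc j)
  have z: "U $$ i * b (Suc j) $$ (n - i) = 0" if "n < s - 4 * int j + s" for n i
    using Suc assms that by (cases "i < s") auto
  have "b (Suc (Suc j)) $$ n = 0" if "n < s - 4 * int (Suc j)" for n
    by (rule lenard_seq_nth_eq_0[OF seq])
       (use that assms z Suc in auto)
  moreover have "b (Suc (Suc j)) $$ (s - 4 * int (Suc j)) \<noteq> 0"
  proof -
    define n where "n = s - 4 * int (Suc j)"
    have "of_int (4 * n) * b (Suc (Suc j)) $$ n
        = - of_int ((n + 4) * (n + 3) * (n + 2) * (n + 1) * n) * b (Suc j) $$ (n + 4)"
      using lenard_seq_nth[OF seq, of "{}" "Suc j" n] z assms by (simp add: n_def)
    moreover have "(n + 4) * (n + 3) * (n + 2) * (n + 1) * n \<noteq> 0"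
      using assms by (simp add: n_def)
    then have "complex_of_int ((n + 4) * (n + 3) * (n + 2) * (n + 1) * n) \<noteq> 0"
      by (metis of_int_eq_0_iff)
    moreover have "b (Suc j) $$ (n + 4) \<noteq> 0" using Suc by (simp add: n_def)
    ultimately show ?thesis unfolding n_def[symmetric] by (metis mult_eq_0_iff neg_equal_0_iff_equal)
  qed
  ultimately show ?case by blast
qed

lemma lenard_seq_below:
  assumes "\<forall>i< -4. U $$ i = 0"
  shows "n < - 4 * int j \<Longrightarrow> b j $$ n = 0"
proof (induction j arbitrary: n)
  case 0
  then show ?case using lenard_seq_0_nth[OF seq] by simp
next
  case (Suc j)
  show ?case
  proof (rule lenard_seq_nth_eq_0[OF seq])
    show "U $$ i * b j $$ (n - i) = 0" for i
      using Suc assms by (cases "i < -4") auto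
  qed (use Suc in auto)
qed

text \<open>At the lowest possible exponent only \<open>U $$ (-4)\<close> and the fifth derivative
  contribute; cancelling the common factor -8 turns the polynomial in the exponent into
  \<open>crit j\<close>.\<close>

lemma lenard_seq_lead:
  assumes "\<forall>i< -4. U $$ i = 0"
  shows "2 * of_nat (Suc j) * b (Suc j) $$ (- 4 * int (Suc j))
       = of_nat (2 * j + 1) * (U $$ (-4) - of_nat (crit j)) * b j $$ (- 4 * int j)"
proof -
  define n where "n = - 4 * int (Suc j)"
  have z: "U $$ i * b j $$ (n - i) = 0" if "i \<notin> {-4}" for i
    using that assms lenard_seq_below[OF assms, of "n - i" j] by (cases "i < -4") (auto simp: n_def)
  have n: "n + 4 = - 4 * int j" by (simp add: n_def)
  have "of_int (4 * n) * b (Suc j) $$ n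
      = (of_int (4 * n + 8) * U $$ (-4) - of_int ((n + 4) * (n + 3) * (n + 2) * (n + 1) * n)) * b j $$ (- 4 * int j)"
    using lenard_seq_nth[OF seq, of "{-4}" j n] z n by (simp add: algebra_simps)
  also have "(of_int (4 * n + 8) * U $$ (-4) - of_int ((n + 4) * (n + 3) * (n + 2) * (n + 1) * n))
     = - 8 * (of_nat (2 * j + 1) * (U $$ (-4) - of_nat (crit j)))"
    by (simp add: n_def crit_def algebra_simps)
  also have "of_int (4 * n) = - 8 * (2 * of_nat (Suc j) :: complex)" by (simp add: n_def)
  finally have "- 8 * (2 * of_nat (Suc j) * b (Suc j) $$ n)
      = - 8 * (of_nat (2 * j + 1) * (U $$ (-4) - of_nat (crit j)) * b j $$ (- 4 * int j))"
    by (simp only: mult.assoc)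
  then show ?thesis unfolding n_def[symmetric] by (simp only: mult_cancel_left) simp
qed

end

lemma crit_strict_mono: "strict_mono crit"
  unfolding strict_mono_Suc_iff crit_def by (intro allI mult_strict_mono) auto

lemma crit_int: "int (4 * crit k) = 4 * int k * (4 * int k + 1) * (4 * int k + 3) * (4 * int k + 4)"
  by (simp add: crit_def algebra_simps)

text \<open>The quartic takes the value \<open>4 * crit k\<close> at 4 k, so its monotonicity
  compares the factor at any exponent with the critical one.\<close>

lemma quartic_strict_mono:
  fixes x y :: int
  assumes "0 \<le> x" "x < y"
  shows "x * (x + 1) * (x + 3) * (x + 4) < y * (y + 1) * (y + 3) * (y + 4)"
  using assms by (intro mult_strict_mono) auto

lemma lenard_seq_lead_nonzero:
  assumes "lenard_seq U b" "\<forall>i< -4. U $$ i = 0" "b 0 $$ 0 \<noteq> 0"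
    and "\<And>j. j < n \<Longrightarrow> U $$ (-4) \<noteq> of_nat (crit j)"
  shows "b n $$ (- 4 * int n) \<noteq> 0"
  using assms(4)
proof (induction n)
  case 0
  then show ?case using assms by simp
next
  case (Suc n)
  then show ?case
    using lenard_seq_lead[OF assms(1,2), of n]
    by (metis assms(3) right_minus_eq mult_eq_0_iff lessI less_SucI of_nat_eq_0_iff
        add_is_0 one_neq_zero)
qed

lemma lenard_seq_lead_zero:
  assumes "lenard_seq U b" "\<forall>i< -4. U $$ i = 0" "U $$ (-4) = of_nat (crit k)" "k < n"
  shows "b n $$ (- 4 * int n) = 0"
  using assms(4)
proof (induction n)
  case (Suc n)
  have "b n $$ (- 4 * int n) = 0 \<or> n = k" using Suc by auto
  then have "2 * of_nat (Suc n) * b (Suc n) $$ (- 4 * int (Suc n)) = 0"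
    unfolding lenard_seq_lead[OF assms(1,2)] using assms(3) by auto
  moreover have "2 * of_nat (Suc n) \<noteq> (0::complex)" by (simp del: of_nat_Suc)
  ultimately show ?case unfolding mult_eq_0_iff by blast
qed auto

text \<open>Positivity, not just nonvanishing, is wanted: at exponents not divisible by 4 these
  leading coefficients enter a sum of two terms that must not cancel. It persists as long as
  \<open>crit k - crit n\<close> is positive.\<close>

lemma lenard_seq_lead_pos:
  assumes "lenard_seq U b" "\<forall>i< -4. U $$ i = 0" "U $$ (-4) = of_nat (crit k)" "n \<le> k"
  shows "\<exists>r>0. b n $$ (- 4 * int n) = of_real r * b 0 $$ 0"
  using assms(4)
proof (induction n)
  case 0
  then show ?case by (intro exI[of _ 1]) auto
next
  case (Suc n)
  then obtain r where r: "r > 0" "b n $$ (- 4 * int n) = of_real r * b 0 $$ 0" by auto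
  have "crit n < crit k" using Suc crit_strict_mono by (auto simp: strict_mono_less)
  define s :: real where "s = (2 * n + 1) * (real (crit k) - real (crit n)) * r / (2 * Suc n)"
  have "s > 0" using r \<open>crit n < crit k\<close> by (simp add: s_def)
  moreover have "2 * of_nat (Suc n) * b (Suc n) $$ (- 4 * int (Suc n))
      = 2 * of_nat (Suc n) * (of_real s * b 0 $$ 0)"
  proof -
    have "2 * of_nat (Suc n) * of_real s = (of_nat (2 * n + 1) * (of_nat (crit k) - of_nat (crit n)) * of_real r :: complex)"
    proof -
      have "2 * real (Suc n) * s = real (2 * n + 1) * (real (crit k) - real (crit n)) * r"
        by (simp add: s_def)
      from arg_cong[OF this, of complex_of_real] show ?thesis by simp
    qed
    then show ?thesis
      unfolding lenard_seq_lead[OF assms(1,2)] assms(3) r(2) by (metis mult.assoc)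
  qed
  then have "b (Suc n) $$ (- 4 * int (Suc n)) = of_real s * b 0 $$ 0"
    by (simp only: mult_cancel_left mult_eq_0_iff of_nat_eq_0_iff) simp
  ultimately show ?case by blast
qed

text \<open>The coefficients of \<open>b j\<close> at exponents not divisible by 4 start at \<open>m + 4 - 4 * j\<close>;
  their leading one is \<open>U $$ m * b 0 $$ 0\<close> times a positive number up to \<open>j = k + 1\<close>, and
  nonzero ever after.\<close>

context
  fixes U :: "complex fls" and b :: "nat \<Rightarrow> complex fls" and m :: int
  assumes seq: "lenard_seq U b"
    and U: "\<forall>i<m. i \<noteq> -4 \<longrightarrow> i \<noteq> 0 \<longrightarrow> U $$ i = 0"
    and m: "-4 < m" "m < 4" "m \<noteq> 0"
begin

text \<open>An exponent not divisible by 4 arises from an earlier one, shifted by -4 or, through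
  \<open>U $$ 0\<close>, by nothing, or else from some \<open>U $$ i\<close> with i \<ge> m times a
  coefficient of exponent at least -4 j.\<close>

lemma lenard_seq_off_grading:
  assumes "n < m + 4 - 4 * int j" "\<not> 4 dvd n"
  shows "b j $$ n = 0"
  using assms
proof (induction j arbitrary: n)
  case 0
  then show ?case using lenard_seq_0_nth[OF seq, of n] by (cases "n = 0") auto
next
  case (Suc j)
  have Um: "\<forall>i< -4. U $$ i = 0" using U m by auto
  show ?case
  proof (rule lenard_seq_nth_eq_0[OF seq])
    show "U $$ i * b j $$ (n - i) = 0" for i
    proof (cases "i < m \<and> i \<noteq> -4 \<and> i \<noteq> 0")
      case True
      then show ?thesis using U by simp
    next
      case False
      then consider "m \<le> i" "i \<noteq> 0" | "i = -4" | "i = 0" by linarith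
      then show ?thesis
      proof cases
        case 1
        then have "n - i < - 4 * int j" using Suc.prems by simp
        then show ?thesis using lenard_seq_below[OF seq Um] by simp
      next
        case 2
        have "b j $$ (n + 4) = 0" using Suc by auto
        then show ?thesis using 2 by simp
      next
        case 3
        have "b j $$ n = 0" using Suc by auto
        then show ?thesis using 3 by simp
      qed
    qed
    show "b j $$ (n + 4) = 0" using Suc by auto
  qed (use Suc in auto)
qed

lemma lenard_seq_off_grading_step:
  defines "d \<equiv> (\<lambda>j. b j $$ (m + 4 - 4 * int j))"
  shows "of_int (4 * (m - 4 * int j)) * d (Suc j)
    = (of_int (4 * (m - 4 * int j) + 8) * U $$ (-4)
        - of_int ((m - 4 * int j + 4) * (m - 4 * int j + 3) * (m - 4 * int j + 2) * (m - 4 * int j + 1) * (m - 4 * int j))) * d j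
      + of_int (2 * m - 16 * int j) * U $$ m * b j $$ (- 4 * int j)"
proof -
  define n where "n = m - 4 * int j"
  have Um: "\<forall>i< -4. U $$ i = 0" using U m by auto
  have m4: "\<not> 4 dvd m" using m by presburger
  have z: "U $$ i * b j $$ (n - i) = 0" if "i \<notin> {-4, m}" for i
  proof (cases "i < m \<and> i \<noteq> 0")
    case True
    then show ?thesis using U that by simp
  next
    case False
    then have "m < i \<or> i = 0" using that by auto
    then consider "m < i" | "i = 0" by blast
    then show ?thesis
    proof cases
      case 1
      then have "n - i < - 4 * int j" by (simp add: n_def)
      then show ?thesis using lenard_seq_below[OF seq Um] by simp
    next
      case 2
      have "\<not> 4 dvd n" using m4 unfolding n_def by presburger
      then have "b j $$ n = 0"
        by (intro lenard_seq_off_grading) (auto simp: n_def)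
      then show ?thesis using 2 by simp
    qed
  qed
  have e: "n + 4 = m + 4 - 4 * int j" "n - m = - 4 * int j" "n = m + 4 - 4 * int (Suc j)" "-4 \<noteq> m"
    using m by (simp_all add: n_def)
  have "of_int (4 * n) * b (Suc j) $$ n = of_int (4 * n + 8) * U $$ (-4) * b j $$ (n + 4)
      + of_int (4 * n - 2 * m) * U $$ m * b j $$ (n - m)
      - of_int ((n + 4) * (n + 3) * (n + 2) * (n + 1) * n) * b j $$ (n + 4)"
    using lenard_seq_nth[OF seq, of "{-4, m}" j n] z e(4) by simp
  moreover have "4 * n - 2 * m = 2 * m - 16 * int j" by (simp add: n_def)
  ultimately show ?thesis
    unfolding d_def e(1)[symmetric] e(2)[symmetric] e(3)[symmetric] n_def[symmetric]
    by (simp only: left_diff_distrib mult.assoc diff_add_eq)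
qed

lemma lenard_seq_off_grading_1: "b 1 $$ m = U $$ m * b 0 $$ 0 / 2"
proof -
  have "b 0 $$ (m + 4) = 0" using lenard_seq_0_nth[OF seq] m by simp
  then have "of_int (4 * m) * b 1 $$ m = of_int (4 * m) * (U $$ m * b 0 $$ 0 / 2)"
    using lenard_seq_off_grading_step[of 0] by simp
  then show ?thesis using m by (simp add: mult.commute)
qed

text \<open>The second step is computed in closed form because the sign argument for the later ones
  needs -N - 4 \<ge> 0 at the exponent N. Here this number is -m and may be negative.\<close>

lemma lenard_seq_off_grading_2:
  "b 2 $$ (m - 4) = (3 * U $$ (-4) - of_int (m * (m - 1) * (m - 2) * (m - 3)) / 2) / 4 * (U $$ m * b 0 $$ 0)"
proof -
  have "\<forall>i< -4. U $$ i = 0" using U m by auto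
  from lenard_seq_lead[OF seq this, of 0] have c: "b 1 $$ (-4) = U $$ (-4) * b 0 $$ 0 / 2"
    by (simp add: crit_def mult.commute)
  have "of_int (4 * (m - 4)) * b 2 $$ (m - 4) = (of_int (4 * (m - 4) + 8) * U $$ (-4)
        - of_int (m * (m - 1) * (m - 2) * (m - 3) * (m - 4))) * (U $$ m * b 0 $$ 0 / 2)
      + of_int (2 * m - 16) * U $$ m * (U $$ (-4) * b 0 $$ 0 / 2)"
  proof -
    have e: "m - 4 * int 1 = m - 4" "m + 4 - 4 * int 1 = m" "m + 4 - 4 * int (Suc 1) = m - 4"
      "- 4 * int 1 = -4" "Suc 1 = 2" "m + 4 - 4 * int 2 = m - 4" "16 * int 1 = 16"
      "(m - 4 + 4) * (m - 4 + 3) * (m - 4 + 2) * (m - 4 + 1) * (m - 4) = m * (m - 1) * (m - 2) * (m - 3) * (m - 4)"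
      by simp_all
    show ?thesis
      using lenard_seq_off_grading_step[of 1] unfolding e c lenard_seq_off_grading_1 .
  qed
  also have "\<dots> = of_int (4 * (m - 4)) *
      ((3 * U $$ (-4) - of_int (m * (m - 1) * (m - 2) * (m - 3)) / 2) / 4 * (U $$ m * b 0 $$ 0))"
    by (simp add: field_simps)
  finally show ?thesis using m by (simp only: mult_cancel_left of_int_eq_0_iff) auto
qed

lemma lenard_seq_off_grading_pos:
  assumes k: "U $$ (-4) = of_nat (crit k)" "1 \<le> k"
  shows "n < k \<Longrightarrow> \<exists>r>0. b (n + 2) $$ (m - 4 - 4 * int n) = of_real r * (U $$ m * b 0 $$ 0)"
proof (induction n)
  case 0
  have pos: "0 < (3 * c - p / 2) / 4" if "p \<le> 360" "280 \<le> c" for c p :: real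
    using that by simp
  \<comment> \<open>The bound is attained at m = -3. It is outweighed by \<open>crit k\<close> \<ge>
    \<open>crit 1\<close> = 280, as 3 * 280 exceeds 360 / 2.\<close>
  have m360: "m * (m - 1) * (m - 2) * (m - 3) \<le> 360"
  proof -
    have "m \<in> {-3, -2, -1, 0, 1, 2, 3}" using m by auto
    then show ?thesis by auto
  qed
  have "real_of_int (m * (m - 1) * (m - 2) * (m - 3)) \<le> 360"
    using m360 by (metis of_int_le_iff of_int_numeral)
  moreover have "crit 1 \<le> crit k" using k crit_strict_mono by (simp add: strict_mono_less_eq)
  then have "real 280 \<le> real (crit k)" by (simp only: of_nat_le_iff) (simp add: crit_def[of "Suc 0"])
  then have "280 \<le> real (crit k)" by simp
  ultimately have "(3 * real (crit k) - real_of_int (m * (m - 1) * (m - 2) * (m - 3)) / 2) / 4 > 0"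
    by (rule pos)
  then show ?case
    using lenard_seq_off_grading_2 unfolding k(1) add_0 of_nat_0 mult_zero_right diff_zero
    by (intro exI[of _ "(3 * real (crit k) - real_of_int (m * (m - 1) * (m - 2) * (m - 3)) / 2) / 4"]) simp
next
  case (Suc n)
  then obtain r where r: "r > 0" "b (n + 2) $$ (m - 4 - 4 * int n) = of_real r * (U $$ m * b 0 $$ 0)"
    by auto
  have "\<forall>i< -4. U $$ i = 0" using U m by auto
  from lenard_seq_lead_pos[OF seq this k(1), of "n + 2"] Suc obtain s
    where s: "s > 0" "b (n + 2) $$ (- 4 * int (n + 2)) = of_real s * b 0 $$ 0" by auto
  define N where "N = m - 4 * int (n + 2)"
  define X where "X = (4 * N + 8) * int (crit k) - (N + 4) * (N + 3) * (N + 2) * (N + 1) * N"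
  define t where "t = (real_of_int X * r + real_of_int (2 * m - 16 * int (n + 2)) * s) / (4 * N)"
  have N: "N < 0" "0 \<le> - N - 4" "- N - 4 < 4 * int k" using Suc.prems m by (auto simp: N_def)
  \<comment> \<open>N + 2 is negative, and the quartic at -N - 4 < 4 k stays below its critical
    value, so X < 0. The factor of \<open>s\<close> is negative too, as is the divisor 4 N; hence
    both terms push \<open>t\<close> in the positive direction.\<close>
  have "X = (N + 2) * (int (4 * crit k) - (- N - 4) * (- N - 4 + 1) * (- N - 4 + 3) * (- N - 4 + 4))"
    by (simp add: X_def algebra_simps)
  also have "\<dots> < 0"
    using quartic_strict_mono[OF N(2,3)] N(2) unfolding crit_int by (intro mult_neg_pos) auto
  finally have "real_of_int X * r + real_of_int (2 * m - 16 * int (n + 2)) * s < 0"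
    using r s m by (intro add_neg_neg mult_neg_pos) auto
  then have t: "t > 0" using N by (simp add: t_def zero_less_divide_iff)
  have e: "m + 4 - 4 * int (n + 2) = m - 4 - 4 * int n"
    "m + 4 - 4 * int (Suc (n + 2)) = m - 4 - 4 * int (Suc n)" by simp_all
  have "of_int (4 * N) * b (Suc (n + 2)) $$ (m - 4 - 4 * int (Suc n))
     = of_int X * (of_real r * (U $$ m * b 0 $$ 0)) + of_int (2 * m - 16 * int (n + 2)) * U $$ m * (of_real s * b 0 $$ 0)"
    using lenard_seq_off_grading_step[of "n + 2"] unfolding e r(2) s(2) k(1) N_def[symmetric]
    by (simp add: X_def)
  also have "\<dots> = of_real (real_of_int X * r + real_of_int (2 * m - 16 * int (n + 2)) * s) * (U $$ m * b 0 $$ 0)"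
    by (simp add: algebra_simps)
  also have "real_of_int X * r + real_of_int (2 * m - 16 * int (n + 2)) * s = real_of_int (4 * N) * t"
    using N by (simp add: t_def)
  also have "of_real (real_of_int (4 * N) * t) * (U $$ m * b 0 $$ 0) = of_int (4 * N) * (of_real t * (U $$ m * b 0 $$ 0))"
    by (simp add: mult.assoc)
  finally have "b (Suc (n + 2)) $$ (m - 4 - 4 * int (Suc n)) = of_real t * (U $$ m * b 0 $$ 0)"
    using N by (simp only: mult_cancel_left of_int_eq_0_iff) auto
  with t show ?case by auto
qed

lemma lenard_seq_off_grading_nonzero:
  assumes k: "U $$ (-4) = of_nat (crit k)" "1 \<le> k" and nz: "U $$ m \<noteq> 0" "b 0 $$ 0 \<noteq> 0"
  shows "b (Suc j) $$ (m - 4 * int j) \<noteq> 0"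
proof (induction j)
  case 0
  have "b 1 $$ m \<noteq> 0" unfolding lenard_seq_off_grading_1 using nz by simp
  then show ?case by simp
next
  case (Suc j)
  show ?case
  proof (cases "j < k")
    case True
    from lenard_seq_off_grading_pos[OF k this] nz show ?thesis by (auto simp: algebra_simps)
  next
    case False
    have "\<forall>i< -4. U $$ i = 0" using U m by auto
    from lenard_seq_lead_zero[OF seq this k(1), of "Suc j"] False
    \<comment> \<open>From index k + 1 on the leading coefficients vanish and only the inherited
      term remains. Its factor X could be zero only for -N - 4 = 4 k, which would make m divisible
      by 4.\<close>
    have c: "b (Suc j) $$ (- 4 * int (Suc j)) = 0" by simp
    define N where "N = m - 4 * int (Suc j)"
    have N: "0 \<le> - N - 4" "- N - 4 \<noteq> 4 * int k" using False m k by (simp_all add: N_def) presburger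
    define X where "X = (4 * N + 8) * int (crit k) - (N + 4) * (N + 3) * (N + 2) * (N + 1) * N"
    have "X = (N + 2) * (int (4 * crit k) - (- N - 4) * (- N - 4 + 1) * (- N - 4 + 3) * (- N - 4 + 4))"
      by (simp add: X_def algebra_simps)
    moreover have "int (4 * crit k) \<noteq> (- N - 4) * (- N - 4 + 1) * (- N - 4 + 3) * (- N - 4 + 4)"
      using quartic_strict_mono[of "- N - 4" "4 * int k"] quartic_strict_mono[of "4 * int k" "- N - 4"] N
      unfolding crit_int by (cases "- N - 4 < 4 * int k") auto
    ultimately have X: "X \<noteq> 0" using N by auto
    have "of_int (4 * N) * b (Suc (Suc j)) $$ (m - 4 * int (Suc j)) = of_int X * b (Suc j) $$ (m - 4 * int j)"
      using lenard_seq_off_grading_step[of "Suc j"] unfolding c N_def[symmetric] k(1)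
      by (simp add: X_def N_def algebra_simps)
    then show ?thesis using X Suc.IH by auto
  qed
qed

end

text \<open>Every alternative to the asserted shape of \<open>U\<close> leaves a nonzero coefficient
  in \<open>b (Suc h)\<close>. In particular, if no critical value with k \<le> h were met, the
  leading coefficient would survive; k = 0 is excluded since \<open>crit 0\<close> = 0 while the
  pole has order exactly 4.\<close>

lemma lenard_seq_terminating:
  assumes seq: "lenard_seq U b" and "b 0 $$ 0 \<noteq> 0" "b (Suc h) = 0" "fls_subdegree U < 0"
  shows "fls_subdegree U = -4"
    and "\<exists>k\<in>{1..h}. U $$ (-4) = of_nat (crit k)"
    and "i \<in> {-3, -2, -1, 1, 2, 3} \<Longrightarrow> U $$ i = 0"
proof -
  define s where "s = fls_subdegree U"
  have U0: "\<forall>i<s. U $$ i = 0" by (simp add: s_def)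
  have Us: "U $$ s \<noteq> 0" using assms(4) nth_fls_subdegree_nonzero[of U] by (cases "U = 0") (auto simp: s_def)
  have "\<not> s < -4" using lenard_seq_high_pole[OF seq _ U0 Us assms(2), of "Suc h"] assms(3) by auto
  moreover have "\<not> s > -4" using lenard_seq_low_pole[OF seq _ _ U0 Us assms(2), of h] assms by (auto simp: s_def)
  ultimately have s: "s = -4" by simp
  then show "fls_subdegree U = -4" by (simp add: s_def)
  have U4: "\<forall>i< -4. U $$ i = 0" using U0 s by simp
  obtain k where k: "k < Suc h" "U $$ (-4) = of_nat (crit k)"
    using lenard_seq_lead_nonzero[OF seq U4 assms(2), of "Suc h"] assms(3) by auto
  have "k \<noteq> 0" using k Us s by (auto simp: crit_def intro: ccontr)
  then have k1: "1 \<le> k" by simp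
  then show "\<exists>k\<in>{1..h}. U $$ (-4) = of_nat (crit k)" using k by (intro bexI[of _ k]) auto
  have step: "U $$ m = 0" if "\<forall>i<m. i \<noteq> -4 \<longrightarrow> i \<noteq> 0 \<longrightarrow> U $$ i = 0" "-4 < m" "m < 4" "m \<noteq> 0" for m
    using lenard_seq_off_grading_nonzero[OF seq that k(2) k1 _ assms(2), of h] assms(3) by auto
  have "U $$ i = 0" if "i < m" "m \<le> 4" "i \<noteq> -4" "i \<noteq> 0" for i m
  proof -
    \<comment> \<open>\<open>step\<close> handles the first exponent not yet known to vanish, so the
      exponents are treated in increasing order; -4 and 0 are passed over.\<close>
    have "\<forall>i < int n - 4. i \<noteq> -4 \<longrightarrow> i \<noteq> 0 \<longrightarrow> U $$ i = 0" if "n \<le> 8" for n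
      using that
    proof (induction n)
      case 0
      then show ?case using U4 by simp
    next
      case (Suc n)
      then have IH: "i < int n - 4 \<Longrightarrow> i \<noteq> -4 \<Longrightarrow> i \<noteq> 0 \<Longrightarrow> U $$ i = 0" for i by simp
      have "U $$ (int n - 4) = 0" if "int n - 4 \<noteq> -4" "int n - 4 \<noteq> 0"
        by (rule step) (use IH that Suc.prems in auto)
      then show ?case using IH by (metis linorder_cases add_diff_eq diff_add_eq of_nat_Suc zless_add1_eq
        add.commute)
    qed
    from this[of 8] show ?thesis using that by auto
  qed
  from this[of i 4] show "i \<in> {-3, -2, -1, 1, 2, 3} \<Longrightarrow> U $$ i = 0" by auto
qed

section \<open>Global functions with one pole modulo the periods\<close>

lemma period_group_0: "0 \<in> period_group u"
  and period_group_add: "\<omega> \<in> period_group u \<Longrightarrow> \<omega>' \<in> period_group u \<Longrightarrow> \<omega> + \<omega>' \<in> period_group u"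
  and period_group_uminus: "\<omega> \<in> period_group u \<Longrightarrow> - \<omega> \<in> period_group u"
proof -
  show "0 \<in> period_group u" by (simp add: period_group_def)
  show "\<omega> + \<omega>' \<in> period_group u" if "\<omega> \<in> period_group u" "\<omega>' \<in> period_group u"
    using that by (simp add: period_group_def flip: add.assoc)
  show "- \<omega> \<in> period_group u" if "\<omega> \<in> period_group u"
  proof -
    have "u (x - \<omega>) = u x" for x
      using that unfolding period_group_def by (metis (mono_tags, lifting) diff_add_cancel mem_Collect_eq)
    then show ?thesis by (simp add: period_group_def)
  qed
qed

lemma is_pole_period:
  assumes "\<omega> \<in> period_group u"
  shows "is_pole u (b + \<omega>) \<longleftrightarrow> is_pole u b"
proof -
  have "u \<circ> (+) \<omega> = u" using assms by (auto simp: fun_eq_iff period_group_def add.commute)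
  then show ?thesis using is_pole_shift_iff[of u \<omega> b] by simp
qed

text \<open>The common form of the three kinds of potentials: the poles are one orbit of the period
  group, which may be trivial, and u is bounded at any fixed distance from them. The boundedness
  carries the condition at infinity and is what Liouville's theorem uses.\<close>

locale single_pole_potential =
  fixes u :: "complex \<Rightarrow> complex" and a :: complex
  assumes nicely_meromorphic: "u nicely_meromorphic_on UNIV"
    and pole: "is_pole u a"
    and all_poles: "is_pole u b \<Longrightarrow> b - a \<in> period_group u"
    and bounded_off_poles:
      "\<delta> > 0 \<Longrightarrow> \<exists>B. \<forall>x. (\<forall>\<omega>\<in>period_group u. \<delta> \<le> dist x (a + \<omega>)) \<longrightarrow> norm (u x) \<le> B"
begin

definition poles :: "complex set" where "poles = (\<lambda>\<omega>. a + \<omega>) ` period_group u"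

definition regular_pts :: "complex set" where "regular_pts = - poles"

lemma is_pole_iff: "is_pole u b \<longleftrightarrow> b \<in> poles"
proof
  assume "is_pole u b"
  then have "b - a \<in> period_group u" by (rule all_poles)
  moreover have "b = a + (b - a)" by simp
  ultimately show "b \<in> poles" unfolding poles_def by blast
next
  assume "b \<in> poles"
  then obtain \<omega> where w: "\<omega> \<in> period_group u" "b = a + \<omega>" by (auto simp: poles_def)
  then show "is_pole u b" using is_pole_period pole by blast
qed

lemma pole_in_poles: "a \<in> poles" using is_pole_iff pole by blast

lemma poles_translate: "\<omega> \<in> period_group u \<Longrightarrow> x + \<omega> \<in> poles \<longleftrightarrow> x \<in> poles"
proof -
  have 1: "x + \<omega> \<in> poles" if "\<omega> \<in> period_group u" "x \<in> poles" for x \<omega>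
    using that period_group_add unfolding poles_def by (auto simp: add.assoc)
  assume "\<omega> \<in> period_group u"
  then show ?thesis using 1[of \<omega> x] 1[of "- \<omega>" "x + \<omega>"] period_group_uminus by auto
qed

lemma regular_translate: "\<omega> \<in> period_group u \<Longrightarrow> x + \<omega> \<in> regular_pts \<longleftrightarrow> x \<in> regular_pts"
  using poles_translate by (simp add: regular_pts_def)

lemma u_meromorphic: "u meromorphic_on UNIV"
  using nicely_meromorphic by (simp add: nicely_meromorphic_on_def)

lemma u_analytic: "u analytic_on regular_pts"
  using nicely_meromorphic is_pole_iff unfolding regular_pts_def
  by (intro nicely_meromorphic_without_singularities)
     (auto intro: nicely_meromorphic_on_subset)

text \<open>A period moves any pole back to \<open>a\<close>, so a single radius serves for all
  poles.\<close>

lemma uniformly_discrete: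
  obtains r where "r > 0" "\<And>p q. p \<in> poles \<Longrightarrow> q \<in> poles \<Longrightarrow> dist p q < r \<Longrightarrow> p = q"
proof -
  have "isolated_singularity_at u a"
    using u_meromorphic by (meson UNIV_I meromorphic_on_isolated_singularity meromorphic_on_subset subset_UNIV)
  then obtain r where r: "r > 0" "u analytic_on ball a r - {a}"
    unfolding isolated_singularity_at_def by blast
  have 1: "p = a" if "p \<in> poles" "dist a p < r" for p
  proof (rule ccontr)
    assume "p \<noteq> a"
    then have "u analytic_on {p}" using r that by (auto intro: analytic_on_subset)
    then have "\<not> is_pole u p" using analytic_at_imp_no_pole by blast
    then show False using is_pole_iff that by blast
  qed
  have "p = q" if pq: "p \<in> poles" "q \<in> poles" "dist p q < r" for p q
  proof -
    obtain \<omega> where w: "\<omega> \<in> period_group u" "p = a + \<omega>" using pq by (auto simp: poles_def)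
    have "q - \<omega> \<in> poles" using pq w poles_translate[of "- \<omega>" q] period_group_uminus by simp
    moreover have "dist a (q - \<omega>) < r" using pq w by (simp add: dist_norm algebra_simps)
    ultimately have "q - \<omega> = a" using 1 by blast
    then show "p = q" using w by (simp add: algebra_simps)
  qed
  then show ?thesis using that r by blast
qed

lemma open_regular: "open regular_pts"
proof -
  obtain r where r: "r > 0" "\<And>p q. p \<in> poles \<Longrightarrow> q \<in> poles \<Longrightarrow> dist p q < r \<Longrightarrow> p = q"
    using uniformly_discrete by blast
  have "closed poles" by (rule discrete_imp_closed[of r]) (use r in auto)
  then show ?thesis by (simp add: regular_pts_def open_Compl)
qed

lemma regular_nhds: "x \<in> regular_pts \<Longrightarrow> eventually (\<lambda>y. y \<in> regular_pts) (nhds x)"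
  using open_regular by (rule eventually_nhds_in_open)

text \<open>A differential ring containing u to which Liouville's theorem applies. Bounds are
  required at every distance \<delta> from the poles so that Cauchy's estimate can give up half of
  \<delta>. The values at the poles are left free, which makes pointwise sums and products tame
  again.\<close>

definition tame :: "(complex \<Rightarrow> complex) \<Rightarrow> bool" where
  "tame f \<longleftrightarrow> f holomorphic_on regular_pts \<and> f meromorphic_on UNIV \<and>
     (\<forall>\<omega>\<in>period_group u. \<forall>x\<in>regular_pts. f (x + \<omega>) = f x) \<and>
     (\<forall>\<delta>>0. \<exists>B. \<forall>x. (\<forall>p\<in>poles. \<delta> \<le> dist x p) \<longrightarrow> norm (f x) \<le> B)"

lemma tame_u: "tame u"
  using u_analytic u_meromorphic bounded_off_poles
  unfolding tame_def by (auto simp: analytic_imp_holomorphic period_group_def poles_def)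

lemma tame_const: "tame (\<lambda>_. c)"
  unfolding tame_def by auto

lemma tame_add: assumes "tame f" "tame g" shows "tame (\<lambda>x. f x + g x)"
  unfolding tame_def
proof (intro conjI allI impI)
  fix \<delta> :: real assume "\<delta> > 0"
  then obtain B C where "\<And>x. (\<forall>p\<in>poles. \<delta> \<le> dist x p) \<Longrightarrow> norm (f x) \<le> B"
    "\<And>x. (\<forall>p\<in>poles. \<delta> \<le> dist x p) \<Longrightarrow> norm (g x) \<le> C"
    using assms unfolding tame_def by metis
  then show "\<exists>B. \<forall>x. (\<forall>p\<in>poles. \<delta> \<le> dist x p) \<longrightarrow> norm (f x + g x) \<le> B"
    by (intro exI[of _ "B + C"]) (meson norm_triangle_mono)
qed (use assms in \<open>auto simp: tame_def intro!: holomorphic_intros meromorphic_intros\<close>)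

lemma tame_mult: assumes "tame f" "tame g" shows "tame (\<lambda>x. f x * g x)"
  unfolding tame_def
proof (intro conjI allI impI)
  fix \<delta> :: real assume "\<delta> > 0"
  then obtain B C where BC: "\<And>x. (\<forall>p\<in>poles. \<delta> \<le> dist x p) \<Longrightarrow> norm (f x) \<le> B"
    "\<And>x. (\<forall>p\<in>poles. \<delta> \<le> dist x p) \<Longrightarrow> norm (g x) \<le> C"
    using assms unfolding tame_def by metis
  have "norm (f x * g x) \<le> B * C" if "\<forall>p\<in>poles. \<delta> \<le> dist x p" for x
    unfolding norm_mult by (rule mult_mono) (use BC[OF that] norm_ge_zero order_trans in blast)+
  then show "\<exists>B. \<forall>x. (\<forall>p\<in>poles. \<delta> \<le> dist x p) \<longrightarrow> norm (f x * g x) \<le> B" by blast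
qed (use assms in \<open>auto simp: tame_def intro!: holomorphic_intros meromorphic_intros\<close>)

lemma tame_deriv: assumes "tame f" shows "tame (deriv f)"
  unfolding tame_def
proof (intro conjI allI impI ballI)
  have hol: "f holomorphic_on regular_pts" using assms by (simp add: tame_def)
  then show "deriv f holomorphic_on regular_pts" using open_regular by (rule holomorphic_deriv)
  show "deriv f meromorphic_on UNIV" using assms by (auto simp: tame_def intro: meromorphic_intros)
  fix \<delta> :: real assume "\<delta> > 0"
  then have d2: "\<delta> / 2 > 0" by simp
  then obtain B where B: "\<And>x. (\<forall>p\<in>poles. \<delta> / 2 \<le> dist x p) \<Longrightarrow> norm (f x) \<le> B"
    using assms unfolding tame_def by metis
  have "norm (deriv f x) \<le> fact 1 * B / (\<delta> / 2) ^ 1" if x: "\<forall>p\<in>poles. \<delta> \<le> dist x p" for x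
  proof -
    have *: "\<forall>p\<in>poles. \<delta> / 2 \<le> dist y p" if "dist x y \<le> \<delta> / 2" for y
    proof
      fix p assume "p \<in> poles"
      then show "\<delta> / 2 \<le> dist y p"
        using x that dist_triangle[of x p y] by fastforce
    qed
    have sub: "cball x (\<delta> / 2) \<subseteq> regular_pts"
      unfolding regular_pts_def using * d2 by fastforce
    have "norm ((deriv ^^ 1) f x) \<le> fact 1 * B / (\<delta> / 2) ^ 1"
    proof (rule Cauchy_inequality)
      show "f holomorphic_on ball x (\<delta> / 2)" using hol sub ball_subset_cball holomorphic_on_subset by blast
      show "continuous_on (cball x (\<delta> / 2)) f" using hol sub holomorphic_on_imp_continuous_on holomorphic_on_subset by blast
      show "norm (f y) \<le> B" if "norm (x - y) = \<delta> / 2" for y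
        using B * that by (simp add: dist_norm)
    qed (use d2 in auto)
    then show ?thesis by simp
  qed
  then show "\<exists>B. \<forall>x. (\<forall>p\<in>poles. \<delta> \<le> dist x p) \<longrightarrow> norm (deriv f x) \<le> B" by blast
next
  fix \<omega> x assume w: "\<omega> \<in> period_group u" and x: "x \<in> regular_pts"
  have "deriv f (x + \<omega>) = deriv (\<lambda>y. f (y + \<omega>)) x"
    unfolding deriv_shift_0[of f "x + \<omega>"] deriv_shift_0[of "\<lambda>y. f (y + \<omega>)" x]
    by (simp add: o_def add_ac)
  also have "\<dots> = deriv f x"
  proof (rule deriv_cong_ev)
    show "\<forall>\<^sub>F y in nhds x. f (y + \<omega>) = f y"
      using regular_nhds[OF x] by eventually_elim (use assms w in \<open>auto simp: tame_def\<close>)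
  qed simp
  finally show "deriv f (x + \<omega>) = deriv f x" .
qed

lemma tame_cmult: "tame f \<Longrightarrow> tame (\<lambda>x. c * f x)"
  using tame_mult[OF tame_const] .

lemma tame_uminus: "tame f \<Longrightarrow> tame (\<lambda>x. - f x)"
  using tame_cmult[of f "-1"] by simp

lemma tame_diff: "tame f \<Longrightarrow> tame g \<Longrightarrow> tame (\<lambda>x. f x - g x)"
  using tame_add[of f "\<lambda>x. - g x"] tame_uminus by simp

lemma tame_sum: "(\<And>i. i \<in> A \<Longrightarrow> tame (f i)) \<Longrightarrow> tame (\<lambda>x. \<Sum>i\<in>A. f i x)"
  by (induction A rule: infinite_finite_induct) (auto intro: tame_const tame_add)

lemma tame_higher_deriv: "tame f \<Longrightarrow> tame ((deriv ^^ n) f)"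
  by (induction n) (auto intro: tame_deriv)

lemma tame_laurent: "tame f \<Longrightarrow> (\<lambda>w. f (a + w)) has_laurent_expansion laurent_expansion f a"
  unfolding tame_def by (auto intro: meromorphic_on_imp_has_laurent_expansion)

text \<open>Without negative exponents f has a limit at \<open>a\<close>, and periodicity carries
  the same limit to every pole. Removing the singularities gives an entire function g, to which
  Liouville's theorem applies.\<close>

lemma tame_constant:
  assumes f: "tame f" and F: "\<And>n. n < 0 \<Longrightarrow> laurent_expansion f a $$ n = 0" and x: "x \<in> regular_pts"
  shows "f x = laurent_expansion f a $$ 0"
proof -
  define c where "c = laurent_expansion f a $$ 0"
  have per: "f (x + \<omega>) = f x" if "\<omega> \<in> period_group u" "x \<in> regular_pts" for x \<omega>
    using f that by (simp add: tame_def)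
  have "(\<lambda>w. f (a + w)) \<midarrow>0\<rightarrow> c"
    unfolding c_def
    by (rule has_laurent_expansion_imp_tendsto_0[OF tame_laurent[OF f]])
       (use F in \<open>cases "laurent_expansion f a = 0", auto intro: fls_subdegree_geI\<close>)
  then have lim_a: "f \<midarrow>a\<rightarrow> c" using LIM_offset_zero_cancel by blast
  have lim: "f \<midarrow>p\<rightarrow> c" if p: "p \<in> poles" for p
  proof -
    obtain \<omega> where w: "\<omega> \<in> period_group u" "p = a + \<omega>" using p by (auto simp: poles_def)
    obtain r where r: "r > 0" "\<And>p q. p \<in> poles \<Longrightarrow> q \<in> poles \<Longrightarrow> dist p q < r \<Longrightarrow> p = q"
      using uniformly_discrete by blast
    have "(\<lambda>x. f (x - \<omega>)) \<midarrow>a + \<omega>\<rightarrow> c" using LIM_offset[OF lim_a, of "- \<omega>"] by simp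
    moreover have "\<forall>\<^sub>F x in at p. f (x - \<omega>) = f x"
      unfolding eventually_at
    proof (intro exI[of _ r] conjI ballI impI)
      fix x assume "x \<noteq> p \<and> dist x p < r"
      then have "x \<in> regular_pts" using r that by (auto simp: regular_pts_def)
      then show "f (x - \<omega>) = f x" using per[of "- \<omega>" x] w period_group_uminus by simp
    qed fact
    ultimately show ?thesis unfolding w(2) by (rule Lim_transform_eventually)
  qed
  define g where "g = remove_sings f"
  have mero: "f meromorphic_on UNIV" and hol: "f holomorphic_on regular_pts" using f by (auto simp: tame_def)
  have g_eq: "g x = f x" if "x \<in> regular_pts" for x
    unfolding g_def using hol that open_regular
    by (intro remove_sings_at_analytic) (meson analytic_at)
  have g_pole: "g p = c" if "p \<in> poles" for p
    unfolding g_def using lim[OF that] by (rule remove_sings_eqI)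
  have "g analytic_on UNIV"
  proof (rule nicely_meromorphic_without_singularities)
    show "g nicely_meromorphic_on UNIV" unfolding g_def using mero by (rule remove_sings_nicely_meromorphic)
    have "\<not> is_pole f z" for z
    proof (cases "z \<in> poles")
      case True
      then show ?thesis using lim not_tendsto_and_filterlim_at_infinity[of "at z" f]
        unfolding is_pole_def by auto
    next
      case False
      then have "f analytic_on {z}"
        using hol open_regular by (auto simp: regular_pts_def analytic_at)
      then show ?thesis using analytic_at_imp_no_pole by blast
    qed
    then show "\<forall>z\<in>UNIV. \<not> is_pole g z"
      unfolding g_def using mero
      by (metis UNIV_I is_pole_remove_sings_iff meromorphic_onE)
  qed
  then have entire: "g holomorphic_on UNIV" by (rule analytic_imp_holomorphic)
  \<comment> \<open>Within distance 1 of a pole some period moves the point into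
    \<open>cball a 1\<close>, where continuity bounds g; elsewhere tameness does.\<close>
  have "bounded (range g)"
  proof -
    have "continuous_on (cball a 1) g" using entire holomorphic_on_imp_continuous_on holomorphic_on_subset by blast
    then have "compact (g ` cball a 1)" using compact_cball compact_continuous_image by blast
    then obtain B1 where B1: "\<And>x. x \<in> cball a 1 \<Longrightarrow> norm (g x) \<le> B1"
      using compact_imp_bounded bounded_iff by (metis imageI)
    obtain B2 where B2: "\<And>x. (\<forall>p\<in>poles. 1 \<le> dist x p) \<Longrightarrow> norm (f x) \<le> B2"
      using f unfolding tame_def by (metis zero_less_one)
    have "norm (g x) \<le> max B1 B2" for x
    proof (cases "\<forall>p\<in>poles. 1 \<le> dist x p")
      case True
      then have "x \<in> regular_pts" by (force simp: regular_pts_def)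
      then show ?thesis using B2[OF True] g_eq by simp
    next
      case False
      then obtain \<omega> where w: "\<omega> \<in> period_group u" "dist x (a + \<omega>) < 1"
        by (auto simp: poles_def not_le)
      have "g x = g (x - \<omega>)"
      proof (cases "x \<in> poles")
        case True
        then have "x - \<omega> \<in> poles" using poles_translate[of "- \<omega>" x] w period_group_uminus by simp
        then show ?thesis using True g_pole by simp
      next
        case False
        then have "x \<in> regular_pts" "x - \<omega> \<in> regular_pts"
          using regular_translate[of "- \<omega>" x] w period_group_uminus by (auto simp: regular_pts_def)
        then show ?thesis using per[of "- \<omega>" x] w period_group_uminus g_eq by simp
      qed
      moreover have "x - \<omega> \<in> cball a 1" using w by (simp add: dist_norm algebra_simps norm_minus_commute)
      ultimately show ?thesis using B1 by (metis max.coboundedI1)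
    qed
    then show ?thesis unfolding bounded_iff by blast
  qed
  then obtain d where "\<And>z. g z = d" using Liouville_theorem[OF entire] unfolding constant_on_def by blast
  then show ?thesis using g_eq[OF x] g_pole[OF pole_in_poles] c_def by metis
qed

end

section \<open>Tame functions through their Laurent series\<close>

lemma has_laurent_expansion_deriv_at:
  assumes "(\<lambda>w. f (z + w)) has_laurent_expansion F"
  shows "(\<lambda>w. deriv f (z + w)) has_laurent_expansion fls_deriv F"
proof -
  have "deriv (\<lambda>w. f (z + w)) = (\<lambda>w. deriv f (z + w))"
    unfolding deriv_shift_0[of f "z + _"] deriv_shift_0[of "\<lambda>w. f (z + w)"] by (simp add: o_def add_ac)
  then show ?thesis using has_laurent_expansion_deriv[OF assms] by simp
qed

context single_pole_potential
begin

text \<open>Computations take place in the field of Laurent series at \<open>a\<close>. The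
  expansion determines a tame function on \<open>regular_pts\<close>, as \<open>tame_eqI\<close>
  shows, so identities of series can be carried back.\<close>

definition tame_series :: "complex fls set" where
  "tame_series = {laurent_expansion f a | f. tame f}"

lemma tame_seriesI: "tame f \<Longrightarrow> (\<lambda>w. f (a + w)) has_laurent_expansion F \<Longrightarrow> F \<in> tame_series"
  unfolding tame_series_def using laurent_expansion_eqI by blast

lemma tame_seriesE:
  assumes "F \<in> tame_series"
  obtains f where "tame f" "(\<lambda>w. f (a + w)) has_laurent_expansion F"
  using assms tame_laurent unfolding tame_series_def by blast

lemma tame_series_const: "fls_const c \<in> tame_series"
  by (rule tame_seriesI[OF tame_const]) (rule has_laurent_expansion_const)

lemma tame_series_add:
  assumes "F \<in> tame_series" "G \<in> tame_series"
  shows "F + G \<in> tame_series"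
proof -
  obtain f g where "tame f" "(\<lambda>w. f (a + w)) has_laurent_expansion F"
    "tame g" "(\<lambda>w. g (a + w)) has_laurent_expansion G"
    using assms by (elim tame_seriesE) blast
  then show ?thesis
    by (intro tame_seriesI[OF tame_add[of f g]] laurent_expansion_intros)
qed

lemma tame_series_diff:
  assumes "F \<in> tame_series" "G \<in> tame_series"
  shows "F - G \<in> tame_series"
proof -
  obtain f g where "tame f" "(\<lambda>w. f (a + w)) has_laurent_expansion F"
    "tame g" "(\<lambda>w. g (a + w)) has_laurent_expansion G"
    using assms by (elim tame_seriesE) blast
  then show ?thesis
    by (intro tame_seriesI[OF tame_diff[of f g]] laurent_expansion_intros)
qed

lemma tame_series_mult:
  assumes "F \<in> tame_series" "G \<in> tame_series"
  shows "F * G \<in> tame_series"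
proof -
  obtain f g where "tame f" "(\<lambda>w. f (a + w)) has_laurent_expansion F"
    "tame g" "(\<lambda>w. g (a + w)) has_laurent_expansion G"
    using assms by (elim tame_seriesE) blast
  then show ?thesis
    by (intro tame_seriesI[OF tame_mult[of f g]] laurent_expansion_intros)
qed

lemma tame_series_numeral: "numeral n \<in> tame_series"
  using tame_series_const[of "numeral n"] by simp

lemma tame_series_0: "0 \<in> tame_series" and tame_series_1: "1 \<in> tame_series"
  using tame_series_const[of 0] tame_series_const[of 1] by simp_all

lemma tame_series_sum: "(\<And>i. i \<in> A \<Longrightarrow> F i \<in> tame_series) \<Longrightarrow> sum F A \<in> tame_series"
  by (induction A rule: infinite_finite_induct) (auto intro: tame_series_0 tame_series_add)

lemma tame_series_deriv: "F \<in> tame_series \<Longrightarrow> fls_deriv F \<in> tame_series"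
  by (elim tame_seriesE, rule tame_seriesI[OF tame_deriv]) (auto intro: has_laurent_expansion_deriv_at)

lemma tame_series_higher_deriv: "F \<in> tame_series \<Longrightarrow> (fls_deriv ^^ n) F \<in> tame_series"
  by (induction n) (auto intro: tame_series_deriv)

lemma tame_series_u: "laurent_expansion u a \<in> tame_series"
  by (rule tame_seriesI[OF tame_u tame_laurent[OF tame_u]])

lemma tame_series_constant:
  assumes "F \<in> tame_series" "\<And>n. n < 0 \<Longrightarrow> F $$ n = 0"
  shows "F = fls_const (F $$ 0)"
proof -
  from assms(1) obtain f where f: "tame f" "(\<lambda>w. f (a + w)) has_laurent_expansion F"
    by (rule tame_seriesE)
  then have F: "laurent_expansion f a = F" by (auto intro: laurent_expansion_eqI)
  have fc: "f x = F $$ 0" if "x \<in> regular_pts" for x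
    using tame_constant[OF f(1) _ that] assms(2) by (simp add: F)
  obtain r where r: "r > 0" "\<And>p q. p \<in> poles \<Longrightarrow> q \<in> poles \<Longrightarrow> dist p q < r \<Longrightarrow> p = q"
    using uniformly_discrete by blast
  have "\<forall>\<^sub>F w in at 0. f (a + w) = F $$ 0"
    unfolding eventually_at
  proof (intro exI[of _ r] conjI ballI impI)
    fix w :: complex assume "w \<noteq> 0 \<and> dist w 0 < r"
    then have "a + w \<in> regular_pts"
      using r(2)[of "a + w" a] pole_in_poles by (auto simp: regular_pts_def dist_norm)
    then show "f (a + w) = F $$ 0" by (rule fc)
  qed (use r in auto)
  then have "(\<lambda>w. F $$ 0) has_laurent_expansion F"
    using has_laurent_expansion_cong[of "\<lambda>w. f (a + w)" "\<lambda>_. F $$ 0" F F] f(2) by simp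
  then show ?thesis using has_laurent_expansion_const has_laurent_expansion_unique by blast
qed

lemma tame_eqI:
  assumes "tame f" "(\<lambda>w. f (a + w)) has_laurent_expansion F"
    and "tame g" "(\<lambda>w. g (a + w)) has_laurent_expansion F" and "x \<in> regular_pts"
  shows "f x = g x"
proof -
  have "(\<lambda>w. f (a + w) - g (a + w)) has_laurent_expansion F - F"
    using assms by (intro laurent_expansion_intros)
  then have "laurent_expansion (\<lambda>x. f x - g x) a = 0" by (intro laurent_expansion_eqI) simp
  then show ?thesis using tame_constant[OF tame_diff[OF assms(1,3)] _ assms(5)] by simp
qed

text \<open>\<open>u'''' - A u\<^sup>2 - B u\<close> has no pole for suitable \<open>A\<close> and \<open>B\<close>, hence is constant.  The
  resulting differential equation determines the coefficients at exponents not divisible by 4,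
  since the resonance polynomial \<open>m (m - 1) (m - 2) (m - 3) - 1680\<close> vanishes only at
  \<open>m = 8\<close> and \<open>m = -5\<close>.\<close>

lemma off_grading_vanish:
  defines "U \<equiv> laurent_expansion u a"
  assumes low: "\<forall>i< -4. U $$ i = 0" and nz: "U $$ (-4) \<noteq> 0"
    and small: "\<forall>i\<in>{-3, -2, -1, 1, 2, 3}. U $$ i = 0"
    and m: "\<not> 4 dvd m"
  shows "U $$ m = 0"
proof -
  \<comment> \<open>\<open>A\<close> matches the coefficient (-4) (-5) (-6) (-7) = 840 of u'''' at
    exponent -8. \<open>C\<close> then cancels, at exponent -4, the doubled cross term of the
    leading and the constant coefficient in \<open>U * U\<close>.\<close>
  define A where "A = 840 / U $$ (-4)"
  define C where "C = - 2 * A * U $$ 0"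
  define F where "F = (fls_deriv ^^ 4) U - fls_const A * (U * U) - fls_const C * U"
  have D4: "(fls_deriv ^^ 4) U $$ n = of_int ((n + 1) * (n + 2) * (n + 3) * (n + 4)) * U $$ (n + 4)" for n
    by (simp add: eval_nat_numeral add.commute mult.commute mult.left_commute)
  have small': "U $$ i = 0" if "-4 < i" "i < 4" "i \<noteq> 0" for i
  proof -
    have "i \<in> {-3, -2, -1, 1, 2, 3}" using that by auto
    then show ?thesis using small by blast
  qed
  have F_nth: "F $$ n = of_int ((n + 1) * (n + 2) * (n + 3) * (n + 4)) * U $$ (n + 4)
      - A * (U * U) $$ n - C * U $$ n" for n
    by (simp only: F_def fls_minus_nth D4 fls_mult_const_nth)
  have AU: "A * U $$ (-4) = 840" using nz by (simp add: A_def)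
  have Fn: "F $$ n = 0" if n: "n < 0" for n
  proof -
    have UU: "(U * U) $$ n = U $$ (-4) * U $$ (n + 4) + U $$ 0 * U $$ n"
    proof -
      have "U $$ i * U $$ (n - i) = 0" if "i \<notin> {-4, 0}" for i
      proof (cases "i < 4")
        case True
        then show ?thesis using low small' that by (cases "i < -4") auto
      next
        case False
        then show ?thesis using low n by auto
      qed
      then have "(U * U) $$ n = (\<Sum>i\<in>{-4, 0}. U $$ i * U $$ (n - i))"
        by (intro fls_nth_mult_finite_support) auto
      then show ?thesis by simp
    qed
    have "F $$ n = of_int ((n + 1) * (n + 2) * (n + 3) * (n + 4)) * U $$ (n + 4)
        - 840 * U $$ (n + 4) + A * U $$ 0 * U $$ n"
      unfolding F_nth UU AU[symmetric] by (simp add: C_def algebra_simps)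
    moreover consider "n = -8" | "n = -4" | "U $$ (n + 4) = 0" "U $$ n = 0"
    proof (cases "n = -8 \<or> n = -4")
      case False
      have "U $$ (n + 4) = 0"
        using low small'[of "n + 4"] False n by (cases "n < -8") auto
      moreover have "U $$ n = 0" using low small'[of n] False n by (cases "n < -4") auto
      ultimately show ?thesis using that by blast
    qed (use that in blast)
    then show ?thesis
      by cases (use low AU calculation in \<open>auto simp: mult.commute mult.left_commute\<close>)
  qed
  have "F \<in> tame_series"
    unfolding F_def U_def
    by (intro tame_series_diff tame_series_mult tame_series_higher_deriv tame_series_u tame_series_const)
  from tame_series_constant[OF this Fn] have F: "F $$ n = 0" if "n \<noteq> 0" for n
    using that by (metis fls_const_nth)
  have "\<not> 4 dvd int k \<Longrightarrow> U $$ int k = 0" for k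
  proof (induction k rule: less_induct)
    case (less k)
    show ?case
    proof (cases "k < 4")
      case True
      then show ?thesis using small' less by (cases "k = 0") auto
    next
      case False
      define n where "n = int k - 4"
      have IH: "U $$ i = 0" if "i < int k" "\<not> 4 dvd i" for i
      proof (cases "i < 0")
        case True
        then show ?thesis using low small'[of i] that by (cases "i < -4"; cases "i = -4") auto
      next
        case False
        then show ?thesis using less.IH[of "nat i"] that by auto
      qed
      have k4: "\<not> 4 dvd int k" "\<not> 4 dvd n" using less unfolding n_def by presburger+
      \<comment> \<open>As 4 does not divide n, one of i and n - i is not divisible by 4 and falls
        under the induction hypothesis. The coefficient at k occurs twice in the square, which turns
        840 into 1680.\<close>
      have "U $$ i * U $$ (n - i) = 0" if "i \<notin> {-4, int k}" for i
      proof (cases "4 dvd i")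
        case True
        then have "\<not> 4 dvd (n - i)" using k4 by (metis dvd_diff_commute dvd_diff_left_iff)
        then show ?thesis using low IH[of "n - i"] that by (cases "i < -4") (auto simp: n_def)
      next
        case False
        then show ?thesis using low IH[of i] that by (cases "i < int k") (auto simp: n_def)
      qed
      then have "(U * U) $$ n = (\<Sum>i\<in>{-4, int k}. U $$ i * U $$ (n - i))"
        by (intro fls_nth_mult_finite_support) auto
      then have UU: "(U * U) $$ n = 2 * (U $$ (-4) * U $$ int k)" using False by (simp add: n_def)
      have "n \<noteq> 0" using k4 by auto
      then have "0 = of_int ((n + 1) * (n + 2) * (n + 3) * (n + 4)) * U $$ (n + 4) - A * (U * U) $$ n - C * U $$ n"
        using F F_nth by simp
      also have "\<dots> = of_int ((n + 1) * (n + 2) * (n + 3) * (n + 4) - 1680) * U $$ int k"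
        unfolding UU using IH[of n] k4 AU by (simp add: n_def algebra_simps)
      finally have "of_int ((n + 1) * (n + 2) * (n + 3) * (n + 4) - 1680) * U $$ int k = 0" by simp
      moreover have "(n + 1) * (n + 2) * (n + 3) * (n + 4) - 1680 \<noteq> 0"
      proof -
        have n0: "0 \<le> n" using False by (simp add: n_def)
        have "n \<noteq> 4" using k4 by auto
        then consider "n \<in> {0, 1, 2, 3}" | "5 \<le> n" using n0 by fastforce
        then show ?thesis
        proof cases
          case 1
          then show ?thesis by auto
        next
          case 2
          then have "6 * 7 * 8 * 9 \<le> (n + 1) * (n + 2) * (n + 3) * (n + 4)"
            by (intro mult_mono) auto
          then show ?thesis by simp
        qed
      qed
      ultimately show ?thesis by (metis mult_eq_0_iff of_int_eq_0_iff)
    qed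
  qed
  from this[of "nat m"] show ?thesis
    using m low small'[of m] by (cases "m < 0"; cases "m < -4"; cases "m = -4") auto
qed

end

section \<open>Differential polynomials solving the recursion\<close>

text \<open>The sequence of coefficients of the solution \<open>Q = 1 + O(t)\<close> of the first integral
  \<open>4 (1 - t U) Q\<^sup>2 + t (2 Q Q'''' - 2 Q' Q''' + Q''\<^sup>2) = 4\<close> of the linear equation
  \<open>4 (1 - t U) Q' - 2 t U' Q + t Q''''' = 0\<close>.  Unlike the linear equation it needs no integration,
  so that all coefficients are differential polynomials in \<open>U\<close>.\<close>

fun alpha :: "complex fls \<Rightarrow> nat \<Rightarrow> complex fls" where
  "alpha U 0 = 1"
| "alpha U (Suc k) = fls_const (1/8) *
     ((\<Sum>i\<in>{0..k}. 4 * (U * (alpha U i * alpha U (k - i)))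
         - 2 * (alpha U i * (fls_deriv ^^ 4) (alpha U (k - i)))
         + 2 * ((fls_deriv ^^ 1) (alpha U i) * (fls_deriv ^^ 3) (alpha U (k - i)))
         - (fls_deriv ^^ 2) (alpha U i) * (fls_deriv ^^ 2) (alpha U (k - i)))
      - (\<Sum>i\<in>{1..k}. 4 * (alpha U i * alpha U (Suc k - i))))"

text \<open>Differentiation in x of a power series in t whose coefficients are Laurent series in x;
  the variable t is \<open>fps_X\<close> and counts as a constant.\<close>

definition fps_coeff_deriv :: "'a::comm_ring_1 fls fps \<Rightarrow> 'a fls fps" where
  "fps_coeff_deriv F = Abs_fps (\<lambda>n. fls_deriv (F $ n))"

lemma fps_coeff_deriv_add: "fps_coeff_deriv (F + G) = fps_coeff_deriv F + fps_coeff_deriv G"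
  and fps_coeff_deriv_diff: "fps_coeff_deriv (F - G) = fps_coeff_deriv F - fps_coeff_deriv G"
  by (auto simp: fps_coeff_deriv_def fps_eq_iff)

lemma fps_coeff_deriv_mult:
  "fps_coeff_deriv (F * G) = fps_coeff_deriv F * G + F * fps_coeff_deriv G"
  by (rule fps_ext)
     (simp add: fps_coeff_deriv_def fps_mult_nth fls_deriv_sum sum.distrib)

lemma fps_coeff_deriv_X [simp]: "fps_coeff_deriv fps_X = 0"
  by (rule fps_ext) (simp add: fps_coeff_deriv_def fps_X_def)

lemma fps_coeff_deriv_numeral [simp]: "fps_coeff_deriv (numeral n) = 0"
  by (rule fps_ext) (simp add: fps_coeff_deriv_def fps_numeral_nth)

lemma fps_coeff_deriv_const [simp]: "fps_coeff_deriv (fps_const c) = fps_const (fls_deriv c)"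
  by (rule fps_ext) (simp add: fps_coeff_deriv_def)

text \<open>The recursion for \<open>alpha\<close> is this identity read at t^(k+1): the two end
  terms of the square supply 8 \<open>alpha U (Suc k)\<close>, and everything else involves smaller
  indices.\<close>

lemma alpha_first_integral:
  fixes U :: "complex fls"
  defines "Q \<equiv> (\<lambda>n. Abs_fps (\<lambda>k. (fls_deriv ^^ n) (alpha U k)))"
  shows "4 * (Q 0 * Q 0) = 4 + fps_X * (4 * (fps_const U * (Q 0 * Q 0))
     - 2 * (Q 0 * Q 4) + 2 * (Q 1 * Q 3) - Q 2 * Q 2)"
proof (rule fps_ext)
  fix n
  show "(4 * (Q 0 * Q 0)) $ n = (4 + fps_X * (4 * (fps_const U * (Q 0 * Q 0))
     - 2 * (Q 0 * Q 4) + 2 * (Q 1 * Q 3) - Q 2 * Q 2)) $ n"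
  proof (cases n)
    case 0
    then show ?thesis by (simp add: Q_def fps_numeral_nth)
  next
    case (Suc k)
    have num: "(numeral w * F) $ j = numeral w * F $ j" for w j and F :: "complex fls fps"
      by (metis fps_mult_left_const_nth fps_numeral_fps_const)
    define R where "R = (\<Sum>i\<in>{0..k}. 4 * (U * (alpha U i * alpha U (k - i)))
         - 2 * (alpha U i * (fls_deriv ^^ 4) (alpha U (k - i)))
         + 2 * ((fls_deriv ^^ 1) (alpha U i) * (fls_deriv ^^ 3) (alpha U (k - i)))
         - (fls_deriv ^^ 2) (alpha U i) * (fls_deriv ^^ 2) (alpha U (k - i)))"
    define S where "S = (\<Sum>i\<in>{1..k}. 4 * (alpha U i * alpha U (Suc k - i)))"
    have "(4 * (Q 0 * Q 0)) $ Suc k = (\<Sum>i=0..Suc k. 4 * (alpha U i * alpha U (Suc k - i)))"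
      unfolding num unfolding fps_mult_nth by (simp add: Q_def sum_distrib_left del: alpha.simps(2) sum.atLeast0_atMost_Suc)
    also have "{0..Suc k} = insert 0 (insert (Suc k) {1..k})" by auto
    also have "(\<Sum>i\<in>insert 0 (insert (Suc k) {1..k}). 4 * (alpha U i * alpha U (Suc k - i)))
        = 8 * alpha U (Suc k) + S"
      by (simp add: S_def del: alpha.simps(2))
    also have "8 * alpha U (Suc k) = R - S"
    proof -
      have "8 * fls_const (1/8) = (1 :: complex fls)"
        by (simp flip: fls_const_numeral)
      moreover have "alpha U (Suc k) = fls_const (1/8) * (R - S)"
        unfolding alpha.simps(2) R_def S_def by (rule refl)
      ultimately show ?thesis by (simp only: mult.assoc[symmetric] mult_1_left)
    qed
    also have "R = (4 * (fps_const U * (Q 0 * Q 0)) - 2 * (Q 0 * Q 4) + 2 * (Q 1 * Q 3) - Q 2 * Q 2) $ k"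
      unfolding fps_add_nth fps_sub_nth num fps_mult_left_const_nth
      unfolding fps_mult_nth R_def sum.distrib sum_subtractf sum_distrib_left by (simp add: Q_def)
    also have "\<dots> = (4 + fps_X * (4 * (fps_const U * (Q 0 * Q 0))
     - 2 * (Q 0 * Q 4) + 2 * (Q 1 * Q 3) - Q 2 * Q 2)) $ Suc k"
      by (simp only: fps_add_nth fps_X_mult_nth fps_numeral_nth) simp
    finally show ?thesis unfolding Suc by simp
  qed
qed

text \<open>Differentiating the first integral in x gives twice Q times the linear equation. Power
  series over a field have no zero divisors and Q has constant term 1, so Q can be
  cancelled.\<close>

lemma alpha_lenard_seq: "lenard_seq U (alpha U)"
proof -
  define Q where "Q = (\<lambda>n. Abs_fps (\<lambda>k. (fls_deriv ^^ n) (alpha U k)))"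
  have DQ: "fps_coeff_deriv (Q n) = Q (Suc n)" for n
    by (simp add: fps_coeff_deriv_def Q_def)
  have DQ': "fps_coeff_deriv (Q 0) = Q 1" "fps_coeff_deriv (Q 1) = Q 2" "fps_coeff_deriv (Q 2) = Q 3"
    "fps_coeff_deriv (Q 3) = Q 4" "fps_coeff_deriv (Q 4) = Q 5"
    by (simp_all add: DQ eval_nat_numeral)
  have "fps_coeff_deriv (4 * (Q 0 * Q 0)) = fps_coeff_deriv (4 + fps_X * (4 * (fps_const U * (Q 0 * Q 0))
     - 2 * (Q 0 * Q 4) + 2 * (Q 1 * Q 3) - Q 2 * Q 2))"
    using alpha_first_integral[of U] unfolding Q_def by simp
  then have "Q 0 * (4 * Q 1 - fps_X * (4 * (fps_const U * Q 1) + 2 * (fps_const (fls_deriv U) * Q 0) - Q 5)) = 0"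
    unfolding fps_coeff_deriv_mult fps_coeff_deriv_add fps_coeff_deriv_diff DQ'
      fps_coeff_deriv_numeral fps_coeff_deriv_X fps_coeff_deriv_const
    by algebra
  moreover have "Q 0 $ 0 = 1" by (simp add: Q_def)
  then have "Q 0 \<noteq> 0" by auto
  ultimately have eq: "4 * Q 1 = fps_X * (4 * (fps_const U * Q 1) + 2 * (fps_const (fls_deriv U) * Q 0) - Q 5)"
    by simp
  have num: "(numeral w * F) $ j = numeral w * F $ j" for w j and F :: "complex fls fps"
    by (metis fps_mult_left_const_nth fps_numeral_fps_const)
  have "4 * fls_deriv (alpha U (Suc k)) = lenard U (alpha U k)" for k
  proof -
    have "(4 * Q 1) $ Suc k = (fps_X * (4 * (fps_const U * Q 1) + 2 * (fps_const (fls_deriv U) * Q 0) - Q 5)) $ Suc k"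
      by (simp only: eq)
    then show ?thesis
      by (simp only: num fps_X_mult_nth fps_add_nth fps_sub_nth fps_mult_left_const_nth)
         (simp add: Q_def lenard_def del: alpha.simps(2))
  qed
  then show ?thesis by (simp add: lenard_seq_def)
qed

declare alpha.simps(2) [simp del]

section \<open>Linearity, constants of integration and termination\<close>

lemma lenard_add: "lenard U (F + G) = lenard U F + lenard U G"
  by (simp add: lenard_def eval_nat_numeral algebra_simps)

lemma lenard_const_mult: "lenard U (fls_const c * F) = fls_const c * lenard U F"
  by (simp add: lenard_def eval_nat_numeral algebra_simps)

lemma lenard_0 [simp]: "lenard U 0 = 0"
  by (simp add: lenard_def eval_nat_numeral)

lemma lenard_sum: "lenard U (\<Sum>i\<in>A. F i) = (\<Sum>i\<in>A. lenard U (F i))"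
  by (induction A rule: infinite_finite_induct) (auto simp: lenard_add)

text \<open>This multiplies the generating function in t by a power series with constant
  coefficients \<open>c s\<close>. They are the constants of integration that the recursion leaves
  free at each step.\<close>

lemma lenard_seq_convolution:
  assumes "lenard_seq U b"
  shows "lenard_seq U (\<lambda>j. \<Sum>s\<le>j. fls_const (c s) * b (j - s))"
proof -
  have b0: "fls_deriv (b 0) = 0" and b: "\<And>j. 4 * fls_deriv (b (Suc j)) = lenard U (b j)"
    using assms by (auto simp: lenard_seq_def)
  have "4 * fls_deriv (\<Sum>s\<le>Suc j. fls_const (c s) * b (Suc j - s)) = lenard U (\<Sum>s\<le>j. fls_const (c s) * b (j - s))" for j
  proof -
    have "4 * fls_deriv (\<Sum>s\<le>Suc j. fls_const (c s) * b (Suc j - s))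
        = 4 * (\<Sum>s\<le>Suc j. fls_const (c s) * fls_deriv (b (Suc j - s)))"
      by (simp add: fls_deriv_sum del: sum.atMost_Suc)
    also have "\<dots> = (\<Sum>s\<le>Suc j. fls_const (c s) * (4 * fls_deriv (b (Suc j - s))))"
      by (simp add: sum_distrib_left mult_ac del: sum.atMost_Suc)
    also have "\<dots> = (\<Sum>s\<le>j. fls_const (c s) * (4 * fls_deriv (b (Suc j - s))))"
      using b0 by simp
    also have "\<dots> = (\<Sum>s\<le>j. fls_const (c s) * lenard U (b (j - s)))"
      by (intro sum.cong refl) (simp add: Suc_diff_le b)
    finally show ?thesis by (simp add: lenard_sum lenard_const_mult)
  qed
  then show ?thesis using b0 by (simp add: lenard_seq_def)
qed

context single_pole_potential
begin

lemma alpha_tame: "alpha (laurent_expansion u a) k \<in> tame_series"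
proof (induction k rule: less_induct)
  case (less k)
  show ?case
  proof (cases k)
    case 0
    then show ?thesis using tame_series_1 by simp
  next
    case (Suc n)
    have IH: "alpha (laurent_expansion u a) i \<in> tame_series" if "i \<le> n" for i using less Suc that by simp
    show ?thesis unfolding Suc alpha.simps(2)
      by (intro tame_series_mult tame_series_add tame_series_diff tame_series_sum tame_series_higher_deriv
           tame_series_const tame_series_u tame_series_numeral IH) auto
  qed
qed

text \<open>The leading coefficients of \<open>alpha U 1, \<dots>, alpha U g\<close> do not vanish, whereas that of
  \<open>alpha U (Suc g)\<close> does.  A linear combination therefore has no pole at all.\<close>

lemma lenard_seq_exists:
  defines "U \<equiv> laurent_expansion u a"
  assumes low: "\<forall>i< -4. U $$ i = 0" and lead: "U $$ (-4) = of_nat (crit g)" and g: "1 \<le> g"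
    and small: "\<forall>i\<in>{-3, -2, -1, 1, 2, 3}. U $$ i = 0"
  obtains b where "\<And>j. b j \<in> tame_series" "b 0 = 1" "lenard_seq U b" "lenard U (b g) = 0"
proof -
  have nz: "U $$ (-4) \<noteq> 0"
  proof -
    have "crit g \<noteq> 0" using g by (simp add: crit_def)
    then show ?thesis by (simp only: lead of_nat_eq_0_iff) simp
  qed
  have off: "U $$ m = 0" if "\<not> 4 dvd m" for m
    using off_grading_vanish[folded U_def] low nz small that by blast
  note seq = alpha_lenard_seq[of U]
  have alpha_off: "\<not> 4 dvd n \<Longrightarrow> alpha U j $$ n = 0" for j n
  proof (induction j arbitrary: n)
    case 0
    then show ?case by (cases "n = 0") auto
  next
    case (Suc j)
    show ?case
    proof (rule lenard_seq_nth_eq_0[OF seq])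
      show "U $$ i * alpha U j $$ (n - i) = 0" for i
      proof (cases "4 dvd i")
        case True
        then have "\<not> 4 dvd (n - i)" using Suc.prems by presburger
        then show ?thesis using Suc.IH by simp
      qed (use off in simp)
      have "\<not> 4 dvd (n + 4)" using Suc.prems by presburger
      then show "alpha U j $$ (n + 4) = 0" using Suc.IH by simp
    qed (use Suc.prems in auto)
  qed
  have alpha_low: "n < - 4 * int j \<Longrightarrow> alpha U j $$ n = 0" for j n
    using lenard_seq_below[OF seq low] .
  have alpha_lead: "alpha U j $$ (- 4 * int j) \<noteq> 0" if "j \<le> g" for j
  proof (rule lenard_seq_lead_nonzero[OF seq low])
    show "U $$ (-4) \<noteq> of_nat (crit i)" if "i < j" for i
      using strict_monoD[OF crit_strict_mono, of i g] that \<open>j \<le> g\<close> lead by simp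
  qed simp
  have alpha_g: "alpha U (Suc g) $$ (- 4 * int (Suc g)) = 0"
    using lenard_seq_lead_zero[OF seq low lead] by blast
  \<comment> \<open>Poles are removed from the highest order down. All exponents are multiples of 4,
    so each round cancels one coefficient, using the first remaining \<open>alpha\<close> from the
    top without disturbing lower exponents. The start is -4 g since \<open>alpha U (Suc g)\<close>
    has no term at -4 (g + 1).\<close>
  have "s \<le> g \<Longrightarrow> \<exists>c. \<forall>n < - 4 * (int g - int s).
      (alpha U (Suc g) + (\<Sum>i\<in>{g - s<..g}. fls_const (c i) * alpha U i)) $$ n = 0" for s
  proof (induction s)
    case 0
    have "alpha U (Suc g) $$ n = 0" if "n < - 4 * int g" for n
    proof (cases "4 dvd n")
      case True
      then obtain q where q: "n = 4 * q" by blast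
      then have "n < - 4 * int (Suc g) \<or> n = - 4 * int (Suc g)" using that by auto
      then show ?thesis using alpha_g alpha_low by blast
    qed (use alpha_off in blast)
    then show ?case by simp
  next
    case (Suc s)
    then obtain c where c: "\<And>n. n < - 4 * (int g - int s) \<Longrightarrow>
      (alpha U (Suc g) + (\<Sum>i\<in>{g - s<..g}. fls_const (c i) * alpha U i)) $$ n = 0" by auto
    define F where "F = alpha U (Suc g) + (\<Sum>i\<in>{g - s<..g}. fls_const (c i) * alpha U i)"
    define r where "r = g - s"
    define e where "e = - F $$ (- 4 * int r) / alpha U r $$ (- 4 * int r)"
    have r: "r \<le> g" "int r = int g - int s" "{g - Suc s<..g} = insert r {g - s<..g}" "r \<notin> {g - s<..g}"
      using Suc.prems by (auto simp: r_def)
    have F': "alpha U (Suc g) + (\<Sum>i\<in>{g - Suc s<..g}. fls_const ((c(r := e)) i) * alpha U i)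
        = F + fls_const e * alpha U r"
    proof -
      have "(\<Sum>i\<in>{g - s<..g}. fls_const ((c(r := e)) i) * alpha U i) = (\<Sum>i\<in>{g - s<..g}. fls_const (c i) * alpha U i)"
        by (rule sum.cong) (use r in auto)
      then show ?thesis unfolding r(3) using r(4) by (simp add: F_def)
    qed
    have "(F + fls_const e * alpha U r) $$ n = 0" if n: "n < - 4 * (int g - int (Suc s))" for n
    proof (cases "4 dvd n")
      case True
      then obtain q where "n = 4 * q" by blast
      then consider "n < - 4 * int r" | "n = - 4 * int r" using n r by fastforce
      then show ?thesis
      proof cases
        case 1
        then show ?thesis using c[of n] alpha_low[of n r] r by (simp add: F_def)
      next
        case 2
        then show ?thesis using alpha_lead[OF r(1)] by (simp add: e_def)
      qed
    next
      case False
      then show ?thesis using alpha_off by (simp add: F_def fls_nth_sum)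
    qed
    then show ?case using F' by metis
  qed
  from this[of g] obtain c where c: "\<And>n. n < 0 \<Longrightarrow>
      (alpha U (Suc g) + (\<Sum>i\<in>{0<..g}. fls_const (c i) * alpha U i)) $$ n = 0" by auto
  \<comment> \<open>The same constants in the order of the convolution. Index 0 gets 1, so that
    \<open>b 0 = 1\<close>; index g + 1 multiplies \<open>alpha U 0\<close> = 1, and its value 0
    only fixes an additive constant.\<close>
  define c' where "c' = (\<lambda>s. if s = 0 then 1 else if s = Suc g then 0 else c (Suc g - s))"
  define b where "b = (\<lambda>j. \<Sum>s\<le>j. fls_const (c' s) * alpha U (j - s))"
  have b_tame: "b j \<in> tame_series" for j
    unfolding b_def U_def by (intro tame_series_sum tame_series_mult tame_series_const alpha_tame)
  have b_seq: "lenard_seq U b" unfolding b_def using seq by (rule lenard_seq_convolution)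
  have "b (Suc g) = alpha U (Suc g) + (\<Sum>i\<in>{0<..g}. fls_const (c i) * alpha U i)"
  proof -
    have "{..Suc g} = insert 0 (insert (Suc g) {0<..g})" by auto
    then have "b (Suc g) = alpha U (Suc g) + (\<Sum>s\<in>{0<..g}. fls_const (c (Suc g - s)) * alpha U (Suc g - s))"
      by (simp add: b_def c'_def del: alpha.simps(2))
    also have "(\<Sum>s\<in>{0<..g}. fls_const (c (Suc g - s)) * alpha U (Suc g - s)) = (\<Sum>i\<in>{0<..g}. fls_const (c i) * alpha U i)"
      by (rule sum.reindex_bij_witness[of _ "\<lambda>i. Suc g - i" "\<lambda>i. Suc g - i"]) auto
    finally show ?thesis .
  qed
  then have "b (Suc g) = fls_const (b (Suc g) $$ 0)"
    using c b_tame tame_series_constant by metis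
  then have "fls_deriv (b (Suc g)) = 0" by (metis fls_deriv_const)
  then have "lenard U (b g) = 0" using b_seq unfolding lenard_seq_def by (metis mult_zero_right)
  moreover have "b 0 = 1" by (simp add: b_def c'_def)
  ultimately show ?thesis using that b_tame b_seq by blast
qed

end

section \<open>The fourth-order linear equation\<close>

text \<open>Taylor coefficients of the solution of \<psi>'''' = v \<psi> whose i-th derivative at
  the centre is \<open>y i\<close> for i < 4; here \<open>v\<close> lists the Taylor coefficients of
  the potential.\<close>

function ode_coeff :: "(nat \<Rightarrow> complex) \<Rightarrow> (nat \<Rightarrow> complex) \<Rightarrow> nat \<Rightarrow> complex" where
  "ode_coeff v y n = (if n < 4 then y n / fact n
     else (\<Sum>k\<in>{0..n - 4}. v k * ode_coeff v y (n - 4 - k)) / of_nat (n * (n - 1) * (n - 2) * (n - 3)))"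
  by auto
termination by (relation "Wellfounded.measure (\<lambda>(_, _, n). n)") auto

declare ode_coeff.simps [simp del]

text \<open>Weighted by powers of r, the recursion sums m + 1 terms bounded by C K and r^4 and
  divides by (m + 1) (m + 2) (m + 3) (m + 4). Once m \<ge> r^4 C the result is at most K, so K can
  be the maximum over finitely many initial terms.\<close>

lemma ode_coeff_bounded:
  assumes r: "r > 0" and v: "\<And>k. norm (v k) * r ^ k \<le> C"
  shows "\<exists>K. \<forall>n. norm (ode_coeff v y n) * r ^ n \<le> K"
proof -
  define q where "q = (\<lambda>n. norm (ode_coeff v y n) * r ^ n)"
  have q0: "q n \<ge> 0" for n using r by (simp add: q_def)
  have C: "C \<ge> 0" using v[of 0] by (meson norm_ge_zero order_trans mult_nonneg_nonneg zero_le_power r less_imp_le)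
  obtain N where N: "real N \<ge> r ^ 4 * C" using real_arch_simple by blast
  define K where "K = Max (q ` {..N + 4})"
  have K0: "K \<ge> 0" using q0[of 0] Max_ge[of "q ` {..N + 4}" "q 0"] by (auto simp: K_def intro: order_trans)
  have "q n \<le> K" for n
  proof (induction n rule: less_induct)
    case (less n)
    show ?case
    proof (cases "n \<le> N + 4")
      case True
      then show ?thesis unfolding K_def by (intro Max_ge) auto
    next
      case False
      define m where "m = n - 4"
      have n: "n = m + 4" "N \<le> m" using False by (auto simp: m_def)
      have "norm (\<Sum>k\<in>{0..m}. v k * ode_coeff v y (m - k)) * r ^ m
          \<le> (\<Sum>k\<in>{0..m}. norm (v k * ode_coeff v y (m - k))) * r ^ m"
        using r by (intro mult_right_mono norm_sum) auto
      also have "\<dots> = (\<Sum>k\<in>{0..m}. (norm (v k) * r ^ k) * q (m - k))"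
        unfolding sum_distrib_right
      proof (rule sum.cong)
        fix k assume "k \<in> {0..m}"
        then have "r ^ m = r ^ k * r ^ (m - k)" by (simp flip: power_add)
        then show "norm (v k * ode_coeff v y (m - k)) * r ^ m = norm (v k) * r ^ k * q (m - k)"
          by (simp add: q_def norm_mult)
      qed simp
      also have "\<dots> \<le> (\<Sum>k\<in>{0..m}. C * K)"
        by (intro sum_mono mult_mono) (use v less n C q0 in auto)
      also have "\<dots> = (m + 1) * (C * K)" by simp
      finally have S: "norm (\<Sum>k\<in>{0..m}. v k * ode_coeff v y (m - k)) * r ^ m \<le> real (m + 1) * (C * K)" .
      have d: "n * (n - 1) * (n - 2) * (n - 3) = (m + 4) * (m + 3) * (m + 2) * (m + 1)"
      proof -
        have "n - 1 = m + 3" "n - 2 = m + 2" "n - 3 = m + 1" using n by simp_all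
        then show ?thesis by (simp only: n(1))
      qed
      have "q n = norm (\<Sum>k\<in>{0..m}. v k * ode_coeff v y (m - k)) * r ^ m * r ^ 4
          / real ((m + 4) * (m + 3) * (m + 2) * (m + 1))"
      proof -
        have "ode_coeff v y n = (\<Sum>k\<in>{0..m}. v k * ode_coeff v y (m - k)) / of_nat ((m + 4) * (m + 3) * (m + 2) * (m + 1))"
          by (subst ode_coeff.simps) (simp only: d, simp add: n)
        moreover have "r ^ n = r ^ m * r ^ 4" by (simp add: n power_add)
        ultimately show ?thesis
          by (simp only: q_def norm_divide norm_of_nat times_divide_eq_left mult.assoc)
      qed
      also have "\<dots> \<le> real (m + 1) * (C * K) * r ^ 4 / real ((m + 4) * (m + 3) * (m + 2) * (m + 1))"
        using S r by (intro divide_right_mono mult_right_mono) auto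
      also have "\<dots> = (r ^ 4 * C) / real ((m + 4) * (m + 3) * (m + 2)) * K"
      proof -
        have cancel: "x * (C * K) * r ^ 4 / (y * x) = r ^ 4 * C / y * K" if "x \<noteq> 0" for x y :: real
          using that by simp
        show ?thesis unfolding of_nat_mult[of _ "m + 1"] by (rule cancel) simp
      qed
      also have "\<dots> \<le> 1 * K"
      proof (rule mult_right_mono)
        have "r ^ 4 * C \<le> real m" using N n by linarith
        also have "m \<le> (m + 4) * (m + 3) * (m + 2)" by (simp add: algebra_simps)
        then have "real m \<le> real ((m + 4) * (m + 3) * (m + 2))" by (simp only: of_nat_le_iff)
        finally have le: "r ^ 4 * C \<le> real ((m + 4) * (m + 3) * (m + 2))" .
        have pos: "0 < real ((m + 4) * (m + 3) * (m + 2))" by (simp only: of_nat_0_less_iff) simp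
        show "(r ^ 4 * C) / real ((m + 4) * (m + 3) * (m + 2)) \<le> 1"
          unfolding divide_le_eq_1_pos[OF pos] by (rule le)
      qed (rule K0)
      finally show ?thesis by simp
    qed
  qed
  then show ?thesis unfolding q_def by blast
qed

text \<open>The radius must not shrink, since \<open>has_rank\<close> asks for eigenfunctions on the
  whole of any disc on which the operators are regular. Bounds at a radius r > s give convergence at
  s.\<close>

lemma fps_conv_radius_ode_coeff:
  "fps_conv_radius (Abs_fps (ode_coeff (fps_nth V) y)) \<ge> fps_conv_radius V"
  unfolding fps_conv_radius_def
proof (rule conv_radius_geI_ex')
  fix s :: real assume s: "0 < s" "ereal s < conv_radius (fps_nth V)"
  then obtain r where r: "s < r" "ereal r < conv_radius (fps_nth V)"
    by (metis ereal_dense2 ereal_less_eq(3) less_ereal.simps(1) not_le)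
  have "summable (\<lambda>n. norm (fps_nth V n * of_real r ^ n))"
    using r s by (intro abs_summable_in_conv_radius) auto
  then have lim: "(\<lambda>n. norm (fps_nth V n * of_real r ^ n)) \<longlonglongrightarrow> 0" by (rule summable_LIMSEQ_zero)
  then have "Bseq (\<lambda>n. norm (fps_nth V n * of_real r ^ n))" by (intro convergent_imp_Bseq convergentI)
  then obtain C where C: "\<And>n. norm (norm (fps_nth V n * of_real r ^ n)) \<le> C" by (auto simp: Bseq_def)
  have "norm (fps_nth V n) * r ^ n \<le> C" for n
    using C[of n] r s by (simp add: norm_mult norm_power)
  then obtain K where K: "\<And>n. norm (ode_coeff (fps_nth V) y n) * r ^ n \<le> K"
    using ode_coeff_bounded[of r] r s by (meson less_trans)
  have "summable (\<lambda>n. norm (ode_coeff (fps_nth V) y n) * s ^ n)"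
    using r s K by (intro Abel_lemma) auto
  then have "summable (\<lambda>n. norm (ode_coeff (fps_nth V) y n * of_real s ^ n))"
    using s by (simp add: norm_mult norm_power)
  then show "summable (\<lambda>n. fps_nth (Abs_fps (ode_coeff (fps_nth V) y)) n * of_real s ^ n)"
    using summable_norm_cancel by auto
qed

lemma higher_deriv_eval_fps:
  fixes F :: "complex fps"
  assumes "ereal \<epsilon> \<le> fps_conv_radius F" "x \<in> ball c \<epsilon>"
  shows "(deriv ^^ n) (\<lambda>x. eval_fps F (x - c)) x = eval_fps ((fps_deriv ^^ n) F) (x - c)"
  using assms(2)
proof (induction n arbitrary: x)
  case 0
  then show ?case by simp
next
  case (Suc n)
  have R: "ereal \<epsilon> \<le> fps_conv_radius ((fps_deriv ^^ n) F)"
    using assms(1) by (induction n) (auto intro: order_trans[OF _ fps_conv_radius_deriv])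
  have "ereal (norm (x - c)) < ereal \<epsilon>" using Suc.prems by (simp add: dist_norm norm_minus_commute)
  then have D: "(eval_fps ((fps_deriv ^^ n) F) has_field_derivative eval_fps (fps_deriv ((fps_deriv ^^ n) F)) (x - c)) (at (x - c))"
    using R by (intro has_field_derivative_eval_fps) (rule less_le_trans)
  have "((\<lambda>x. eval_fps ((fps_deriv ^^ n) F) (x - c)) has_field_derivative eval_fps (fps_deriv ((fps_deriv ^^ n) F)) (x - c)) (at x)"
  proof -
    have "((\<lambda>x. x - c) has_field_derivative 1) (at x)" by (auto intro!: derivative_eq_intros)
    from DERIV_chain2[where f = "eval_fps ((fps_deriv ^^ n) F)" and g = "\<lambda>x. x - c", OF D this]
    show ?thesis by simp
  qed
  then have "deriv (\<lambda>x. eval_fps ((fps_deriv ^^ n) F) (x - c)) x = eval_fps ((fps_deriv ^^ Suc n) F) (x - c)"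
    by (simp add: DERIV_imp_deriv)
  moreover have "deriv ((deriv ^^ n) (\<lambda>x. eval_fps F (x - c))) x = deriv (\<lambda>x. eval_fps ((fps_deriv ^^ n) F) (x - c)) x"
  proof (rule deriv_cong_ev)
    show "\<forall>\<^sub>F y in nhds x. (deriv ^^ n) (\<lambda>x. eval_fps F (x - c)) y = eval_fps ((fps_deriv ^^ n) F) (y - c)"
      using eventually_nhds_in_open[OF open_ball Suc.prems] by eventually_elim (rule Suc.IH)
  qed simp
  ultimately show ?case by simp
qed

lemma linear_ode_exists:
  assumes v: "v holomorphic_on ball c \<epsilon>" and "\<epsilon> > 0"
  obtains \<psi> where "\<psi> holomorphic_on ball c \<epsilon>" "\<And>x. x \<in> ball c \<epsilon> \<Longrightarrow> (deriv ^^ 4) \<psi> x = v x * \<psi> x"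
    "\<And>i. i < 4 \<Longrightarrow> (deriv ^^ i) \<psi> c = y i"
proof -
  define V where "V = fps_expansion v c"
  have "v analytic_on {c}" using assms analytic_at by (metis centre_in_ball open_ball)
  then have V: "(\<lambda>x. v (c + x)) has_fps_expansion V"
    unfolding V_def by (rule analytic_at_imp_has_fps_expansion)
  have hol0: "(\<lambda>x. v (c + x)) holomorphic_on ball 0 \<epsilon>"
  proof -
    have "v \<circ> (\<lambda>x. c + x) holomorphic_on ball 0 \<epsilon>"
      by (rule holomorphic_on_compose_gen[OF _ v]) (auto intro!: holomorphic_intros simp: dist_norm)
    then show ?thesis by (simp add: o_def)
  qed
  have RV: "ereal \<epsilon> \<le> fps_conv_radius V"
    using V hol0 by (intro holomorphic_on_imp_fps_conv_radius_ge) auto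
  have V_eq: "eval_fps V (x - c) = v x" if "x \<in> ball c \<epsilon>" for x
    using has_fps_expansion_imp_eval_fps_eq[OF V _ hol0, of "x - c"] that
    by (simp add: dist_norm norm_minus_commute)
  define F where "F = Abs_fps (ode_coeff (fps_nth V) y)"
  have RF: "ereal \<epsilon> \<le> fps_conv_radius F"
    using RV fps_conv_radius_ode_coeff[of V y] unfolding F_def by (rule order_trans)
  have F4: "(fps_deriv ^^ 4) F = V * F"
  proof (rule fps_ext)
    fix n
    have "(fps_deriv ^^ 4) F $ n = of_nat ((n + 4) * (n + 3) * (n + 2) * (n + 1)) * ode_coeff (fps_nth V) y (n + 4)"
      by (simp add: eval_nat_numeral F_def algebra_simps)
    also have "\<dots> = (\<Sum>k\<in>{0..n}. V $ k * ode_coeff (fps_nth V) y (n - k))"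
    proof -
      have e: "(n + 4) * (n + 4 - 1) * (n + 4 - 2) * (n + 4 - 3) = (n + 4) * (n + 3) * (n + 2) * (n + 1)"
      proof -
        have "n + 4 - 1 = n + 3" "n + 4 - 2 = n + 2" "n + 4 - 3 = n + 1" by simp_all
        then show ?thesis by (simp only:)
      qed
      have nz: "(of_nat ((n + 4) * (n + 3) * (n + 2) * (n + 1)) :: complex) \<noteq> 0"
        by (simp only: of_nat_eq_0_iff) simp
      have "ode_coeff (fps_nth V) y (n + 4)
        = (\<Sum>k\<in>{0..n}. V $ k * ode_coeff (fps_nth V) y (n - k)) / of_nat ((n + 4) * (n + 3) * (n + 2) * (n + 1))"
        by (subst ode_coeff.simps) (simp only: e, simp)
      then show ?thesis by (simp only: nonzero_mult_div_cancel_left[OF nz] times_divide_eq_right)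
    qed
    also have "\<dots> = (V * F) $ n" by (simp add: fps_mult_nth F_def)
    finally show "(fps_deriv ^^ 4) F $ n = (V * F) $ n" .
  qed
  define \<psi> where "\<psi> = (\<lambda>x. eval_fps F (x - c))"
  show ?thesis
  proof
    show "\<psi> holomorphic_on ball c \<epsilon>"
      unfolding \<psi>_def
    proof (rule holomorphic_on_compose_gen[of "\<lambda>x. x - c" _ "eval_fps F", unfolded o_def])
      show "eval_fps F holomorphic_on eball 0 (fps_conv_radius F)" by (rule holomorphic_on_eval_fps) simp
      show "(\<lambda>x. x - c) ` ball c \<epsilon> \<subseteq> eball 0 (fps_conv_radius F)"
      proof (rule image_subsetI)
        fix x assume "x \<in> ball c \<epsilon>"
        then have "ereal (norm (x - c)) < ereal \<epsilon>" by (simp add: dist_norm norm_minus_commute)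
        also note RF
        finally show "x - c \<in> eball 0 (fps_conv_radius F)" by (simp add: in_eball_iff)
      qed
    qed (auto intro: holomorphic_intros)
    show "(deriv ^^ 4) \<psi> x = v x * \<psi> x" if x: "x \<in> ball c \<epsilon>" for x
    proof -
      have n: "ereal (norm (x - c)) < ereal \<epsilon>" using x by (simp add: dist_norm norm_minus_commute)
      show ?thesis
        unfolding \<psi>_def higher_deriv_eval_fps[OF RF x] F4 V_eq[OF x, symmetric]
        by (rule eval_fps_mult) (use n RV RF less_le_trans in blast)+
    qed
    show "(deriv ^^ i) \<psi> c = y i" if "i < 4" for i
    proof -
      have "c \<in> ball c \<epsilon>" using assms by simp
      from higher_deriv_eval_fps[OF RF this, of i] have "(deriv ^^ i) \<psi> c = (fps_deriv ^^ i) F $ 0"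
        by (simp add: \<psi>_def eval_fps_at_0)
      also have "\<dots> = fact i * F $ i"
      proof -
        have "i \<in> {0, 1, 2, 3}" using that by auto
        then show ?thesis by (auto simp: eval_nat_numeral)
      qed
      also have "\<dots> = y i" using that by (simp add: F_def ode_coeff.simps)
      finally show ?thesis .
    qed
  qed
qed

lemma linear_ode_unique:
  assumes v: "v holomorphic_on ball c \<epsilon>" and \<psi>: "\<psi> holomorphic_on ball c \<epsilon>"
    and ode: "\<And>x. x \<in> ball c \<epsilon> \<Longrightarrow> (deriv ^^ 4) \<psi> x = v x * \<psi> x"
    and init: "\<And>i. i < 4 \<Longrightarrow> (deriv ^^ i) \<psi> c = 0" and x: "x \<in> ball c \<epsilon>"
  shows "\<psi> x = 0"
proof -
  have c: "c \<in> ball c \<epsilon>" using x by (metis centre_in_ball dist_not_less_zero mem_ball not_less order.strict_trans1 zero_le_dist)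
  have "(deriv ^^ n) \<psi> c = 0" for n
  proof (induction n rule: less_induct)
    case (less n)
    show ?case
    proof (cases "n < 4")
      case False
      define m where "m = n - 4"
      have n: "n = m + 4" using False by (simp add: m_def)
      have "(deriv ^^ n) \<psi> c = (deriv ^^ m) ((deriv ^^ 4) \<psi>) c" by (simp add: n funpow_add)
      also have "\<dots> = (deriv ^^ m) (\<lambda>x. v x * \<psi> x) c"
        by (rule higher_deriv_transform_within_open[of _ "ball c \<epsilon>"])
           (use v \<psi> ode c in \<open>auto intro: holomorphic_intros\<close>)
      also have "\<dots> = (\<Sum>i = 0..m. of_nat (m choose i) * (deriv ^^ i) v c * (deriv ^^ (m - i)) \<psi> c)"
        by (rule higher_deriv_mult) (use v \<psi> c in auto)
      also have "\<dots> = 0" by (intro sum.neutral) (auto intro!: less.IH simp: n)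
      finally show ?thesis .
    qed (use init in blast)
  qed
  then show ?thesis
    using holomorphic_fun_eq_0_on_connected[OF \<psi> open_ball connected_ball _ c x] by blast
qed

section \<open>Differential operators in two bases\<close>

lemma app_L4: "app (L4 u) f = (\<lambda>x. u x * f x + (deriv ^^ 4) f x)"
  by (simp add: app_def L4_def lessThan_nat_numeral lessThan_Suc eval_nat_numeral add.commute)

text \<open>The basis d^i L^j with k = 4 j + i and i < 4, whose k-th element has order k. On an
  eigenfunction it reduces to z^j times the i-th derivative, which separates the spectral parameter
  from the jet.\<close>

definition ebase :: "(complex \<Rightarrow> complex) \<Rightarrow> nat \<Rightarrow> (complex \<Rightarrow> complex) \<Rightarrow> complex \<Rightarrow> complex" where
  "ebase u k f = (deriv ^^ (k mod 4)) ((app (L4 u) ^^ (k div 4)) f)"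

lemma holomorphic_app_L4:
  assumes "open S" "u holomorphic_on S" "f holomorphic_on S"
  shows "(app (L4 u) ^^ j) f holomorphic_on S"
  using assms by (induction j) (auto simp: app_L4 intro!: holomorphic_intros)

lemma holomorphic_ebase:
  assumes "open S" "u holomorphic_on S" "f holomorphic_on S"
  shows "ebase u k f holomorphic_on S"
  unfolding ebase_def using assms holomorphic_app_L4 by (intro holomorphic_higher_deriv) auto

lemma ebase_eq: "i < 4 \<Longrightarrow> ebase u (4 * j + i) f = (deriv ^^ i) ((app (L4 u) ^^ j) f)"
  by (simp add: ebase_def)

lemma deriv_ebase:
  "deriv (ebase u k f) x = ebase u (Suc k) f x - (if k mod 4 = 3 then u x * ebase u (k - 3) f x else 0)"
proof -
  define j i where "j = k div 4" and "i = k mod 4"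
  have k: "k = 4 * j + i" "i < 4" by (simp_all add: i_def j_def)
  define h where "h = (app (L4 u) ^^ j) f"
  have e: "ebase u k f = (deriv ^^ i) h" using k by (simp add: ebase_eq h_def)
  show ?thesis
  proof (cases "i = 3")
    case True
    have "Suc k = 4 * Suc j + 0" "k - 3 = 4 * j + 0" using k True by simp_all
    then have "ebase u (Suc k) f = app (L4 u) h" "ebase u (k - 3) f = h"
      unfolding h_def by (simp_all only: ebase_eq zero_less_numeral) simp_all
    moreover have "deriv ((deriv ^^ 3) h) x = (deriv ^^ 4) h x" by (simp add: eval_nat_numeral)
    ultimately show ?thesis using True e by (simp add: app_L4 flip: i_def)
  next
    case False
    then have "Suc k = 4 * j + Suc i" "Suc i < 4" using k by simp_all
    then have "ebase u (Suc k) f = (deriv ^^ Suc i) h" unfolding h_def by (simp only: ebase_eq)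
    then show ?thesis using False e by (simp flip: i_def)
  qed
qed

text \<open>Instantiated twice: by the tame functions off all poles, and by functions on a punctured
  disc that are meromorphic at its centre. Membership in \<open>C\<close> keeps this extra
  information for the coefficients of every operator that is built.\<close>

locale coefficient_ring =
  fixes \<Omega> :: "complex set" and C :: "(complex \<Rightarrow> complex) set" and u :: "complex \<Rightarrow> complex"
  assumes open_dom: "open \<Omega>"
    and C_holomorphic: "c \<in> C \<Longrightarrow> c holomorphic_on \<Omega>"
    and C_const: "(\<lambda>_. \<kappa>) \<in> C"
    and C_add: "c \<in> C \<Longrightarrow> d \<in> C \<Longrightarrow> (\<lambda>x. c x + d x) \<in> C"
    and C_mult: "c \<in> C \<Longrightarrow> d \<in> C \<Longrightarrow> (\<lambda>x. c x * d x) \<in> C"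
    and C_deriv: "c \<in> C \<Longrightarrow> deriv c \<in> C"
    and C_u: "u \<in> C"
begin

text \<open>Operators are arbitrary maps on functions; \<open>rep\<close> states that \<Phi> acts as
  a differential operator in the basis \<open>B\<close>. Coefficients above \<open>n\<close> are
  zero functions so that different orders can be added, and \<open>\<mu> n\<close> keeps track of
  the leading coefficient.\<close>

definition rep :: "(nat \<Rightarrow> (complex \<Rightarrow> complex) \<Rightarrow> complex \<Rightarrow> complex) \<Rightarrow>
    ((complex \<Rightarrow> complex) \<Rightarrow> complex \<Rightarrow> complex) \<Rightarrow> nat \<Rightarrow> (nat \<Rightarrow> complex \<Rightarrow> complex) \<Rightarrow> bool" where
  "rep B \<Phi> n \<mu> \<longleftrightarrow> (\<forall>k. \<mu> k \<in> C) \<and> (\<forall>k>n. \<mu> k = (\<lambda>_. 0)) \<and>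
     (\<forall>S f x. open S \<longrightarrow> S \<subseteq> \<Omega> \<longrightarrow> f holomorphic_on S \<longrightarrow> x \<in> S \<longrightarrow>
        \<Phi> f x = (\<Sum>k\<le>n. \<mu> k x * B k f x))"

lemma C_sum: "(\<And>i. i \<in> A \<Longrightarrow> c i \<in> C) \<Longrightarrow> (\<lambda>x. \<Sum>i\<in>A. c i x) \<in> C"
  by (induction A rule: infinite_finite_induct) (auto intro: C_const C_add)

lemma C_cmult: "c \<in> C \<Longrightarrow> (\<lambda>x. \<kappa> * c x) \<in> C"
  using C_mult[OF C_const] .

lemma C_diff: "c \<in> C \<Longrightarrow> d \<in> C \<Longrightarrow> (\<lambda>x. c x - d x) \<in> C"
  using C_add[of c "\<lambda>x. - 1 * d x"] C_cmult[of d "-1"] by simp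

lemma C_higher_deriv: "c \<in> C \<Longrightarrow> (deriv ^^ n) c \<in> C"
  by (induction n) (auto intro: C_deriv)

lemma u_holomorphic: "u holomorphic_on \<Omega>" using C_holomorphic C_u by blast

lemma C_holomorphic_subset: "c \<in> C \<Longrightarrow> S \<subseteq> \<Omega> \<Longrightarrow> c holomorphic_on S"
  using C_holomorphic holomorphic_on_subset by blast

lemma rep_cong:
  assumes "rep B \<Phi> n \<mu>"
    "\<And>S f x. open S \<Longrightarrow> S \<subseteq> \<Omega> \<Longrightarrow> f holomorphic_on S \<Longrightarrow> x \<in> S \<Longrightarrow> \<Psi> f x = \<Phi> f x"
  shows "rep B \<Psi> n \<mu>"
  using assms unfolding rep_def by auto

lemma rep_mono:
  assumes "rep B \<Phi> n \<mu>" "n \<le> m" shows "rep B \<Phi> m \<mu>"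
proof -
  have "(\<Sum>k\<le>m. \<mu> k x * B k f x) = (\<Sum>k\<le>n. \<mu> k x * B k f x)" for f x
    by (rule sum.mono_neutral_right) (use assms in \<open>auto simp: rep_def\<close>)
  then show ?thesis using assms unfolding rep_def by auto
qed

lemma rep_add:
  assumes "rep B \<Phi> n \<mu>" "rep B \<Psi> n \<nu>"
  shows "rep B (\<lambda>f x. \<Phi> f x + \<Psi> f x) n (\<lambda>k x. \<mu> k x + \<nu> k x)"
  using assms unfolding rep_def by (auto intro!: C_add simp: sum.distrib distrib_right)

lemma rep_mult:
  assumes "rep B \<Phi> n \<mu>" "c \<in> C"
  shows "rep B (\<lambda>f x. c x * \<Phi> f x) n (\<lambda>k x. c x * \<mu> k x)"
  using assms unfolding rep_def by (auto intro!: C_mult simp: sum_distrib_left mult.assoc)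

lemma rep_0: "rep B (\<lambda>f x. 0) n (\<lambda>k x. 0)"
  unfolding rep_def by (auto intro: C_const)

lemma rep_sum:
  assumes "\<And>i. i \<in> A \<Longrightarrow> rep B (\<Phi> i) n (\<mu> i)"
  shows "rep B (\<lambda>f x. \<Sum>i\<in>A. \<Phi> i f x) n (\<lambda>k x. \<Sum>i\<in>A. \<mu> i k x)"
  using assms
proof (induction A rule: infinite_finite_induct)
  case (insert i A)
  have "rep B (\<lambda>f x. \<Phi> i f x + (\<Sum>i\<in>A. \<Phi> i f x)) n (\<lambda>k x. \<mu> i k x + (\<Sum>i\<in>A. \<mu> i k x))"
    by (rule rep_add) (use insert in auto)
  then show ?case using insert.hyps by simp
qed (auto intro: rep_0)

lemma rep_deriv_sum:
  assumes "rep B \<Phi> n \<mu>" and B: "\<And>S f k. open S \<Longrightarrow> S \<subseteq> \<Omega> \<Longrightarrow> f holomorphic_on S \<Longrightarrow> B k f holomorphic_on S"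
    and S: "open S" "S \<subseteq> \<Omega>" "f holomorphic_on S" "x \<in> S"
  shows "deriv (\<Phi> f) x = (\<Sum>k\<le>n. deriv (\<mu> k) x * B k f x + \<mu> k x * deriv (B k f) x)"
proof -
  have "deriv (\<Phi> f) x = deriv (\<lambda>x. \<Sum>k\<le>n. \<mu> k x * B k f x) x"
  proof (rule deriv_cong_ev)
    show "\<forall>\<^sub>F y in nhds x. \<Phi> f y = (\<Sum>k\<le>n. \<mu> k y * B k f y)"
      using eventually_nhds_in_open[OF S(1,4)] by eventually_elim (use assms(1) S in \<open>auto simp: rep_def\<close>)
  qed simp
  also have "\<dots> = (\<Sum>k\<le>n. deriv (\<mu> k) x * B k f x + \<mu> k x * deriv (B k f) x)"
  proof (rule DERIV_imp_deriv, rule DERIV_sum)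
    fix k
    have "(\<mu> k has_field_derivative deriv (\<mu> k) x) (at x)"
      using assms(1) S C_holomorphic_subset by (intro holomorphic_derivI[of _ S]) (auto simp: rep_def)
    moreover have "(B k f has_field_derivative deriv (B k f) x) (at x)"
      using B S by (intro holomorphic_derivI[of _ S]) auto
    ultimately show "((\<lambda>x. \<mu> k x * B k f x) has_field_derivative deriv (\<mu> k) x * B k f x + \<mu> k x * deriv (B k f) x) (at x)"
      by (auto intro!: derivative_eq_intros)
  qed
  finally show ?thesis .
qed

lemma rep_deriv_ebase:
  assumes "rep (ebase u) \<Phi> n \<mu>"
  shows "\<exists>\<nu>. rep (ebase u) (\<lambda>f. deriv (\<Phi> f)) (Suc n) \<nu> \<and> \<nu> (Suc n) = \<mu> n"
proof -
  have C: "\<mu> k \<in> C" and hi: "k > n \<Longrightarrow> \<mu> k = (\<lambda>_. 0)" for k using assms by (auto simp: rep_def)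
  have hi': "\<mu> k x \<noteq> 0 \<Longrightarrow> k \<le> n" for k x using hi[of k] by (cases "k \<le> n") auto
  \<comment> \<open>The last term comes from d^4 = L - u: for 4 dividing k, differentiating the
    basis element k + 3 gives the next power of L minus u times the element k.\<close>
  define \<nu> where "\<nu> = (\<lambda>k x. deriv (\<mu> k) x + (if k = 0 then 0 else \<mu> (k - 1) x)
    - (if k mod 4 = 0 then u x * \<mu> (k + 3) x else 0))"
  have "rep (ebase u) (\<lambda>f. deriv (\<Phi> f)) (Suc n) \<nu>"
    unfolding rep_def
  proof (intro conjI allI impI)
    show "\<nu> k \<in> C" for k
    proof -
      have "(\<lambda>x. if k = 0 then 0 else \<mu> (k - 1) x) \<in> C"
        by (cases "k = 0") (auto intro: C C_const)
      then have "(\<lambda>x. deriv (\<mu> k) x + (if k = 0 then 0 else \<mu> (k - 1) x)) \<in> C"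
        by (intro C_add C_deriv C)
      moreover have "(\<lambda>x. if k mod 4 = 0 then u x * \<mu> (k + 3) x else 0) \<in> C"
        by (cases "k mod 4 = 0") (auto intro: C C_const C_mult C_u)
      ultimately show ?thesis unfolding \<nu>_def by (rule C_diff)
    qed
    show "\<nu> k = (\<lambda>_. 0)" if "k > Suc n" for k
      using that by (auto simp: \<nu>_def hi)
    fix S f x assume S: "open S" "S \<subseteq> \<Omega>" "f holomorphic_on S" "x \<in> S"
    have "deriv (\<Phi> f) x = (\<Sum>k\<le>n. deriv (\<mu> k) x * ebase u k f x + \<mu> k x * deriv (ebase u k f) x)"
      by (rule rep_deriv_sum[OF assms _ S])
         (auto intro: holomorphic_ebase holomorphic_on_subset[OF u_holomorphic])
    also have "\<dots> = (\<Sum>k\<le>n. deriv (\<mu> k) x * ebase u k f x) + (\<Sum>k\<le>n. \<mu> k x * ebase u (Suc k) f x)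
        - (\<Sum>k\<le>n. if k mod 4 = 3 then \<mu> k x * (u x * ebase u (k - 3) f x) else 0)"
      unfolding deriv_ebase sum.distrib[symmetric] sum_subtractf[symmetric]
      by (rule sum.cong) (auto simp: algebra_simps)
    also have "(\<Sum>k\<le>n. deriv (\<mu> k) x * ebase u k f x) = (\<Sum>k\<le>Suc n. deriv (\<mu> k) x * ebase u k f x)"
      using hi by simp
    also have "(\<Sum>k\<le>n. \<mu> k x * ebase u (Suc k) f x) = (\<Sum>k\<le>Suc n. (if k = 0 then 0 else \<mu> (k - 1) x) * ebase u k f x)"
      by (simp add: sum.atMost_Suc_shift del: sum.atMost_Suc)
    also have "(\<Sum>k\<le>n. if k mod 4 = 3 then \<mu> k x * (u x * ebase u (k - 3) f x) else 0)
        = (\<Sum>k\<le>Suc n. (if k mod 4 = 0 then u x * \<mu> (k + 3) x else 0) * ebase u k f x)"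
    proof -
      have "(\<Sum>k\<le>n. if k mod 4 = 3 then \<mu> k x * (u x * ebase u (k - 3) f x) else 0)
          = (\<Sum>k\<in>{k. k \<le> n \<and> k mod 4 = 3}. \<mu> k x * (u x * ebase u (k - 3) f x))"
        by (rule sum.mono_neutral_cong_right) auto
      also have "\<dots> = (\<Sum>k\<in>{k. k + 3 \<le> n \<and> k mod 4 = 0}. u x * \<mu> (k + 3) x * ebase u k f x)"
      proof (rule sum.reindex_bij_witness[of _ "\<lambda>k. k + 3" "\<lambda>k. k - 3"])
        fix k assume "k \<in> {k. k \<le> n \<and> k mod 4 = 3}"
        then have k: "k \<le> n" "k mod 4 = 3" by auto
        then have "3 \<le> k" using mod_less_eq_dividend[of k 4] by simp
        then show "k - 3 + 3 = k" by simp
        then show "u x * \<mu> (k - 3 + 3) x * ebase u (k - 3) f x = \<mu> k x * (u x * ebase u (k - 3) f x)" by simp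
        have "(k - 3) mod 4 = 0" using k \<open>3 \<le> k\<close> by (metis mod_eq_dvd_iff_nat mod_0_imp_dvd dvd_imp_mod_0 mod_less numeral_less_iff semiring_norm(75,78) mod_mod_trivial)
        then show "k - 3 \<in> {k. k + 3 \<le> n \<and> k mod 4 = 0}" using k \<open>3 \<le> k\<close> by simp
      next
        fix k assume "k \<in> {k. k + 3 \<le> n \<and> k mod 4 = 0}"
        then have "k + 3 \<le> n" "(k + 3) mod 4 = 3" by (auto simp: mod_add_left_eq[symmetric])
        then show "k + 3 \<in> {k. k \<le> n \<and> k mod 4 = 3}" by simp
      qed auto
      also have "\<dots> = (\<Sum>k\<le>Suc n. (if k mod 4 = 0 then u x * \<mu> (k + 3) x else 0) * ebase u k f x)"
        by (rule sum.mono_neutral_cong_left) (auto intro: hi')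
      finally show ?thesis .
    qed
    finally show "deriv (\<Phi> f) x = (\<Sum>k\<le>Suc n. \<nu> k x * ebase u k f x)"
      unfolding \<nu>_def by (simp only: left_diff_distrib distrib_right sum.distrib sum_subtractf)
  qed
  moreover have "\<nu> (Suc n) = \<mu> n" by (auto simp: \<nu>_def hi)
  ultimately show ?thesis by blast
qed

lemma rep_deriv_dbase:
  assumes "rep (\<lambda>k. deriv ^^ k) \<Phi> n \<mu>"
  shows "\<exists>\<nu>. rep (\<lambda>k. deriv ^^ k) (\<lambda>f. deriv (\<Phi> f)) (Suc n) \<nu> \<and> \<nu> (Suc n) = \<mu> n"
proof -
  have C: "\<mu> k \<in> C" and hi: "k > n \<Longrightarrow> \<mu> k = (\<lambda>_. 0)" for k using assms by (auto simp: rep_def)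
  define \<nu> where "\<nu> = (\<lambda>k x. deriv (\<mu> k) x + (if k = 0 then 0 else \<mu> (k - 1) x))"
  have "rep (\<lambda>k. deriv ^^ k) (\<lambda>f. deriv (\<Phi> f)) (Suc n) \<nu>"
    unfolding rep_def
  proof (intro conjI allI impI)
    show "\<nu> k \<in> C" for k
    proof -
      have "(\<lambda>x. if k = 0 then 0 else \<mu> (k - 1) x) \<in> C"
        by (cases "k = 0") (auto intro: C C_const)
      then show ?thesis unfolding \<nu>_def by (intro C_add C_deriv C)
    qed
    show "\<nu> k = (\<lambda>_. 0)" if "k > Suc n" for k
      using that by (auto simp: \<nu>_def hi)
    fix S f x assume S: "open S" "S \<subseteq> \<Omega>" "f holomorphic_on S" "x \<in> S"
    have "deriv (\<Phi> f) x = (\<Sum>k\<le>n. deriv (\<mu> k) x * (deriv ^^ k) f x + \<mu> k x * deriv ((deriv ^^ k) f) x)"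
      by (rule rep_deriv_sum[OF assms _ S]) (auto intro: holomorphic_higher_deriv)
    also have "\<dots> = (\<Sum>k\<le>n. deriv (\<mu> k) x * (deriv ^^ k) f x) + (\<Sum>k\<le>n. \<mu> k x * (deriv ^^ Suc k) f x)"
      by (simp add: sum.distrib)
    also have "(\<Sum>k\<le>n. deriv (\<mu> k) x * (deriv ^^ k) f x) = (\<Sum>k\<le>Suc n. deriv (\<mu> k) x * (deriv ^^ k) f x)"
      using hi by simp
    also have "(\<Sum>k\<le>n. \<mu> k x * (deriv ^^ Suc k) f x) = (\<Sum>k\<le>Suc n. (if k = 0 then 0 else \<mu> (k - 1) x) * (deriv ^^ k) f x)"
      by (simp add: sum.atMost_Suc_shift del: sum.atMost_Suc)
    finally show "deriv (\<Phi> f) x = (\<Sum>k\<le>Suc n. \<nu> k x * (deriv ^^ k) f x)"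
      unfolding \<nu>_def by (simp only: distrib_right sum.distrib)
  qed
  moreover have "\<nu> (Suc n) = \<mu> n" by (auto simp: \<nu>_def hi)
  ultimately show ?thesis by blast
qed

lemma rep_higher_deriv_ebase:
  "\<exists>\<mu>. rep (ebase u) (deriv ^^ n) n \<mu> \<and> \<mu> n = (\<lambda>_. 1)"
proof (induction n)
  case 0
  have "rep (ebase u) (deriv ^^ 0) 0 (\<lambda>k x. if k = 0 then 1 else 0)"
    unfolding rep_def by (auto intro: C_const simp: ebase_def)
  then show ?case by (rule exI[of _ "\<lambda>k x. if k = 0 then 1 else 0", OF conjI]) simp
next
  case (Suc n)
  then obtain \<mu> where "rep (ebase u) (deriv ^^ n) n \<mu>" "\<mu> n = (\<lambda>_. 1)" by blast
  then show ?case using rep_deriv_ebase[of "deriv ^^ n" n \<mu>] by simp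
qed

text \<open>The change of basis is triangular with ones on the diagonal, hence keeps the leading
  coefficient.\<close>

lemma rep_dbase_imp_ebase:
  assumes "rep (\<lambda>k. deriv ^^ k) \<Phi> n m"
  shows "\<exists>\<mu>. rep (ebase u) \<Phi> n \<mu> \<and> \<mu> n = m n"
proof -
  obtain r where r: "\<And>k. rep (ebase u) (deriv ^^ k) k (r k)" "\<And>k. r k k = (\<lambda>_. 1)"
    using rep_higher_deriv_ebase by metis
  have m: "m k \<in> C" for k using assms by (simp add: rep_def)
  have "rep (ebase u) (\<lambda>f x. \<Sum>k\<in>{..n}. m k x * (deriv ^^ k) f x) n (\<lambda>j x. \<Sum>k\<in>{..n}. m k x * r k j x)"
    by (intro rep_sum rep_mult m rep_mono[OF r(1)]) auto
  then have "rep (ebase u) \<Phi> n (\<lambda>j x. \<Sum>k\<in>{..n}. m k x * r k j x)"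
    by (rule rep_cong) (use assms in \<open>auto simp: rep_def\<close>)
  moreover have "(\<lambda>x. \<Sum>k\<in>{..n}. m k x * r k n x) = m n"
  proof
    fix x
    have "r k n = (\<lambda>_. 0)" if "k < n" for k using r(1)[of k] that by (simp add: rep_def)
    then have "(\<Sum>k\<in>{..n}. m k x * r k n x) = (\<Sum>k\<in>{n}. m k x * r k n x)"
      by (intro sum.mono_neutral_right) auto
    then show "(\<Sum>k\<in>{..n}. m k x * r k n x) = m n x" by (simp add: r)
  qed
  ultimately show ?thesis by blast
qed

end

section \<open>Eigenfunctions of the fourth-order operator\<close>

lemma higher_deriv_4_mult:
  assumes "f holomorphic_on S" "g holomorphic_on S" "open S" "x \<in> S"
  shows "(deriv ^^ 4) (\<lambda>x. f x * g x) x = f x * (deriv ^^ 4) g x + 4 * (deriv ^^ 1) f x * (deriv ^^ 3) g x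
    + 6 * (deriv ^^ 2) f x * (deriv ^^ 2) g x + 4 * (deriv ^^ 3) f x * (deriv ^^ 1) g x + (deriv ^^ 4) f x * g x"
proof -
  have "{0..4::nat} = {0, 1, 2, 3, 4}" by auto
  then show ?thesis
    unfolding higher_deriv_mult[OF assms] by (simp add: numeral_eq_Suc binomial_Suc_Suc)
qed

lemma higher_deriv_add4:
  assumes "f holomorphic_on S" "g holomorphic_on S" "h holomorphic_on S" "k holomorphic_on S" "open S" "x \<in> S"
  shows "(deriv ^^ n) (\<lambda>x. f x + g x + h x + k x) x
    = (deriv ^^ n) f x + (deriv ^^ n) g x + (deriv ^^ n) h x + (deriv ^^ n) k x"
proof -
  have "(deriv ^^ n) (\<lambda>x. f x + g x + h x + k x) x = (deriv ^^ n) (\<lambda>x. f x + g x + h x) x + (deriv ^^ n) k x"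
    by (rule higher_deriv_add) (use assms in \<open>auto intro!: holomorphic_intros\<close>)
  also have "(deriv ^^ n) (\<lambda>x. f x + g x + h x) x = (deriv ^^ n) (\<lambda>x. f x + g x) x + (deriv ^^ n) h x"
    by (rule higher_deriv_add) (use assms in \<open>auto intro!: holomorphic_intros\<close>)
  also have "(deriv ^^ n) (\<lambda>x. f x + g x) x = (deriv ^^ n) f x + (deriv ^^ n) g x"
    by (rule higher_deriv_add) (use assms in auto)
  finally show ?thesis .
qed

lemma eigenfunction_higher_derivs:
  fixes v :: "complex \<Rightarrow> complex"
  assumes S: "open S" "x \<in> S" and v: "v holomorphic_on S" and \<psi>: "\<psi> holomorphic_on S"
    and ode: "\<And>y. y \<in> S \<Longrightarrow> (deriv ^^ 4) \<psi> y = v y * \<psi> y"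
  defines "w \<equiv> (\<lambda>i. (deriv ^^ i) \<psi> x)"
  shows "w 4 = v x * w 0"
    and "w 5 = (deriv ^^ 1) v x * w 0 + v x * w 1"
    and "w 6 = (deriv ^^ 2) v x * w 0 + 2 * (deriv ^^ 1) v x * w 1 + v x * w 2"
    and "w 7 = (deriv ^^ 3) v x * w 0 + 3 * (deriv ^^ 2) v x * w 1 + 3 * (deriv ^^ 1) v x * w 2 + v x * w 3"
proof -
  have eq: "w (m + 4) = (\<Sum>i = 0..m. of_nat (m choose i) * (deriv ^^ i) v x * w (m - i))" for m
  proof -
    have "w (m + 4) = (deriv ^^ m) ((deriv ^^ 4) \<psi>) x" by (simp add: w_def funpow_add)
    also have "\<dots> = (deriv ^^ m) (\<lambda>y. v y * \<psi> y) x"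
      by (rule higher_deriv_transform_within_open[of _ S])
         (use S v \<psi> ode in \<open>auto intro!: holomorphic_intros\<close>)
    also have "\<dots> = (\<Sum>i = 0..m. of_nat (m choose i) * (deriv ^^ i) v x * (deriv ^^ (m - i)) \<psi> x)"
      by (rule higher_deriv_mult) (use S v \<psi> in auto)
    finally show ?thesis by (simp add: w_def)
  qed
  have s: "{0..1::nat} = {0, 1}" "{0..2::nat} = {0, 1, 2}" "{0..3::nat} = {0, 1, 2, 3}" by auto
  show "w 4 = v x * w 0" using eq[of 0] by simp
  show "w 5 = (deriv ^^ 1) v x * w 0 + v x * w 1" using eq[of 1] unfolding s by simp
  show "w 6 = (deriv ^^ 2) v x * w 0 + 2 * (deriv ^^ 1) v x * w 1 + v x * w 2"
    using eq[of 2] unfolding s by simp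
  show "w 7 = (deriv ^^ 3) v x * w 0 + 3 * (deriv ^^ 2) v x * w 1 + 3 * (deriv ^^ 1) v x * w 2 + v x * w 3"
    using eq[of 3] unfolding s by (simp add: numeral_eq_Suc binomial_Suc_Suc)
qed

text \<open>The equation eliminates \<open>w 4\<close> to \<open>w 7\<close>. As the jet
  \<open>w 0\<close>, ..., \<open>w 3\<close> of an eigenfunction at a point is arbitrary, the four
  brackets vanish separately if \<phi> is an eigenfunction whenever \<psi> is.\<close>

lemma eigenfunction_commutator:
  fixes v :: "complex \<Rightarrow> complex"
  assumes S: "open S" "x \<in> S" and v: "v holomorphic_on S" and \<psi>: "\<psi> holomorphic_on S"
    and ode: "\<And>y. y \<in> S \<Longrightarrow> (deriv ^^ 4) \<psi> y = v y * \<psi> y"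
    and abcd: "a holomorphic_on S" "b holomorphic_on S" "c holomorphic_on S" "d holomorphic_on S"
  defines "w \<equiv> (\<lambda>i. (deriv ^^ i) \<psi> x)"
    and "\<phi> \<equiv> (\<lambda>y. a y * (deriv ^^ 3) \<psi> y + b y * (deriv ^^ 2) \<psi> y + c y * (deriv ^^ 1) \<psi> y + d y * \<psi> y)"
  shows "(deriv ^^ 4) \<phi> x - v x * \<phi> x =
      ((deriv ^^ 4) a x + 4 * (deriv ^^ 3) b x + 6 * (deriv ^^ 2) c x + 4 * (deriv ^^ 1) d x) * w 3
    + (4 * (deriv ^^ 1) a x * v x + 3 * a x * (deriv ^^ 1) v x + (deriv ^^ 4) b x + 4 * (deriv ^^ 3) c x
        + 6 * (deriv ^^ 2) d x) * w 2
    + (6 * (deriv ^^ 2) a x * v x + 8 * (deriv ^^ 1) a x * (deriv ^^ 1) v x + 3 * a x * (deriv ^^ 2) v x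
        + 4 * (deriv ^^ 1) b x * v x + 2 * b x * (deriv ^^ 1) v x + (deriv ^^ 4) c x + 4 * (deriv ^^ 3) d x) * w 1
    + (4 * (deriv ^^ 3) a x * v x + 6 * (deriv ^^ 2) a x * (deriv ^^ 1) v x + 4 * (deriv ^^ 1) a x * (deriv ^^ 2) v x
        + a x * (deriv ^^ 3) v x + 6 * (deriv ^^ 2) b x * v x + 4 * (deriv ^^ 1) b x * (deriv ^^ 1) v x
        + b x * (deriv ^^ 2) v x + 4 * (deriv ^^ 1) c x * v x + c x * (deriv ^^ 1) v x + (deriv ^^ 4) d x) * w 0"
proof -
  have w: "w 4 = v x * w 0" "w 5 = (deriv ^^ 1) v x * w 0 + v x * w 1"
    "w 6 = (deriv ^^ 2) v x * w 0 + 2 * (deriv ^^ 1) v x * w 1 + v x * w 2"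
    "w 7 = (deriv ^^ 3) v x * w 0 + 3 * (deriv ^^ 2) v x * w 1 + 3 * (deriv ^^ 1) v x * w 2 + v x * w 3"
    using eigenfunction_higher_derivs[OF S v \<psi> ode] by (simp_all only: w_def)
  have hol: "(deriv ^^ n) \<psi> holomorphic_on S" for n using \<psi> S by (intro holomorphic_higher_deriv)
  have fw: "(deriv ^^ m) ((deriv ^^ n) \<psi>) x = w (m + n)" for m n
    by (simp add: w_def funpow_add)
  have fw0: "(deriv ^^ n) \<psi> x = w n" "\<psi> x = w 0" for n by (simp_all add: w_def)
  have "(deriv ^^ 4) \<phi> x = (deriv ^^ 4) (\<lambda>y. a y * (deriv ^^ 3) \<psi> y) x + (deriv ^^ 4) (\<lambda>y. b y * (deriv ^^ 2) \<psi> y) x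
    + (deriv ^^ 4) (\<lambda>y. c y * (deriv ^^ 1) \<psi> y) x + (deriv ^^ 4) (\<lambda>y. d y * \<psi> y) x"
    unfolding \<phi>_def
    by (rule higher_deriv_add4[of _ S]) (use S abcd \<psi> hol in \<open>auto intro!: holomorphic_intros simp del: funpow.simps\<close>)
  also have "\<dots> = (a x * w 7 + 4 * (deriv ^^ 1) a x * w 6 + 6 * (deriv ^^ 2) a x * w 5 + 4 * (deriv ^^ 3) a x * w 4 + (deriv ^^ 4) a x * w 3)
    + (b x * w 6 + 4 * (deriv ^^ 1) b x * w 5 + 6 * (deriv ^^ 2) b x * w 4 + 4 * (deriv ^^ 3) b x * w 3 + (deriv ^^ 4) b x * w 2)
    + (c x * w 5 + 4 * (deriv ^^ 1) c x * w 4 + 6 * (deriv ^^ 2) c x * w 3 + 4 * (deriv ^^ 3) c x * w 2 + (deriv ^^ 4) c x * w 1)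
    + (d x * w 4 + 4 * (deriv ^^ 1) d x * w 3 + 6 * (deriv ^^ 2) d x * w 2 + 4 * (deriv ^^ 3) d x * w 1 + (deriv ^^ 4) d x * w 0)"
    unfolding higher_deriv_4_mult[OF abcd(1) hol S] higher_deriv_4_mult[OF abcd(2) hol S]
      higher_deriv_4_mult[OF abcd(3) hol S] higher_deriv_4_mult[OF abcd(4) \<psi> S] fw fw0
    by (simp add: eval_nat_numeral)
  finally have 1: "(deriv ^^ 4) \<phi> x = \<dots>" .
  have 2: "\<phi> x = a x * w 3 + b x * w 2 + c x * w 1 + d x * w 0" by (simp add: \<phi>_def w_def)
  show ?thesis unfolding 1 2 w by algebra
qed

context coefficient_ring
begin

lemma ebase_eigenfunction:
  assumes S: "open S" "S \<subseteq> \<Omega>" "\<psi> holomorphic_on S"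
    and ode: "\<And>y. y \<in> S \<Longrightarrow> (deriv ^^ 4) \<psi> y = (z - u y) * \<psi> y" and x: "x \<in> S"
  shows "ebase u k \<psi> x = z ^ (k div 4) * (deriv ^^ (k mod 4)) \<psi> x"
proof -
  have u: "u holomorphic_on S" using u_holomorphic S(2) holomorphic_on_subset by blast
  note hol = holomorphic_app_L4[OF S(1) u S(3)]
  have tr: "(deriv ^^ i) ((app (L4 u) ^^ j) \<psi>) y = z ^ j * (deriv ^^ i) \<psi> y"
    if eq: "\<And>y. y \<in> S \<Longrightarrow> (app (L4 u) ^^ j) \<psi> y = z ^ j * \<psi> y" and "y \<in> S" for i j y
  proof -
    have "(deriv ^^ i) ((app (L4 u) ^^ j) \<psi>) y = (deriv ^^ i) (\<lambda>y. z ^ j * \<psi> y) y"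
      by (rule higher_deriv_transform_within_open[of _ S])
         (use S hol that in \<open>auto intro!: holomorphic_intros\<close>)
    also have "\<dots> = z ^ j * (deriv ^^ i) \<psi> y" by (rule higher_deriv_cmult) (use S that in auto)
    finally show ?thesis .
  qed
  have "y \<in> S \<Longrightarrow> (app (L4 u) ^^ j) \<psi> y = z ^ j * \<psi> y" for j y
  proof (induction j arbitrary: y)
    case (Suc j)
    have "(app (L4 u) ^^ Suc j) \<psi> y = u y * (app (L4 u) ^^ j) \<psi> y + (deriv ^^ 4) ((app (L4 u) ^^ j) \<psi>) y"
      by (simp add: app_L4)
    also have "(deriv ^^ 4) ((app (L4 u) ^^ j) \<psi>) y = z ^ j * (deriv ^^ 4) \<psi> y"
      by (rule tr) (use Suc in auto)
    also have "u y * (app (L4 u) ^^ j) \<psi> y + z ^ j * (deriv ^^ 4) \<psi> y = z ^ Suc j * \<psi> y"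
      unfolding Suc.IH[OF Suc.prems] ode[OF Suc.prems] by (simp add: algebra_simps)
    finally show ?case .
  qed simp
  then show ?thesis unfolding ebase_def by (intro tr x)
qed

lemma eigenfunction_exists:
  assumes "ball x \<epsilon> \<subseteq> \<Omega>" "\<epsilon> > 0"
  obtains \<psi> where "\<psi> holomorphic_on ball x \<epsilon>" "\<And>y. y \<in> ball x \<epsilon> \<Longrightarrow> (deriv ^^ 4) \<psi> y = (z - u y) * \<psi> y"
    "\<And>i. i < 4 \<Longrightarrow> (deriv ^^ i) \<psi> x = w i"
proof -
  have "(\<lambda>y. z - u y) holomorphic_on ball x \<epsilon>"
    using u_holomorphic assms by (auto intro!: holomorphic_intros intro: holomorphic_on_subset)
  from linear_ode_exists[OF this assms(2), of w] show ?thesis using that by blast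
qed

text \<open>A unit initial jet selects the indices congruent to i modulo 4. Their sum is a
  polynomial in z that vanishes for every z, so each of its coefficients is zero.\<close>

lemma rep_eq_0_on_eigenfunctions:
  assumes rep: "rep (ebase u) \<Phi> n \<mu>" and ball: "ball x \<epsilon> \<subseteq> \<Omega>" "\<epsilon> > 0"
    and 0: "\<And>z \<psi>. \<psi> holomorphic_on ball x \<epsilon> \<Longrightarrow>
      (\<And>y. y \<in> ball x \<epsilon> \<Longrightarrow> (deriv ^^ 4) \<psi> y = (z - u y) * \<psi> y) \<Longrightarrow> \<Phi> \<psi> x = 0"
  shows "\<mu> k x = 0"
proof (cases "k \<le> n")
  case True
  define i j where "i = k mod 4" and "j = k div 4"
  define p where "p = (\<Sum>k | k \<le> n \<and> k mod 4 = i. monom (\<mu> k x) (k div 4))"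
  have "poly p z = 0" for z
  proof -
    obtain \<psi> where \<psi>: "\<psi> holomorphic_on ball x \<epsilon>" "\<And>y. y \<in> ball x \<epsilon> \<Longrightarrow> (deriv ^^ 4) \<psi> y = (z - u y) * \<psi> y"
      "\<And>l. l < 4 \<Longrightarrow> (deriv ^^ l) \<psi> x = (if l = i then 1 else 0)"
      using eigenfunction_exists[OF ball, of z "\<lambda>l. if l = i then 1 else 0"] by blast
    have x: "x \<in> ball x \<epsilon>" using ball by simp
    have "0 = \<Phi> \<psi> x" using 0 \<psi> by metis
    also have "\<dots> = (\<Sum>k\<le>n. \<mu> k x * ebase u k \<psi> x)"
      using rep \<psi>(1) ball x unfolding rep_def by blast
    also have "\<dots> = (\<Sum>k\<le>n. \<mu> k x * (z ^ (k div 4) * (if k mod 4 = i then 1 else 0)))"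
      using ebase_eigenfunction[OF open_ball ball(1) \<psi>(1,2) x] \<psi>(3) by simp
    also have "\<dots> = (\<Sum>k | k \<le> n \<and> k mod 4 = i. \<mu> k x * z ^ (k div 4))"
      by (rule sum.mono_neutral_cong_right) auto
    also have "\<dots> = poly p z" by (simp add: p_def poly_sum poly_monom)
    finally show ?thesis by simp
  qed
  then have "p = 0" using poly_all_0_iff_0 by blast
  then have "0 = coeff p j" by simp
  also have "\<dots> = (\<Sum>k' | k' \<le> n \<and> k' mod 4 = i. if k' div 4 = j then \<mu> k' x else 0)"
    by (simp add: p_def coeff_sum)
  also have "\<dots> = (\<Sum>k'\<in>{k}. \<mu> k' x)"
  proof (rule sum.mono_neutral_cong_right)
    show "\<forall>k'\<in>{k'. k' \<le> n \<and> k' mod 4 = i} - {k}. (if k' div 4 = j then \<mu> k' x else 0) = 0"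
      by (auto simp: i_def j_def) (metis mult_div_mod_eq)
  qed (use True in \<open>auto simp: i_def j_def\<close>)
  finally show ?thesis by simp
next
  case False
  then show ?thesis using rep by (simp add: rep_def)
qed

end

section \<open>From a commuting operator to a terminating recursion\<close>

lemma regular_on_L4 [simp]: "regular_on (L4 u) S \<longleftrightarrow> u holomorphic_on S"
  by (auto simp: regular_on_def L4_def)

lemma sum_blocks4: "(\<Sum>k<4 * n. g k) = (\<Sum>j<n. g (4 * j) + g (4 * j + 1) + g (4 * j + 2) + g (4 * j + 3))"
  for g :: "nat \<Rightarrow> 'a::comm_monoid_add"
  by (induction n) (simp_all add: numeral_eq_Suc add.assoc)

lemma common_punctured_disc:
  assumes "\<And>f. f \<in> set fs \<Longrightarrow> f meromorphic_on {a}"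
  obtains r where "r > 0" "\<And>f. f \<in> set fs \<Longrightarrow> f holomorphic_on ball a r - {a}"
proof -
  have "\<exists>r>0. \<forall>f\<in>set fs. f holomorphic_on ball a r - {a}"
    using assms
  proof (induction fs)
    case Nil
    then show ?case by (auto intro: exI[of _ 1])
  next
    case (Cons f fs)
    then obtain r where r: "r > 0" "\<forall>f\<in>set fs. f holomorphic_on ball a r - {a}" by auto
    have "isolated_singularity_at f a" using Cons.prems by (auto simp: meromorphic_at_iff)
    then obtain s where s: "s > 0" "f analytic_on ball a s - {a}" unfolding isolated_singularity_at_def by blast
    have "f holomorphic_on ball a (min r s) - {a}"
      using analytic_imp_holomorphic[OF s(2)] by (rule holomorphic_on_subset) auto
    moreover have "g holomorphic_on ball a (min r s) - {a}" if "g \<in> set fs" for g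
      using r(2) that by (auto intro: holomorphic_on_subset)
    ultimately show ?case using r(1) s(1) by (intro exI[of _ "min r s"]) auto
  qed
  then show ?thesis using that by blast
qed

lemma has_laurent_expansion_higher_deriv_at:
  assumes "(\<lambda>w. f (z + w)) has_laurent_expansion F"
  shows "(\<lambda>w. (deriv ^^ n) f (z + w)) has_laurent_expansion (fls_deriv ^^ n) F"
  by (induction n) (auto intro: assms has_laurent_expansion_deriv_at)

lemma has_laurent_expansion_eq_0:
  assumes "(\<lambda>w. f (a + w)) has_laurent_expansion F" "r > 0" "\<And>x. x \<in> ball a r - {a} \<Longrightarrow> f x = 0"
  shows "F = 0"
proof -
  have "\<forall>\<^sub>F w in at 0. f (a + w) = 0"
    unfolding eventually_at using assms(2,3) by (intro exI[of _ r]) (auto simp: dist_norm)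
  then have "(\<lambda>w. 0) has_laurent_expansion F"
    using has_laurent_expansion_cong[of "\<lambda>w. f (a + w)" "\<lambda>_. 0" F F] assms(1) by simp
  then show ?thesis using has_laurent_expansion_0 has_laurent_expansion_unique by blast
qed

lemma app_cmult_eigenfunction:
  assumes "open S" "\<psi> holomorphic_on S" "\<And>y. y \<in> S \<Longrightarrow> f y = z * \<psi> y" "x \<in> S"
  shows "app M f x = z * app M \<psi> x"
proof -
  have "f holomorphic_on S \<longleftrightarrow> (\<lambda>y. z * \<psi> y) holomorphic_on S"
    by (rule holomorphic_cong) (use assms in auto)
  then have f: "f holomorphic_on S" using assms by (auto intro: holomorphic_intros)
  have "(deriv ^^ i) f x = z * (deriv ^^ i) \<psi> x" for i
  proof -
    have "(deriv ^^ i) f x = (deriv ^^ i) (\<lambda>y. z * \<psi> y) x"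
      by (rule higher_deriv_transform_within_open[OF f _ assms(1,4,3)]) (use assms in \<open>auto intro: holomorphic_intros\<close>)
    also have "\<dots> = z * (deriv ^^ i) \<psi> x" by (rule higher_deriv_cmult) (use assms in auto)
    finally show ?thesis .
  qed
  then show ?thesis by (simp add: app_def sum_distrib_left mult.left_commute)
qed

text \<open>The first three components of the condition that \<open>A \<psi>''' + B \<psi>'' + C \<psi>' + D \<psi>\<close> is again an
  eigenfunction combine to the homogeneous Lenard equation for \<open>2 B + A'\<close>.\<close>

lemma lenard_of_commuting:
  fixes A B C D U V :: "complex fls"
  assumes V: "V = fls_const z - U"
    and 1: "(fls_deriv ^^ 4) A + 4 * (fls_deriv ^^ 3) B + 6 * (fls_deriv ^^ 2) C + 4 * (fls_deriv ^^ 1) D = 0"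
    and 2: "4 * (fls_deriv ^^ 1) A * V + 3 * A * (fls_deriv ^^ 1) V + (fls_deriv ^^ 4) B + 4 * (fls_deriv ^^ 3) C
        + 6 * (fls_deriv ^^ 2) D = 0"
    and 3: "6 * (fls_deriv ^^ 2) A * V + 8 * (fls_deriv ^^ 1) A * (fls_deriv ^^ 1) V + 3 * A * (fls_deriv ^^ 2) V
        + 4 * (fls_deriv ^^ 1) B * V + 2 * B * (fls_deriv ^^ 1) V + (fls_deriv ^^ 4) C + 4 * (fls_deriv ^^ 3) D = 0"
  shows "lenard U (2 * B + fls_deriv A) = 4 * (fls_const z * fls_deriv (2 * B + fls_deriv A))"
proof -
  \<comment> \<open>The combination is (3) - (2)' + (1)''/2; its weights cancel the fourth
    derivative of C and the third of D. What remains is half of the equation for 2 B + A'.\<close>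
  have d1: "fls_deriv (fls_deriv ((fls_deriv ^^ 4) A + 4 * (fls_deriv ^^ 3) B + 6 * (fls_deriv ^^ 2) C + 4 * (fls_deriv ^^ 1) D)) = 0"
    unfolding 1 by simp
  have d2: "fls_deriv (4 * (fls_deriv ^^ 1) A * V + 3 * A * (fls_deriv ^^ 1) V + (fls_deriv ^^ 4) B + 4 * (fls_deriv ^^ 3) C
        + 6 * (fls_deriv ^^ 2) D) = 0"
    unfolding 2 by simp
  have U: "fls_const z = U + V" "fls_deriv V = - fls_deriv U" using V by simp_all
  show ?thesis
    using d1 d2 3 unfolding U(1) lenard_def by (simp add: eval_nat_numeral U(2)) algebra
qed

text \<open>The argument is local at \<open>a\<close>. Pointwise identities on a punctured disc,
  found by testing on eigenfunctions, become identities of Laurent series; comparing powers of z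
  then gives the recursion.\<close>

lemma commuting_imp_lenard_seq:
  assumes u: "u meromorphic_on {a}" and M: "diff_operator M" "diff_order M = 4 * h + 2"
    and comm: "commuting (L4 u) M"
  obtains b where "lenard_seq (laurent_expansion u a) b" "b 0 $$ 0 \<noteq> 0" "b (Suc h) = 0"
proof -
  define U where "U = laurent_expansion u a"
  have M_mero: "c meromorphic_on {a}" if "c \<in> set M" for c
    using M(1) that by (auto simp: diff_operator_def nicely_meromorphic_on_def intro: meromorphic_on_subset)
  obtain r where r: "r > 0" "\<And>f. f \<in> set (u # M) \<Longrightarrow> f holomorphic_on ball a r - {a}"
    using common_punctured_disc[of "u # M" a] u M_mero by auto
  define \<Omega> where "\<Omega> = ball a r - {a}"
  define C where "C = {f. f holomorphic_on \<Omega> \<and> f meromorphic_on {a}}"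
  have open_\<Omega>: "open \<Omega>" unfolding \<Omega>_def by auto
  interpret coefficient_ring \<Omega> C u
    by unfold_locales
       (use open_\<Omega> r u in \<open>auto simp: C_def \<Omega>_def intro!: holomorphic_intros meromorphic_intros holomorphic_deriv\<close>)
  define m where "m = (\<lambda>k. if k < length M then M ! k else (\<lambda>_. 0))"
  have len: "length M = 4 * h + 3" using M by (auto simp: diff_operator_def diff_order_def)
  have "rep (\<lambda>k. deriv ^^ k) (app M) (4 * h + 2) m"
    unfolding rep_def
  proof (intro conjI allI impI)
    show "m k \<in> C" for k
      using r M_mero by (auto simp: m_def C_def \<Omega>_def)
    show "m k = (\<lambda>_. 0)" if "k > 4 * h + 2" for k using that len by (simp add: m_def)
    have "{..<4 * h + 3} = {..4 * h + 2}" by auto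
    then show "app M f x = (\<Sum>k\<le>4 * h + 2. m k x * (deriv ^^ k) f x)" for f x
      unfolding app_def len by (intro sum.cong) (auto simp: m_def len)
  qed
  then obtain \<mu> where \<mu>: "rep (ebase u) (app M) (4 * h + 2) \<mu>" "\<mu> (4 * h + 2) = m (4 * h + 2)"
    using rep_dbase_imp_ebase by blast
  have \<mu>C: "\<mu> k \<in> C" and \<mu>0: "k > 4 * h + 2 \<Longrightarrow> \<mu> k = (\<lambda>_. 0)" for k using \<mu>(1) by (auto simp: rep_def)
  define P where "P = (\<lambda>i z x. \<Sum>j<Suc h. \<mu> (4 * j + i) x * z ^ j)"
  have PC: "P i z \<in> C" for i z
    unfolding P_def by (intro C_sum C_mult \<mu>C C_const)
  have eqs:
    "(deriv ^^ 4) (P 3 z) x + 4 * (deriv ^^ 3) (P 2 z) x + 6 * (deriv ^^ 2) (P 1 z) x + 4 * (deriv ^^ 1) (P 0 z) x = 0"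
    (is "?E3 = 0")
    "4 * (deriv ^^ 1) (P 3 z) x * (z - u x) + 3 * P 3 z x * (deriv ^^ 1) (\<lambda>y. z - u y) x + (deriv ^^ 4) (P 2 z) x
        + 4 * (deriv ^^ 3) (P 1 z) x + 6 * (deriv ^^ 2) (P 0 z) x = 0"
    (is "?E2 = 0")
    "6 * (deriv ^^ 2) (P 3 z) x * (z - u x) + 8 * (deriv ^^ 1) (P 3 z) x * (deriv ^^ 1) (\<lambda>y. z - u y) x
        + 3 * P 3 z x * (deriv ^^ 2) (\<lambda>y. z - u y) x
        + 4 * (deriv ^^ 1) (P 2 z) x * (z - u x) + 2 * P 2 z x * (deriv ^^ 1) (\<lambda>y. z - u y) x
        + (deriv ^^ 4) (P 1 z) x + 4 * (deriv ^^ 3) (P 0 z) x = 0"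
    (is "?E1 = 0")
    if x: "x \<in> \<Omega>" for x z
  proof -
    obtain \<epsilon> where \<epsilon>: "\<epsilon> > 0" "ball x \<epsilon> \<subseteq> \<Omega>" using open_\<Omega> x open_contains_ball by blast
    define S where "S = ball x \<epsilon>"
    have S: "open S" "x \<in> S" "S \<subseteq> \<Omega>" using \<epsilon> by (auto simp: S_def)
    \<comment> \<open>Jets with \<open>w 0 = 0\<close> leave the three brackets that enter
      \<open>lenard_of_commuting\<close>; unit vectors then separate them.\<close>
    have "?E3 * w 3 + ?E2 * w 2 + ?E1 * w 1 = 0"
      if w: "w 0 = 0" for w :: "nat \<Rightarrow> complex"
    proof -
      obtain \<psi> where \<psi>: "\<psi> holomorphic_on S" "\<And>y. y \<in> S \<Longrightarrow> (deriv ^^ 4) \<psi> y = (z - u y) * \<psi> y"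
        "\<And>i. i < 4 \<Longrightarrow> (deriv ^^ i) \<psi> x = w i"
        using eigenfunction_exists[OF \<epsilon>(2,1), of z w] unfolding S_def by blast
      have uS: "u holomorphic_on S" using S u_holomorphic holomorphic_on_subset by blast
      define \<phi> where "\<phi> = (\<lambda>y. P 3 z y * (deriv ^^ 3) \<psi> y + P 2 z y * (deriv ^^ 2) \<psi> y + P 1 z y * (deriv ^^ 1) \<psi> y + P 0 z y * \<psi> y)"
      have M\<psi>: "app M \<psi> y = \<phi> y" if y: "y \<in> S" for y
      proof -
        have "app M \<psi> y = (\<Sum>k\<le>4 * h + 2. \<mu> k y * ebase u k \<psi> y)"
          using \<mu>(1) S \<psi>(1) y unfolding rep_def by blast
        \<comment> \<open>Padding to full blocks of four: the added index 4 h + 3 lies above the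
          order of M and has coefficient 0.\<close>
        also have "\<dots> = (\<Sum>k<4 * Suc h. \<mu> k y * ebase u k \<psi> y)"
          by (rule sum.mono_neutral_left) (auto simp: \<mu>0)
        also have "\<dots> = (\<Sum>k<4 * Suc h. \<mu> k y * (z ^ (k div 4) * (deriv ^^ (k mod 4)) \<psi> y))"
          using ebase_eigenfunction[OF S(1,3) \<psi>(1,2) y] by simp
        also have "\<dots> = (\<Sum>j<Suc h. \<mu> (4 * j) y * z ^ j * \<psi> y + \<mu> (4 * j + 1) y * z ^ j * (deriv ^^ 1) \<psi> y
            + \<mu> (4 * j + 2) y * z ^ j * (deriv ^^ 2) \<psi> y + \<mu> (4 * j + 3) y * z ^ j * (deriv ^^ 3) \<psi> y)"
        proof -
          have dm0: "(4 * j + i) div 4 = j" "(4 * j + i) mod 4 = i" if "i < 4" for i j :: nat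
            using that by simp_all
          have dm: "4 * j div 4 = j" "4 * j mod 4 = 0" "(4 * j + 1) div 4 = j" "(4 * j + 1) mod 4 = 1"
            "(4 * j + 2) div 4 = j" "(4 * j + 2) mod 4 = 2" "(4 * j + 3) div 4 = j" "(4 * j + 3) mod 4 = 3" for j :: nat
            using dm0[of 0 j] dm0[of 1 j] dm0[of 2 j] dm0[of 3 j] by simp_all
          show ?thesis unfolding sum_blocks4 by (simp only: dm mult.assoc funpow_0)
        qed
        also have "\<dots> = \<phi> y"
          unfolding \<phi>_def P_def sum_distrib_right sum.distrib by (simp add: add_ac)
        finally show ?thesis .
      qed
      have PS: "P i z holomorphic_on S" for i using PC S C_holomorphic_subset by blast
      have \<phi>S: "\<phi> holomorphic_on S" unfolding \<phi>_def
        by (intro holomorphic_intros PS \<psi> S holomorphic_higher_deriv)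
      have MS: "regular_on M S"
        using r(2) S unfolding regular_on_def \<Omega>_def by (auto intro: holomorphic_on_subset)
      have "app (L4 u) (app M \<psi>) x = app M (app (L4 u) \<psi>) x"
        using comm S uS MS \<psi>(1) unfolding commuting_def by simp
      also have "\<dots> = z * app M \<psi> x"
        by (rule app_cmult_eigenfunction[OF S(1) \<psi>(1) _ S(2)]) (simp add: app_L4 \<psi>(2) algebra_simps)
      also have "app (L4 u) (app M \<psi>) x = u x * \<phi> x + (deriv ^^ 4) \<phi> x"
      proof -
        have "app M \<psi> holomorphic_on S \<longleftrightarrow> \<phi> holomorphic_on S"
          by (rule holomorphic_cong) (use M\<psi> in auto)
        then have "(deriv ^^ 4) (app M \<psi>) x = (deriv ^^ 4) \<phi> x"
          using \<phi>S by (intro higher_deriv_transform_within_open[OF _ \<phi>S S(1,2) M\<psi>]) auto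
        then show ?thesis using M\<psi> S by (simp add: app_L4)
      qed
      finally have "(deriv ^^ 4) \<phi> x - (z - u x) * \<phi> x = 0" using M\<psi> S by (simp add: algebra_simps)
      moreover have vS: "(\<lambda>y. z - u y) holomorphic_on S" using uS by (intro holomorphic_intros)
      moreover have "(deriv ^^ 3) \<psi> x = w 3" "(deriv ^^ 2) \<psi> x = w 2" "(deriv ^^ 1) \<psi> x = w 1" "(deriv ^^ 0) \<psi> x = 0"
        using \<psi>(3)[of 3] \<psi>(3)[of 2] \<psi>(3)[of 1] \<psi>(3)[of 0] w by auto
      ultimately show ?thesis
        using eigenfunction_commutator[OF S(1,2) vS \<psi>(1,2) PS[of 3] PS[of 2] PS[of 1] PS[of 0]]
        unfolding \<phi>_def by simp
    qed
    from this[of "\<lambda>i. if i = 3 then 1 else 0"] this[of "\<lambda>i. if i = 2 then 1 else 0"] this[of "\<lambda>i. if i = 1 then 1 else 0"]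
    show "?E3 = 0" "?E2 = 0" "?E1 = 0" by simp_all
  qed
  define L where "L = (\<lambda>k. laurent_expansion (\<mu> k) a)"
  have L: "(\<lambda>w. \<mu> k (a + w)) has_laurent_expansion L k" for k
    using \<mu>C[of k] unfolding L_def C_def by (auto intro: meromorphic_on_imp_has_laurent_expansion)
  have UL: "(\<lambda>w. u (a + w)) has_laurent_expansion U"
    using u unfolding U_def by (auto intro: meromorphic_on_imp_has_laurent_expansion)
  define PL where "PL = (\<lambda>i z. \<Sum>j<Suc h. L (4 * j + i) * fls_const (z ^ j))"
  have PL: "(\<lambda>w. (deriv ^^ n) (P i z) (a + w)) has_laurent_expansion (fls_deriv ^^ n) (PL i z)" for n i z
  proof (rule has_laurent_expansion_higher_deriv_at)
    show "(\<lambda>w. P i z (a + w)) has_laurent_expansion PL i z"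
      unfolding P_def PL_def by (intro laurent_expansion_intros L)
  qed
  have VL: "(\<lambda>w. (deriv ^^ n) (\<lambda>y. z - u y) (a + w)) has_laurent_expansion (fls_deriv ^^ n) (fls_const z - U)" for n z
    by (rule has_laurent_expansion_higher_deriv_at) (intro laurent_expansion_intros UL)
  note PL0 = PL[of 0, simplified]
  define q where "q = (\<lambda>j. 2 * L (4 * j + 2) + fls_deriv (L (4 * j + 3)))"
  have Q: "2 * PL 2 z + fls_deriv (PL 3 z) = (\<Sum>j<Suc h. fls_const (z ^ j) * q j)" for z
    unfolding PL_def q_def by (simp add: fls_deriv_sum sum_distrib_left sum.distrib algebra_simps del: sum.lessThan_Suc)
  have len_Q: "lenard U (\<Sum>j<Suc h. fls_const (z ^ j) * q j) = 4 * (fls_const z * fls_deriv (\<Sum>j<Suc h. fls_const (z ^ j) * q j))" for z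
    unfolding Q[symmetric]
  proof (rule lenard_of_commuting[of "fls_const z - U" z U "PL 3 z" "PL 2 z" "PL 1 z" "PL 0 z"])
    show "(fls_deriv ^^ 4) (PL 3 z) + 4 * (fls_deriv ^^ 3) (PL 2 z) + 6 * (fls_deriv ^^ 2) (PL 1 z) + 4 * (fls_deriv ^^ 1) (PL 0 z) = 0"
      by (rule has_laurent_expansion_eq_0[OF _ r(1) eqs(1)[where z = z, unfolded \<Omega>_def]])
         (intro laurent_expansion_intros, (rule PL)+)
    show "4 * (fls_deriv ^^ 1) (PL 3 z) * (fls_const z - U) + 3 * PL 3 z * (fls_deriv ^^ 1) (fls_const z - U) + (fls_deriv ^^ 4) (PL 2 z) + 4 * (fls_deriv ^^ 3) (PL 1 z)
        + 6 * (fls_deriv ^^ 2) (PL 0 z) = 0"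
      by (rule has_laurent_expansion_eq_0[OF _ r(1) eqs(2)[where z = z, unfolded \<Omega>_def]])
         (intro laurent_expansion_intros, (rule UL PL PL0 VL)+)
    show "6 * (fls_deriv ^^ 2) (PL 3 z) * (fls_const z - U) + 8 * (fls_deriv ^^ 1) (PL 3 z) * (fls_deriv ^^ 1) (fls_const z - U) + 3 * PL 3 z * (fls_deriv ^^ 2) (fls_const z - U)
        + 4 * (fls_deriv ^^ 1) (PL 2 z) * (fls_const z - U) + 2 * PL 2 z * (fls_deriv ^^ 1) (fls_const z - U) + (fls_deriv ^^ 4) (PL 1 z) + 4 * (fls_deriv ^^ 3) (PL 0 z) = 0"
      by (rule has_laurent_expansion_eq_0[OF _ r(1) eqs(3)[where z = z, unfolded \<Omega>_def]])
         (intro laurent_expansion_intros, (rule UL PL PL0 VL)+)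
  qed simp
  \<comment> \<open>Coefficients of z^j in \<open>len_Q\<close>. The factor z shifts the index on
    the right, so j = h + 1 says that q h has derivative 0.\<close>
  have coeffs: "(if j \<le> h then lenard U (q j) else 0) = (if j = 0 then 0 else 4 * fls_deriv (q (j - 1)))" if "j \<le> Suc h" for j
  proof (rule fls_eqI)
    fix n
    define p where "p = (\<Sum>j<Suc h. monom (lenard U (q j) $$ n) j) - (\<Sum>j<Suc h. monom (4 * fls_deriv (q j) $$ n) (Suc j))"
    have "poly p z = 0" for z
    proof -
      have "lenard U (\<Sum>j<Suc h. fls_const (z ^ j) * q j) $$ n = (\<Sum>j<Suc h. lenard U (q j) $$ n * z ^ j)"
        by (simp only: lenard_sum lenard_const_mult fls_nth_sum fls_mult_const_nth) (simp only: mult.commute)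
      moreover have "(4 * (fls_const z * fls_deriv (\<Sum>j<Suc h. fls_const (z ^ j) * q j))) $$ n
          = (\<Sum>j<Suc h. 4 * fls_deriv (q j) $$ n * z ^ Suc j)"
      proof -
        have "fls_deriv (\<Sum>j<Suc h. fls_const (z ^ j) * q j) = (\<Sum>j<Suc h. fls_const (z ^ j) * fls_deriv (q j))"
          by (simp add: fls_deriv_sum del: sum.lessThan_Suc)
        then show ?thesis
          by (simp only: fls_mult_of_numeral_nth fls_mult_const_nth fls_nth_sum sum_distrib_left)
             (simp only: power_Suc mult_ac)
      qed
      ultimately show ?thesis using len_Q[of z]
        by (simp add: p_def poly_sum poly_monom del: sum.lessThan_Suc fls_deriv_nth)
    qed
    then have "coeff p j = 0" using poly_all_0_iff_0 by (metis coeff_0)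
    moreover have "coeff p j = (if j \<le> h then lenard U (q j) $$ n else 0) - (if j = 0 then 0 else 4 * fls_deriv (q (j - 1)) $$ n)"
    proof -
      have "coeff p j = (\<Sum>i<Suc h. if i = j then lenard U (q i) $$ n else 0) - (\<Sum>i<Suc h. if Suc i = j then 4 * fls_deriv (q i) $$ n else 0)"
        by (simp add: p_def coeff_sum del: sum.lessThan_Suc fls_deriv_nth)
      also have "(\<Sum>i<Suc h. if Suc i = j then 4 * fls_deriv (q i) $$ n else 0) = (\<Sum>i<Suc h. if i = j - 1 \<and> j \<noteq> 0 then 4 * fls_deriv (q i) $$ n else 0)"
        by (rule sum.cong) auto
      finally show ?thesis using that
        by (cases "j = 0") (auto simp: less_Suc_eq_le simp del: sum.lessThan_Suc fls_deriv_nth)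
    qed
    ultimately show "(if j \<le> h then lenard U (q j) else 0) $$ n = (if j = 0 then 0 else 4 * fls_deriv (q (j - 1))) $$ n"
      by (auto simp del: fls_deriv_nth split: if_splits)
  qed
  \<comment> \<open>Reversal puts the top power of z first. The default 0 beyond h is the
    termination, and the recursion at j = h is the comparison at z^0.\<close>
  define b where "b = (\<lambda>j. if j \<le> h then q (h - j) else 0)"
  have qh: "fls_deriv (q h) = 0" using coeffs[of "Suc h"] by simp
  have "lenard_seq U b"
    unfolding lenard_seq_def
  proof (intro conjI allI)
    show "fls_deriv (b 0) = 0" using qh by (simp add: b_def)
    fix j
    show "4 * fls_deriv (b (Suc j)) = lenard U (b j)"
      using coeffs[of "h - j"] by (cases j h rule: linorder_cases) (auto simp: b_def Suc_diff_Suc)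
  qed
  \<comment> \<open>\<open>b 0\<close> is constant and equals twice the leading coefficient of M,
    since the coefficient at 4 h + 3 is zero. Were it zero, that meromorphic function would vanish
    identically.\<close>
  moreover have "b 0 $$ 0 \<noteq> 0"
  proof
    assume b0: "b 0 $$ 0 = 0"
    have "b 0 = 0"
      using b0 lenard_seq_0_nth[OF \<open>lenard_seq U b\<close>] by (intro fls_eqI) (metis fls_zero_nth)
    moreover have "L (4 * h + 3) = 0"
    proof (rule zero_has_laurent_expansion_imp_eq_0)
      show "(\<lambda>_. 0) has_laurent_expansion L (4 * h + 3)"
        using L[of "4 * h + 3"] \<mu>0[of "4 * h + 3"] by simp
    qed
    ultimately have "L (4 * h + 2) = 0" by (simp add: b_def q_def)
    then have "(\<lambda>w. m (4 * h + 2) (a + w)) has_laurent_expansion 0" using L[of "4 * h + 2"] \<mu>(2) by simp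
    moreover have "m (4 * h + 2) = last M" using len last_conv_nth[of M] by (cases "M = []") (auto simp: m_def)
    ultimately have "(\<lambda>w. last M (a + w)) has_laurent_expansion 0" by simp
    then have "\<forall>\<^sub>F w in at 0. eval_fls 0 w = last M (a + w)" unfolding has_laurent_expansion_def by blast
    then have "\<forall>\<^sub>F w in at 0. last M (w + a) = 0" by eventually_elim (simp add: add.commute)
    then have "\<forall>\<^sub>F z in at a. last M z = 0" unfolding at_to_0[of a] eventually_filtermap .
    then have "\<exists>\<^sub>F z in at a. last M z = 0" by (rule eventually_frequently[rotated]) simp
    moreover have "last M nicely_meromorphic_on UNIV" "last M \<noteq> (\<lambda>_. 0)"
      using M by (auto simp: diff_operator_def)
    ultimately show False
      using frequently_eq_meromorphic_imp_constant[of "last M" 0 a UNIV] by auto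
  qed
  moreover have "b (Suc h) = 0" by (simp add: b_def)
  ultimately show ?thesis using that unfolding U_def by blast
qed

section \<open>Construction of the partner\<close>

text \<open>In the commutator with L of b d^2 + c d + e the terms of orders 3 and 2 on
  eigenfunctions are 4 b''' + 6 c'' + 4 e' and b'''' + 4 c''' + 6 e''. The choice c = -b', e = b''/2
  annihilates both.\<close>

definition lenard_op :: "(complex \<Rightarrow> complex) \<Rightarrow> (complex \<Rightarrow> complex) \<Rightarrow> complex \<Rightarrow> complex" where
  "lenard_op b f = (\<lambda>x. b x * (deriv ^^ 2) f x - (deriv ^^ 1) b x * (deriv ^^ 1) f x + (deriv ^^ 2) b x / 2 * f x)"

lemma higher_deriv_cong_on:
  assumes "open S" "x \<in> S" "\<And>y. y \<in> S \<Longrightarrow> f y = g y"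
  shows "(deriv ^^ n) f x = (deriv ^^ n) g x"
proof (rule higher_deriv_cong_ev)
  show "\<forall>\<^sub>F y in nhds x. f y = g y"
    using eventually_nhds_in_open[OF assms(1,2)] by eventually_elim (rule assms(3))
qed simp

lemma higher_deriv_sum:
  assumes "open S" "x \<in> S" "\<And>i. i \<in> A \<Longrightarrow> f i holomorphic_on S"
  shows "(deriv ^^ n) (\<lambda>x. \<Sum>i\<in>A. f i x) x = (\<Sum>i\<in>A. (deriv ^^ n) (f i) x)"
  using assms(3)
proof (induction A rule: infinite_finite_induct)
  case (insert i A)
  have "(deriv ^^ n) (\<lambda>x. f i x + (\<Sum>i\<in>A. f i x)) x = (deriv ^^ n) (f i) x + (deriv ^^ n) (\<lambda>x. \<Sum>i\<in>A. f i x) x"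
    by (rule higher_deriv_add[OF _ _ assms(1,2)]) (use insert in \<open>auto intro!: holomorphic_intros\<close>)
  then show ?case using insert by simp
qed (simp_all add: higher_deriv_const)

lemma higher_deriv_sum_cmult:
  assumes "open S" "x \<in> S" "\<And>j. j \<in> A \<Longrightarrow> q j holomorphic_on S"
  shows "(deriv ^^ n) (\<lambda>y. \<Sum>j\<in>A. q j y * \<kappa> j) x = (\<Sum>j\<in>A. (deriv ^^ n) (q j) x * \<kappa> j)"
proof -
  have "(deriv ^^ n) (\<lambda>y. \<Sum>j\<in>A. q j y * \<kappa> j) x = (\<Sum>j\<in>A. (deriv ^^ n) (\<lambda>y. \<kappa> j * q j y) x)"
    unfolding mult.commute[of _ "\<kappa> _"]
    by (rule higher_deriv_sum[OF assms(1,2)]) (auto intro!: holomorphic_intros assms)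
  also have "\<dots> = (\<Sum>j\<in>A. (deriv ^^ n) (q j) x * \<kappa> j)"
  proof (rule sum.cong)
    fix j assume "j \<in> A"
    then show "(deriv ^^ n) (\<lambda>y. \<kappa> j * q j y) x = (deriv ^^ n) (q j) x * \<kappa> j"
      using higher_deriv_cmult[OF assms(3) assms(2,1), of j n "\<kappa> j"] by simp
  qed simp
  finally show ?thesis .
qed

lemma lenard_op_cong_on:
  assumes "open S" "x \<in> S" "\<And>y. y \<in> S \<Longrightarrow> f y = g y"
  shows "lenard_op b f x = lenard_op b g x"
proof -
  have "(deriv ^^ n) f x = (deriv ^^ n) g x" for n by (rule higher_deriv_cong_on) (use assms in auto)
  then show ?thesis unfolding lenard_op_def by (simp only: assms(3)[OF assms(2)])
qed

lemma app_cong_on: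
  assumes "open S" "x \<in> S" "\<And>y. y \<in> S \<Longrightarrow> f y = g y"
  shows "app A f x = app A g x"
proof -
  have "(deriv ^^ n) f x = (deriv ^^ n) g x" for n by (rule higher_deriv_cong_on) (use assms in auto)
  then show ?thesis unfolding app_def by simp
qed

lemma app_power_cong_on:
  assumes "open S" "\<And>y. y \<in> S \<Longrightarrow> f y = g y" "x \<in> S"
  shows "(app A ^^ i) f x = (app A ^^ i) g x"
  using assms(3)
proof (induction i arbitrary: x)
  case (Suc i)
  then show ?case using app_cong_on[OF assms(1) Suc.prems, of "(app A ^^ i) f" "(app A ^^ i) g"] by simp
qed (use assms in auto)

lemma holomorphic_lenard_op:
  assumes "open S" "b holomorphic_on S" "f holomorphic_on S"
  shows "lenard_op b f holomorphic_on S"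
  unfolding lenard_op_def by (intro holomorphic_intros holomorphic_higher_deriv assms) auto

lemma lenard_op_cmult:
  assumes "open S" "x \<in> S" "f holomorphic_on S"
  shows "lenard_op b (\<lambda>y. \<kappa> * f y) x = \<kappa> * lenard_op b f x"
  unfolding lenard_op_def higher_deriv_cmult[OF assms(3,2,1)] by (simp add: algebra_simps)

lemma higher_deriv_lenard_op:
  assumes S: "open S" "x \<in> S" and b: "b holomorphic_on S" and f: "f holomorphic_on S"
  shows "(deriv ^^ n) (lenard_op b f) x =
    (deriv ^^ n) (\<lambda>x. b x * (deriv ^^ 2) f x) x - (deriv ^^ n) (\<lambda>x. (deriv ^^ 1) b x * (deriv ^^ 1) f x) x
    + 1 / 2 * (deriv ^^ n) (\<lambda>x. (deriv ^^ 2) b x * f x) x"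
proof -
  have hol: "(deriv ^^ n) b holomorphic_on S" "(deriv ^^ n) f holomorphic_on S" for n
    using S b f by (auto intro: holomorphic_higher_deriv)
  have h: "(\<lambda>x. b x * (deriv ^^ 2) f x) holomorphic_on S" "(\<lambda>x. (deriv ^^ 1) b x * (deriv ^^ 1) f x) holomorphic_on S"
    "(\<lambda>x. (deriv ^^ 2) b x * f x) holomorphic_on S"
    by (intro holomorphic_intros hol b f)+
  have "lenard_op b f = (\<lambda>x. (b x * (deriv ^^ 2) f x - (deriv ^^ 1) b x * (deriv ^^ 1) f x) + 1 / 2 * ((deriv ^^ 2) b x * f x))"
    by (simp add: lenard_op_def)
  then have "(deriv ^^ n) (lenard_op b f) x = (deriv ^^ n) (\<lambda>x. b x * (deriv ^^ 2) f x - (deriv ^^ 1) b x * (deriv ^^ 1) f x) x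
      + (deriv ^^ n) (\<lambda>x. 1 / 2 * ((deriv ^^ 2) b x * f x)) x"
    by (simp only: higher_deriv_add[OF holomorphic_on_diff[OF h(1,2)] holomorphic_on_mult[OF holomorphic_on_const h(3)] S])
  also have "(deriv ^^ n) (\<lambda>x. 1 / 2 * ((deriv ^^ 2) b x * f x)) x = 1 / 2 * (deriv ^^ n) (\<lambda>x. (deriv ^^ 2) b x * f x) x"
    by (rule higher_deriv_cmult[OF h(3) S(2,1)])
  also have "(deriv ^^ n) (\<lambda>x. b x * (deriv ^^ 2) f x - (deriv ^^ 1) b x * (deriv ^^ 1) f x) x
      = (deriv ^^ n) (\<lambda>x. b x * (deriv ^^ 2) f x) x - (deriv ^^ n) (\<lambda>x. (deriv ^^ 1) b x * (deriv ^^ 1) f x) x"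
    by (rule higher_deriv_diff[OF h(1,2) S])
  finally show ?thesis .
qed

lemma lenard_op_jets:
  assumes S: "open S" "x \<in> S" and b: "b holomorphic_on S" and f: "f holomorphic_on S"
  defines "B \<equiv> (\<lambda>n. (deriv ^^ n) b x)" and "F \<equiv> (\<lambda>n. (deriv ^^ n) f x)"
  shows "(deriv ^^ 0) (lenard_op b f) x = B 0 * F 2 - B 1 * F 1 + B 2 / 2 * F 0"
    and "(deriv ^^ 1) (lenard_op b f) x = B 0 * F 3 - B 2 / 2 * F 1 + B 3 / 2 * F 0"
    and "(deriv ^^ 2) (lenard_op b f) x = B 0 * F 4 + B 1 * F 3 - B 2 / 2 * F 2 + B 4 / 2 * F 0"
    and "(deriv ^^ 4) (lenard_op b f) x = B 0 * F 6 + 3 * B 1 * F 5 + 5 / 2 * B 2 * F 4 + B 5 * F 1 + B 6 / 2 * F 0"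
proof -
  have hol: "(deriv ^^ n) b holomorphic_on S" "(deriv ^^ n) f holomorphic_on S" for n
    using S b f by (auto intro: holomorphic_higher_deriv)
  have fn: "(deriv ^^ m) ((deriv ^^ n) f) x = F (m + n)" "(deriv ^^ m) ((deriv ^^ n) b) x = B (m + n)"
    "(deriv ^^ n) f x = F n" "(deriv ^^ n) b x = B n" "f x = F 0" "b x = B 0" for m n
    by (simp_all add: F_def B_def funpow_add)
  have s: "{0..1::nat} = {0, 1}" "{0..2::nat} = {0, 1, 2}" by auto
  show "(deriv ^^ 0) (lenard_op b f) x = B 0 * F 2 - B 1 * F 1 + B 2 / 2 * F 0"
    by (simp add: lenard_op_def B_def F_def)
  show "(deriv ^^ 1) (lenard_op b f) x = B 0 * F 3 - B 2 / 2 * F 1 + B 3 / 2 * F 0"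
    unfolding higher_deriv_lenard_op[OF S b f] higher_deriv_mult[OF b hol(2) S] higher_deriv_mult[OF hol S]
      higher_deriv_mult[OF hol(1) f S] s fn
    by (simp add: eval_nat_numeral field_simps)
  show "(deriv ^^ 2) (lenard_op b f) x = B 0 * F 4 + B 1 * F 3 - B 2 / 2 * F 2 + B 4 / 2 * F 0"
    unfolding higher_deriv_lenard_op[OF S b f] higher_deriv_mult[OF b hol(2) S] higher_deriv_mult[OF hol S]
      higher_deriv_mult[OF hol(1) f S] s fn
    by (simp add: eval_nat_numeral field_simps)
  show "(deriv ^^ 4) (lenard_op b f) x = B 0 * F 6 + 3 * B 1 * F 5 + 5 / 2 * B 2 * F 4 + B 5 * F 1 + B 6 / 2 * F 0"
    unfolding higher_deriv_lenard_op[OF S b f] higher_deriv_4_mult[OF b hol(2) S] higher_deriv_4_mult[OF hol S]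
      higher_deriv_4_mult[OF hol(1) f S] fn
    by (simp add: eval_nat_numeral field_simps)
qed

text \<open>On Laurent series, \<open>lenard_fun u\<close> is \<open>- lenard u\<close>.\<close>

definition lenard_fun :: "(complex \<Rightarrow> complex) \<Rightarrow> (complex \<Rightarrow> complex) \<Rightarrow> complex \<Rightarrow> complex" where
  "lenard_fun u b = (\<lambda>x. (deriv ^^ 5) b x - 4 * (u x * (deriv ^^ 1) b x) - 2 * ((deriv ^^ 1) u x * b x))"

text \<open>The formally skew-adjoint first-order operator (c d + d c) / 2.\<close>

definition skew_op :: "(complex \<Rightarrow> complex) \<Rightarrow> (complex \<Rightarrow> complex) \<Rightarrow> complex \<Rightarrow> complex" where
  "skew_op c f = (\<lambda>x. c x * deriv f x + deriv c x / 2 * f x)"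

text \<open>The two top orders of this fifth-order commutator form the skew operator of 4 b'
  composed with L, and what is left is first-order and again skew. Having L on the right is what
  lets the sum over its powers telescope.\<close>

lemma lenard_op_commutator:
  assumes S: "open S" "x \<in> S" and u: "u holomorphic_on S" and b: "b holomorphic_on S" and f: "f holomorphic_on S"
  shows "app (L4 u) (lenard_op b f) x - lenard_op b (app (L4 u) f) x
     = skew_op (\<lambda>x. 4 * deriv b x) (app (L4 u) f) x + skew_op (lenard_fun u b) f x"
proof -
  define B where "B = (\<lambda>n. (deriv ^^ n) b x)"
  define F where "F = (\<lambda>n. (deriv ^^ n) f x)"
  define W where "W = (\<lambda>n. (deriv ^^ n) u x)"
  have hol: "(deriv ^^ n) b holomorphic_on S" "(deriv ^^ n) f holomorphic_on S" "(deriv ^^ n) u holomorphic_on S" for n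
    using S b f u by (auto intro: holomorphic_higher_deriv)
  have fn: "(deriv ^^ m) ((deriv ^^ n) f) x = F (m + n)" "(deriv ^^ m) ((deriv ^^ n) b) x = B (m + n)"
    "(deriv ^^ m) ((deriv ^^ n) u) x = W (m + n)"
    "(deriv ^^ n) f x = F n" "(deriv ^^ n) b x = B n" "(deriv ^^ n) u x = W n" "f x = F 0" "b x = B 0" "u x = W 0" for m n
    by (simp_all add: F_def B_def W_def funpow_add)
  have s: "{0..0::nat} = {0}" "{0..1::nat} = {0, 1}" "{0..2::nat} = {0, 1, 2}" by auto
  have Lf: "(deriv ^^ n) (app (L4 u) f) x = (\<Sum>i = 0..n. of_nat (n choose i) * W i * F (n - i)) + F (n + 4)" for n
  proof -
    have "(deriv ^^ n) (app (L4 u) f) x = (deriv ^^ n) (\<lambda>x. u x * f x) x + (deriv ^^ n) ((deriv ^^ 4) f) x"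
      unfolding app_L4 by (rule higher_deriv_add[OF _ hol(2) S]) (intro holomorphic_intros u f)
    then show ?thesis unfolding higher_deriv_mult[OF u f S] fn .
  qed
  have Lf0: "app (L4 u) f x = W 0 * F 0 + F 4" by (simp add: app_L4 fn)
  have Lf1: "(deriv ^^ 1) (app (L4 u) f) x = W 0 * F 1 + W 1 * F 0 + F 5" using Lf[of 1] unfolding s by simp
  have Lf2: "(deriv ^^ 2) (app (L4 u) f) x = W 0 * F 2 + 2 * W 1 * F 1 + W 2 * F 0 + F 6" using Lf[of 2] unfolding s by simp
  have P0: "lenard_op b f x = B 0 * F 2 - B 1 * F 1 + B 2 / 2 * F 0"
    and P4: "(deriv ^^ 4) (lenard_op b f) x = B 0 * F 6 + 3 * B 1 * F 5 + 5 / 2 * B 2 * F 4 + B 5 * F 1 + B 6 / 2 * F 0"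
    using lenard_op_jets(1,4)[OF S b f] by (simp_all add: B_def F_def)
  have k0: "lenard_fun u b x = B 5 - 4 * (W 0 * B 1) - 2 * (W 1 * B 0)" unfolding lenard_fun_def fn ..
  have "deriv (lenard_fun u b) x = B 6 - 4 * (W 0 * B 2 + W 1 * B 1) - 2 * (W 1 * B 1 + W 2 * B 0)"
  proof (rule DERIV_imp_deriv)
    have D: "((deriv ^^ n) b has_field_derivative B (Suc n)) (at x)" "((deriv ^^ n) u has_field_derivative W (Suc n)) (at x)" for n
      using has_field_derivative_higher_deriv[OF b S(1,2)] has_field_derivative_higher_deriv[OF u S(1,2)]
      by (auto simp: B_def W_def)
    have D0: "(b has_field_derivative B 1) (at x)" "(u has_field_derivative W 1) (at x)"
      using D(1)[of 0] D(2)[of 0] by simp_all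
    have dd: "deriv b x = B (Suc 0)" "deriv u x = W (Suc 0)" by (simp_all add: B_def W_def)
    have "(lenard_fun u b has_field_derivative
      B (Suc 5) - 4 * (W 0 * B (Suc 1) + W 1 * B 1) - 2 * (W 1 * B 1 + W (Suc 1) * B 0)) (at x)"
      unfolding lenard_fun_def by (rule derivative_eq_intros D D0 refl)+ (simp add: fn dd)
    then show "(lenard_fun u b has_field_derivative
      B 6 - 4 * (W 0 * B 2 + W 1 * B 1) - 2 * (W 1 * B 1 + W 2 * B 0)) (at x)" by (simp add: eval_nat_numeral)
  qed
  note k1 = this
  have c1: "deriv (\<lambda>x. 4 * deriv b x) x = 4 * B 2"
  proof -
    have "(deriv ^^ 1) (\<lambda>x. 4 * (deriv ^^ 1) b x) x = 4 * (deriv ^^ 1) ((deriv ^^ 1) b) x"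
      by (rule higher_deriv_cmult[OF hol(1) S(2,1)])
    then show ?thesis by (simp add: B_def numeral_2_eq_2)
  qed
  have d1: "deriv b x = B 1" "deriv f x = F 1" "deriv (app (L4 u) f) x = W 0 * F 1 + W 1 * F 0 + F 5"
    using Lf1 by (simp_all add: B_def F_def)
  show ?thesis
    unfolding skew_op_def k0 k1 c1 d1 Lf0
    by (simp add: lenard_op_def[of b "app (L4 u) f"] app_L4[of u "lenard_op b f"] P0 P4 Lf0 Lf1[simplified] Lf2 fn d1)
       (simp add: field_simps)
qed

section \<open>Compositions of represented operators\<close>

context coefficient_ring
begin

abbreviation dbase :: "nat \<Rightarrow> (complex \<Rightarrow> complex) \<Rightarrow> complex \<Rightarrow> complex" where
  "dbase \<equiv> (\<lambda>k. deriv ^^ k)"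

lemma rep_holomorphic:
  assumes rep: "rep dbase \<Phi> n \<mu>" and S: "open S" "S \<subseteq> \<Omega>" "f holomorphic_on S"
  shows "\<Phi> f holomorphic_on S"
proof -
  have "(\<lambda>x. \<Sum>k\<le>n. \<mu> k x * (deriv ^^ k) f x) holomorphic_on S"
    by (intro holomorphic_intros holomorphic_higher_deriv S C_holomorphic_subset[OF _ S(2)])
       (use rep in \<open>auto simp: rep_def\<close>)
  moreover have "\<Phi> f holomorphic_on S \<longleftrightarrow> (\<lambda>x. \<Sum>k\<le>n. \<mu> k x * (deriv ^^ k) f x) holomorphic_on S"
    by (rule holomorphic_cong) (use rep S in \<open>auto simp: rep_def\<close>)
  ultimately show ?thesis by blast
qed

lemma rep_higher_deriv_dbase:
  assumes "rep dbase \<Phi> n \<mu>"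
  shows "\<exists>\<nu>. rep dbase (\<lambda>f. (deriv ^^ k) (\<Phi> f)) (n + k) \<nu> \<and> \<nu> (n + k) = \<mu> n"
proof (induction k)
  case 0
  then show ?case using assms by auto
next
  case (Suc k)
  then obtain \<nu> where "rep dbase (\<lambda>f. (deriv ^^ k) (\<Phi> f)) (n + k) \<nu>" "\<nu> (n + k) = \<mu> n" by blast
  then show ?case using rep_deriv_dbase[of "\<lambda>f. (deriv ^^ k) (\<Phi> f)" "n + k" \<nu>] by simp
qed

lemma rep_lenard_op:
  assumes rep: "rep dbase \<Phi> n \<mu>" and b: "b \<in> C"
  shows "\<exists>\<nu>. rep dbase (\<lambda>f. lenard_op b (\<Phi> f)) (n + 2) \<nu> \<and> \<nu> (n + 2) = (\<lambda>x. b x * \<mu> n x)"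
proof -
  obtain \<nu>1 \<nu>2 where \<nu>: "rep dbase (\<lambda>f. (deriv ^^ 1) (\<Phi> f)) (n + 1) \<nu>1"
    "rep dbase (\<lambda>f. (deriv ^^ 2) (\<Phi> f)) (n + 2) \<nu>2" "\<nu>2 (n + 2) = \<mu> n"
    using rep_higher_deriv_dbase[OF rep] by metis
  define \<kappa> where "\<kappa> = (\<lambda>k x. (b x * \<nu>2 k x + (- 1 * (deriv ^^ 1) b x) * \<nu>1 k x) + (1 / 2 * (deriv ^^ 2) b x) * \<mu> k x)"
  have "rep dbase (\<lambda>f x. (b x * (deriv ^^ 2) (\<Phi> f) x + (- 1 * (deriv ^^ 1) b x) * (deriv ^^ 1) (\<Phi> f) x)
      + (1 / 2 * (deriv ^^ 2) b x) * \<Phi> f x) (n + 2) \<kappa>"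
    unfolding \<kappa>_def
    by (intro rep_add rep_mult \<nu>(2) rep_mono[OF \<nu>(1)] rep_mono[OF rep] b C_cmult C_higher_deriv) auto
  then have "rep dbase (\<lambda>f. lenard_op b (\<Phi> f)) (n + 2) \<kappa>"
    by (rule rep_cong) (simp add: lenard_op_def)
  moreover have "\<kappa> (n + 2) = (\<lambda>x. b x * \<mu> n x)"
    using \<nu> rep by (simp add: \<kappa>_def rep_def)
  ultimately show ?thesis by blast
qed

lemma rep_L4:
  assumes rep: "rep dbase \<Phi> n \<mu>"
  shows "\<exists>\<nu>. rep dbase (\<lambda>f. app (L4 u) (\<Phi> f)) (n + 4) \<nu> \<and> \<nu> (n + 4) = \<mu> n"
proof -
  obtain \<nu> where \<nu>: "rep dbase (\<lambda>f. (deriv ^^ 4) (\<Phi> f)) (n + 4) \<nu>" "\<nu> (n + 4) = \<mu> n"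
    using rep_higher_deriv_dbase[OF rep] by blast
  have "rep dbase (\<lambda>f x. u x * \<Phi> f x + (deriv ^^ 4) (\<Phi> f) x) (n + 4) (\<lambda>k x. u x * \<mu> k x + \<nu> k x)"
    by (intro rep_add rep_mult rep_mono[OF rep] \<nu>(1) C_u) auto
  moreover have "(\<lambda>x. u x * \<mu> (n + 4) x + \<nu> (n + 4) x) = \<mu> n"
    using \<nu>(2) rep by (simp add: rep_def)
  ultimately show ?thesis unfolding app_L4 by blast
qed

lemma rep_L4_power: "\<exists>\<nu>. rep dbase (app (L4 u) ^^ j) (4 * j) \<nu> \<and> \<nu> (4 * j) = (\<lambda>_. 1)"
proof (induction j)
  case 0
  have "rep dbase (app (L4 u) ^^ 0) 0 (\<lambda>k x. if k = 0 then 1 else 0)"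
    unfolding rep_def by (auto intro: C_const)
  then show ?case unfolding mult_0_right by (rule exI[of _ "\<lambda>k x. if k = 0 then 1 else 0", OF conjI]) simp
next
  case (Suc j)
  then obtain \<nu> where "rep dbase (app (L4 u) ^^ j) (4 * j) \<nu>" "\<nu> (4 * j) = (\<lambda>_. 1)" by blast
  then obtain \<nu>' where \<nu>': "rep dbase (\<lambda>f. app (L4 u) ((app (L4 u) ^^ j) f)) (4 * j + 4) \<nu>'" "\<nu>' (4 * j + 4) = (\<lambda>_. 1)"
    using rep_L4 by metis
  have "4 * Suc j = 4 * j + 4" "(app (L4 u) ^^ Suc j) = (\<lambda>f. app (L4 u) ((app (L4 u) ^^ j) f))"
    by (simp_all add: fun_eq_iff)
  then show ?case using \<nu>' by metis
qed

lemma rep_compose: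
  assumes \<Phi>: "rep dbase \<Phi> n \<mu>" and \<Psi>: "rep dbase \<Psi> n' \<nu>"
  shows "\<exists>\<kappa>. rep dbase (\<lambda>f. \<Phi> (\<Psi> f)) (n' + n) \<kappa>"
proof -
  obtain \<kappa> where \<kappa>: "\<And>k. rep dbase (\<lambda>f. (deriv ^^ k) (\<Psi> f)) (n' + k) (\<kappa> k)"
    using rep_higher_deriv_dbase[OF \<Psi>] by metis
  have \<mu>: "\<mu> k \<in> C" for k using \<Phi> by (simp add: rep_def)
  have "rep dbase (\<lambda>f x. \<Sum>k\<in>{..n}. \<mu> k x * (deriv ^^ k) (\<Psi> f) x) (n' + n) (\<lambda>j x. \<Sum>k\<in>{..n}. \<mu> k x * \<kappa> k j x)"
    by (intro rep_sum rep_mult \<mu> rep_mono[OF \<kappa>]) auto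
  then have "rep dbase (\<lambda>f. \<Phi> (\<Psi> f)) (n' + n) (\<lambda>j x. \<Sum>k\<in>{..n}. \<mu> k x * \<kappa> k j x)"
  proof (rule rep_cong)
    fix S f x assume S: "open S" "S \<subseteq> \<Omega>" "f holomorphic_on S" "x \<in> S"
    have "\<Psi> f holomorphic_on S" using rep_holomorphic[OF \<Psi> S(1-3)] .
    then show "\<Phi> (\<Psi> f) x = (\<Sum>k\<in>{..n}. \<mu> k x * (deriv ^^ k) (\<Psi> f) x)"
      using \<Phi> S unfolding rep_def by blast
  qed
  then show ?thesis by blast
qed

text \<open>Transfers an identity from eigenfunctions to arbitrary functions: in the basis
  \<open>ebase\<close> all coefficients at x vanish.\<close>

lemma rep_eq_0:
  assumes rep: "rep dbase \<Phi> n \<mu>" and ball: "ball x \<epsilon> \<subseteq> \<Omega>" "\<epsilon> > 0"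
    and 0: "\<And>z \<psi>. \<psi> holomorphic_on ball x \<epsilon> \<Longrightarrow>
      (\<And>y. y \<in> ball x \<epsilon> \<Longrightarrow> (deriv ^^ 4) \<psi> y = (z - u y) * \<psi> y) \<Longrightarrow> \<Phi> \<psi> x = 0"
    and S: "open S" "S \<subseteq> \<Omega>" "f holomorphic_on S" "x \<in> S"
  shows "\<Phi> f x = 0"
proof -
  obtain \<mu>' where \<mu>': "rep (ebase u) \<Phi> n \<mu>'" using rep_dbase_imp_ebase[OF rep] by blast
  then have "\<Phi> f x = (\<Sum>k\<le>n. \<mu>' k x * ebase u k f x)" using S unfolding rep_def by blast
  moreover have "\<mu>' k x = 0" for k
    by (rule rep_eq_0_on_eigenfunctions[OF \<mu>' ball]) (rule 0)
  ultimately show ?thesis by simp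
qed

end

text \<open>For Q = \<Sum> q_j z^j the assumptions \<open>q_bot\<close> and \<open>q_step\<close>
  are the powers of z in \<open>lenard_fun u Q = - 4 z Q'\<close>, with \<open>q_top\<close> making
  Q monic in z. The x-derivative of the expression in \<open>F\<close> is Q times this linear
  equation, so its value depends on z only.\<close>

locale lenard_chain = coefficient_ring +
  fixes g :: nat and q :: "nat \<Rightarrow> complex \<Rightarrow> complex" and F :: "complex poly"
  assumes q_C: "j \<le> g \<Longrightarrow> q j \<in> C"
    and q_top: "q g = (\<lambda>_. 1)"
    and q_bot: "x \<in> \<Omega> \<Longrightarrow> lenard_fun u (q 0) x = 0"
    and q_step: "j < g \<Longrightarrow> x \<in> \<Omega> \<Longrightarrow> lenard_fun u (q (Suc j)) x = - 4 * deriv (q j) x"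
    and F: "x \<in> \<Omega> \<Longrightarrow> (let Q = (\<lambda>n. (deriv ^^ n) (\<lambda>y. \<Sum>j\<le>g. q j y * z ^ j) x) in
        Q 0 * Q 4 - Q 1 * Q 3 + Q 2 * Q 2 / 2 + 2 * (z - u x) * (Q 0 * Q 0)) = 2 * poly F z"
begin

definition partner :: "(complex \<Rightarrow> complex) \<Rightarrow> complex \<Rightarrow> complex" where
  "partner f = (\<lambda>x. \<Sum>j\<le>g. lenard_op (q j) ((app (L4 u) ^^ j) f) x)"

definition Q :: "complex \<Rightarrow> complex \<Rightarrow> complex" where
  "Q z = (\<lambda>y. \<Sum>j\<le>g. q j y * z ^ j)"

lemma Q_C: "Q z \<in> C"
  unfolding Q_def by (intro C_sum C_mult q_C C_const) auto

lemma u_hol: "S \<subseteq> \<Omega> \<Longrightarrow> u holomorphic_on S"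
  using u_holomorphic holomorphic_on_subset by blast

lemma partner_rep: "\<exists>\<mu>. rep dbase partner (4 * g + 2) \<mu> \<and> \<mu> (4 * g + 2) = (\<lambda>_. 1)"
proof -
  have "\<exists>\<nu>. rep dbase (\<lambda>f. lenard_op (q j) ((app (L4 u) ^^ j) f)) (4 * j + 2) \<nu> \<and> \<nu> (4 * j + 2) = q j"
    if "j \<le> g" for j
  proof -
    obtain \<nu> where "rep dbase (app (L4 u) ^^ j) (4 * j) \<nu>" "\<nu> (4 * j) = (\<lambda>_. 1)" using rep_L4_power by blast
    then show ?thesis using rep_lenard_op[of "app (L4 u) ^^ j" "4 * j" \<nu> "q j"] q_C[OF that] by simp
  qed
  then obtain \<nu> where \<nu>: "\<And>j. j \<le> g \<Longrightarrow> rep dbase (\<lambda>f. lenard_op (q j) ((app (L4 u) ^^ j) f)) (4 * j + 2) (\<nu> j)"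
    "\<And>j. j \<le> g \<Longrightarrow> \<nu> j (4 * j + 2) = q j" by metis
  have "rep dbase partner (4 * g + 2) (\<lambda>k x. \<Sum>j\<in>{..g}. \<nu> j k x)"
    unfolding partner_def by (intro rep_sum rep_mono[OF \<nu>(1)]) auto
  moreover have "(\<lambda>x. \<Sum>j\<in>{..g}. \<nu> j (4 * g + 2) x) = (\<lambda>_. 1)"
  proof
    fix x
    have "\<nu> j (4 * g + 2) = (\<lambda>_. 0)" if "j < g" for j using \<nu>(1)[of j] that by (simp add: rep_def)
    then have "(\<Sum>j\<in>{..g}. \<nu> j (4 * g + 2) x) = (\<Sum>j\<in>{g}. \<nu> j (4 * g + 2) x)"
      by (intro sum.mono_neutral_right) auto
    then show "(\<Sum>j\<in>{..g}. \<nu> j (4 * g + 2) x) = 1" using \<nu>(2)[of g] q_top by simp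
  qed
  ultimately show ?thesis by blast
qed

lemma partner_holomorphic: "open S \<Longrightarrow> S \<subseteq> \<Omega> \<Longrightarrow> f holomorphic_on S \<Longrightarrow> partner f holomorphic_on S"
  using partner_rep rep_holomorphic by blast

lemma partner_cong_on:
  assumes "open S" "x \<in> S" "\<And>y. y \<in> S \<Longrightarrow> f y = h y"
  shows "partner f x = partner h x"
  unfolding partner_def
proof (rule sum.cong)
  fix j
  show "lenard_op (q j) ((app (L4 u) ^^ j) f) x = lenard_op (q j) ((app (L4 u) ^^ j) h) x"
    by (rule lenard_op_cong_on[OF assms(1,2)]) (rule app_power_cong_on[OF assms(1,3)])
qed simp

lemma skew_op_cong:
  assumes "open S" "x \<in> S" "\<And>y. y \<in> S \<Longrightarrow> c y = d y"
  shows "skew_op c f x = skew_op d f x"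
  unfolding skew_op_def using higher_deriv_cong_on[of S x c d 1] assms by simp

text \<open>By \<open>lenard_op_commutator\<close> the j-th summand leaves one term with L^(j+1) and
  one with L^j. Neighbouring summands cancel by \<open>q_step\<close>; the ends vanish by
  \<open>q_bot\<close> and because \<open>q g\<close> is constant.\<close>

lemma partner_commutes:
  assumes S: "open S" "S \<subseteq> \<Omega>" "f holomorphic_on S" and x: "x \<in> S"
  shows "app (L4 u) (partner f) x = partner (app (L4 u) f) x"
proof -
  define h where "h = (\<lambda>j. (app (L4 u) ^^ j) f)"
  have h: "h j holomorphic_on S" for j unfolding h_def using holomorphic_app_L4[OF S(1) u_hol[OF S(2)] S(3)] .
  have hS: "app (L4 u) (h j) = h (Suc j)" for j by (simp add: h_def)
  have qS: "q j holomorphic_on S" if "j \<le> g" for j using q_C[OF that] C_holomorphic_subset S by blast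
  define c where "c = (\<lambda>j x. 4 * deriv (q j) x)"
  have 1: "app (L4 u) (partner f) x = (\<Sum>j\<le>g. app (L4 u) (lenard_op (q j) (h j)) x)"
  proof -
    have "(deriv ^^ 4) (\<lambda>x. \<Sum>j\<le>g. lenard_op (q j) (h j) x) x = (\<Sum>j\<le>g. (deriv ^^ 4) (lenard_op (q j) (h j)) x)"
      by (rule higher_deriv_sum[OF S(1) x]) (use holomorphic_lenard_op[OF S(1) qS h] in auto)
    moreover have "partner f = (\<lambda>x. \<Sum>j\<le>g. lenard_op (q j) (h j) x)" by (simp add: partner_def h_def)
    ultimately show ?thesis by (simp add: app_L4 sum.distrib sum_distrib_left)
  qed
  have 2: "partner (app (L4 u) f) x = (\<Sum>j\<le>g. lenard_op (q j) (app (L4 u) (h j)) x)"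
    unfolding partner_def h_def by (simp add: funpow_swap1)
  have "app (L4 u) (partner f) x - partner (app (L4 u) f) x
      = (\<Sum>j\<le>g. skew_op (c j) (h (Suc j)) x + skew_op (lenard_fun u (q j)) (h j) x)"
    unfolding 1 2 sum_subtractf[symmetric]
  proof (rule sum.cong)
    fix j assume "j \<in> {..g}"
    then show "app (L4 u) (lenard_op (q j) (h j)) x - lenard_op (q j) (app (L4 u) (h j)) x
        = skew_op (c j) (h (Suc j)) x + skew_op (lenard_fun u (q j)) (h j) x"
      using lenard_op_commutator[OF S(1) x u_hol[OF S(2)] qS h] by (simp add: hS c_def)
  qed simp
  also have "\<dots> = 0"
  proof -
    have bot: "skew_op (lenard_fun u (q 0)) (h 0) x = 0"
    proof -
      have "skew_op (lenard_fun u (q 0)) (h 0) x = skew_op (\<lambda>_. 0) (h 0) x"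
        by (rule skew_op_cong[OF S(1) x]) (use q_bot S in auto)
      then show ?thesis by (simp add: skew_op_def)
    qed
    have step: "skew_op (lenard_fun u (q (Suc j))) (h (Suc j)) x = - skew_op (c j) (h (Suc j)) x" if "j < g" for j
    proof -
      have "skew_op (lenard_fun u (q (Suc j))) (h (Suc j)) x = skew_op (\<lambda>y. - 1 * c j y) (h (Suc j)) x"
        by (rule skew_op_cong[OF S(1) x]) (use q_step that S in \<open>auto simp: c_def\<close>)
      also have "\<dots> = - skew_op (c j) (h (Suc j)) x"
      proof -
        have "c j holomorphic_on S" unfolding c_def using qS[of j] that S by (intro holomorphic_intros) auto
        then have "deriv (\<lambda>y. - 1 * c j y) x = - 1 * deriv (c j) x"
          using higher_deriv_cmult[of "c j" S x 1 "- 1"] x S by simp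
        then show ?thesis by (simp add: skew_op_def)
      qed
      finally show ?thesis .
    qed
    have top: "skew_op (c g) (h (Suc g)) x = 0"
      by (simp add: c_def q_top skew_op_def)
    have "(\<Sum>j\<le>g. skew_op (lenard_fun u (q j)) (h j) x)
        = skew_op (lenard_fun u (q 0)) (h 0) x + (\<Sum>j<g. skew_op (lenard_fun u (q (Suc j))) (h (Suc j)) x)"
      by (simp add: sum.lessThan_Suc_shift flip: lessThan_Suc_atMost del: sum.lessThan_Suc)
    also have "\<dots> = - (\<Sum>j<g. skew_op (c j) (h (Suc j)) x)"
      using bot step by (simp add: sum_negf)
    also have "(\<Sum>j<g. skew_op (c j) (h (Suc j)) x) = (\<Sum>j\<le>g. skew_op (c j) (h (Suc j)) x)"
      using top by (simp flip: lessThan_Suc_atMost)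
    finally show ?thesis by (simp add: sum.distrib)
  qed
  finally show ?thesis by simp
qed

end

section \<open>The partner on eigenfunctions, and its square\<close>

context lenard_chain
begin

lemma Q_higher_deriv:
  assumes "x \<in> \<Omega>"
  shows "(deriv ^^ n) (Q z) x = (\<Sum>j\<le>g. (deriv ^^ n) (q j) x * z ^ j)"
  unfolding Q_def by (rule higher_deriv_sum_cmult[OF open_dom assms]) (use q_C C_holomorphic in auto)

lemma L4_power_eigenfunction:
  assumes "open S" "S \<subseteq> \<Omega>" "\<psi> holomorphic_on S"
    and "\<And>y. y \<in> S \<Longrightarrow> (deriv ^^ 4) \<psi> y = (z - u y) * \<psi> y" and "x \<in> S"
  shows "(app (L4 u) ^^ j) \<psi> x = z ^ j * \<psi> x"
  using ebase_eigenfunction[OF assms, of "4 * j"] by (simp add: ebase_def)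

lemma partner_eq_lenard_op:
  assumes S: "open S" "S \<subseteq> \<Omega>" "\<psi> holomorphic_on S"
    and ode: "\<And>y. y \<in> S \<Longrightarrow> (deriv ^^ 4) \<psi> y = (z - u y) * \<psi> y" and x: "x \<in> S"
  shows "partner \<psi> x = lenard_op (Q z) \<psi> x"
proof -
  have "lenard_op (q j) ((app (L4 u) ^^ j) \<psi>) x = z ^ j * lenard_op (q j) \<psi> x" for j
  proof -
    have "lenard_op (q j) ((app (L4 u) ^^ j) \<psi>) x = lenard_op (q j) (\<lambda>y. z ^ j * \<psi> y) x"
      by (rule lenard_op_cong_on[OF S(1) x]) (rule L4_power_eigenfunction[OF S ode])
    then show ?thesis using lenard_op_cmult[OF S(1) x S(3)] by simp
  qed
  then have "partner \<psi> x = (\<Sum>j\<le>g. z ^ j * lenard_op (q j) \<psi> x)" by (simp add: partner_def)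
  also have "\<dots> = lenard_op (Q z) \<psi> x"
  proof -
    have "x \<in> \<Omega>" using S x by blast
    then have h: "(deriv ^^ 2) (Q z) x = (\<Sum>j\<le>g. (deriv ^^ 2) (q j) x * z ^ j)"
      "(deriv ^^ 1) (Q z) x = (\<Sum>j\<le>g. (deriv ^^ 1) (q j) x * z ^ j)" "Q z x = (\<Sum>j\<le>g. q j x * z ^ j)"
      using Q_higher_deriv[of x 2 z] Q_higher_deriv[of x 1 z] by (simp_all only: Q_def)
    show ?thesis
      unfolding lenard_op_def h
      by (simp add: sum_distrib_left sum_distrib_right sum_divide_distrib algebra_simps
           flip: sum_subtractf sum.distrib)
  qed
  finally show ?thesis .
qed

lemma partner_eigenfunction:
  assumes S: "open S" "S \<subseteq> \<Omega>" "\<psi> holomorphic_on S"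
    and ode: "\<And>y. y \<in> S \<Longrightarrow> (deriv ^^ 4) \<psi> y = (z - u y) * \<psi> y" and x: "x \<in> S"
  shows "(deriv ^^ 4) (partner \<psi>) x = (z - u x) * partner \<psi> x"
proof -
  have "app (L4 u) (partner \<psi>) x = partner (app (L4 u) \<psi>) x"
    by (rule partner_commutes[OF S x])
  also have "\<dots> = partner (\<lambda>y. z * \<psi> y) x"
    by (rule partner_cong_on[OF S(1) x]) (simp add: app_L4 ode algebra_simps)
  also have "\<dots> = lenard_op (Q z) (\<lambda>y. z * \<psi> y) x"
  proof (rule partner_eq_lenard_op[OF S(1,2) _ _ x])
    show "(\<lambda>y. z * \<psi> y) holomorphic_on S" using S by (intro holomorphic_intros)
    show "(deriv ^^ 4) (\<lambda>y. z * \<psi> y) y = (z - u y) * (z * \<psi> y)" if "y \<in> S" for y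
      using higher_deriv_cmult[OF S(3) that S(1), of 4 z] ode[OF that] by simp
  qed
  also have "\<dots> = z * partner \<psi> x"
    using lenard_op_cmult[OF S(1) x S(3)] partner_eq_lenard_op[OF S ode x] by simp
  finally show ?thesis by (simp add: app_L4 algebra_simps)
qed

text \<open>The image of an eigenfunction is again one for the same z, so the partner acts both
  times as \<open>lenard_op (Q z)\<close>. In the square the first three derivatives of \<psi>
  cancel, and the factor of \<psi> is half of the first integral.\<close>

lemma partner_square:
  assumes S: "open S" "S \<subseteq> \<Omega>" "\<psi> holomorphic_on S"
    and ode: "\<And>y. y \<in> S \<Longrightarrow> (deriv ^^ 4) \<psi> y = (z - u y) * \<psi> y" and x: "x \<in> S"
  shows "partner (partner \<psi>) x = poly F z * \<psi> x"
proof -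
  have QS: "Q z holomorphic_on S" using Q_C S C_holomorphic_subset by blast
  have "partner (partner \<psi>) x = lenard_op (Q z) (partner \<psi>) x"
    by (rule partner_eq_lenard_op[OF S(1,2) partner_holomorphic[OF S] _ x]) (rule partner_eigenfunction[OF S ode])
  also have "\<dots> = lenard_op (Q z) (lenard_op (Q z) \<psi>) x"
    by (rule lenard_op_cong_on[OF S(1) x]) (rule partner_eq_lenard_op[OF S ode])
  also have "\<dots> = poly F z * \<psi> x"
  proof -
    define B where "B = (\<lambda>n. (deriv ^^ n) (Q z) x)"
    define G where "G = (\<lambda>n. (deriv ^^ n) \<psi> x)"
    define H where "H = (\<lambda>n. (deriv ^^ n) (lenard_op (Q z) \<psi>) x)"
    have H: "H 0 = B 0 * G 2 - B 1 * G 1 + B 2 / 2 * G 0" "H 1 = B 0 * G 3 - B 2 / 2 * G 1 + B 3 / 2 * G 0"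
      "H 2 = B 0 * G 4 + B 1 * G 3 - B 2 / 2 * G 2 + B 4 / 2 * G 0"
      using lenard_op_jets(1-3)[OF S(1) x QS S(3)] by (simp_all only: B_def G_def H_def)
    have G4: "G 4 = (z - u x) * G 0" using ode[OF x] by (simp add: G_def)
    have "x \<in> \<Omega>" using S x by blast
    from F[OF this, of z] have Fz: "B 0 * B 4 - B 1 * B 3 + B 2 * B 2 / 2 + 2 * (z - u x) * (B 0 * B 0) = 2 * poly F z"
      by (simp add: Let_def B_def Q_def)
    have "lenard_op (Q z) (lenard_op (Q z) \<psi>) x = B 0 * H 2 - B 1 * H 1 + B 2 / 2 * H 0"
      by (simp add: lenard_op_def[of "Q z" "lenard_op (Q z) \<psi>"] B_def H_def)
    also have "\<dots> = (B 0 * B 4 - B 1 * B 3 + B 2 * B 2 / 2 + 2 * (z - u x) * (B 0 * B 0)) / 2 * G 0"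
      unfolding H G4 by (simp add: field_simps)
    also have "\<dots> = poly F z * \<psi> x" unfolding Fz by (simp add: G_def)
    finally show ?thesis .
  qed
  finally show ?thesis .
qed

lemma partner_square_eq:
  assumes S: "open S" "S \<subseteq> \<Omega>" "f holomorphic_on S" and x: "x \<in> S"
  shows "partner (partner f) x = (\<Sum>i\<le>degree F. coeff F i * (app (L4 u) ^^ i) f x)"
proof -
  define \<Phi> where "\<Phi> = (\<lambda>f x. partner (partner f) x + (\<Sum>i\<in>{..degree F}. (- coeff F i) * (app (L4 u) ^^ i) f x))"
  obtain \<mu> where \<mu>: "rep dbase partner (4 * g + 2) \<mu>" using partner_rep by blast
  obtain \<kappa> where \<kappa>: "rep dbase (\<lambda>f. partner (partner f)) (4 * g + 2 + (4 * g + 2)) \<kappa>"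
    using rep_compose[OF \<mu> \<mu>] by blast
  obtain \<nu> where \<nu>: "\<And>i. rep dbase (app (L4 u) ^^ i) (4 * i) (\<nu> i)" using rep_L4_power by metis
  define N where "N = 4 * g + 2 + (4 * g + 2) + 4 * degree F"
  have rep: "rep dbase \<Phi> N (\<lambda>k x. \<kappa> k x + (\<Sum>i\<in>{..degree F}. (- coeff F i) * \<nu> i k x))"
    unfolding \<Phi>_def by (intro rep_add rep_sum rep_mult C_const rep_mono[OF \<kappa>] rep_mono[OF \<nu>]) (auto simp: N_def)
  obtain \<epsilon> where \<epsilon>: "\<epsilon> > 0" "ball x \<epsilon> \<subseteq> \<Omega>" using open_dom S x open_contains_ball by blast
  have "\<Phi> f x = 0"
  proof (rule rep_eq_0[OF rep \<epsilon>(2,1) _ S x])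
    fix z \<psi> assume \<psi>: "\<psi> holomorphic_on ball x \<epsilon>" "\<And>y. y \<in> ball x \<epsilon> \<Longrightarrow> (deriv ^^ 4) \<psi> y = (z - u y) * \<psi> y"
    have xb: "x \<in> ball x \<epsilon>" using \<epsilon> by simp
    have "partner (partner \<psi>) x = poly F z * \<psi> x"
      by (rule partner_square[OF open_ball \<epsilon>(2) \<psi>(1) _ xb]) (rule \<psi>(2))
    moreover have "(app (L4 u) ^^ i) \<psi> x = z ^ i * \<psi> x" for i
      by (rule L4_power_eigenfunction[OF open_ball \<epsilon>(2) \<psi>(1) _ xb]) (rule \<psi>(2))
    ultimately show "\<Phi> \<psi> x = 0"
      unfolding \<Phi>_def
      by (simp add: poly_altdef sum_negf sum_distrib_right mult.assoc)
  qed
  then show ?thesis by (simp add: \<Phi>_def sum_negf)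
qed

section \<open>Dimension of the common eigenspaces\<close>

context
  fixes c :: complex and \<epsilon> :: real and z :: complex
  assumes \<epsilon>: "\<epsilon> > 0" "ball c \<epsilon> \<subseteq> \<Omega>" and Qc: "Q z c \<noteq> 0"
begin

text \<open>At c the equation for the partner and its derivative read Q \<psi>'' = 0 and Q \<psi>'''
  = 0 once \<psi> and \<psi>' vanish there. Since Q is nonzero at c, the whole initial jet is
  zero.\<close>

lemma eigenfunction_unique:
  assumes \<psi>: "\<psi> holomorphic_on ball c \<epsilon>"
    and ode: "\<And>y. y \<in> ball c \<epsilon> \<Longrightarrow> (deriv ^^ 4) \<psi> y = (z - u y) * \<psi> y"
    and M: "\<And>y. y \<in> ball c \<epsilon> \<Longrightarrow> partner \<psi> y = w * \<psi> y"
    and init: "\<psi> c = 0" "deriv \<psi> c = 0" and x: "x \<in> ball c \<epsilon>"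
  shows "\<psi> x = 0"
proof -
  have c: "c \<in> ball c \<epsilon>" using \<epsilon> by simp
  have QS: "Q z holomorphic_on ball c \<epsilon>" using Q_C \<epsilon> C_holomorphic_subset by blast
  have uS: "(\<lambda>y. z - u y) holomorphic_on ball c \<epsilon>" using u_hol[OF \<epsilon>(2)] by (intro holomorphic_intros)
  note jets = lenard_op_jets[OF open_ball c QS \<psi>]
  have eq: "lenard_op (Q z) \<psi> y = w * \<psi> y" if "y \<in> ball c \<epsilon>" for y
    using partner_eq_lenard_op[OF open_ball \<epsilon>(2) \<psi> ode that] M[OF that] by simp
  have "(deriv ^^ 0) (lenard_op (Q z) \<psi>) c = 0" using eq[OF c] init by simp
  then have 2: "(deriv ^^ 2) \<psi> c = 0" unfolding jets(1) using init Qc by simp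
  have "(deriv ^^ 1) (lenard_op (Q z) \<psi>) c = (deriv ^^ 1) (\<lambda>y. w * \<psi> y) c"
    by (rule higher_deriv_cong_on[OF open_ball c eq])
  also have "\<dots> = 0" using higher_deriv_cmult[OF \<psi> c open_ball, of 1 w] init by simp
  finally have 3: "(deriv ^^ 3) \<psi> c = 0" unfolding jets(2) using init Qc by simp
  show ?thesis
  proof (rule linear_ode_unique[OF uS \<psi> ode _ x])
    fix i :: nat assume "i < 4"
    then have "i \<in> {0, 1, 2, 3}" by auto
    then show "(deriv ^^ i) \<psi> c = 0" using init 2 3 by auto
  qed
qed

text \<open>\<open>y2\<close> and \<open>y3\<close> are chosen so that \<phi> = (M - w) \<psi>
  vanishes at c with its first derivative, M being the partner. From M^2 = w^2 on these
  eigenfunctions, \<phi> belongs to the eigenvalue -w of M, and uniqueness for -w gives \<phi> =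
  0.\<close>

lemma common_eigenfunction_exists:
  assumes w: "w ^ 2 = poly F z"
  obtains \<psi> where "\<psi> holomorphic_on ball c \<epsilon>" "\<And>y. y \<in> ball c \<epsilon> \<Longrightarrow> (deriv ^^ 4) \<psi> y = (z - u y) * \<psi> y"
    "\<And>y. y \<in> ball c \<epsilon> \<Longrightarrow> partner \<psi> y = w * \<psi> y" "\<psi> c = s" "deriv \<psi> c = t"
proof -
  have c: "c \<in> ball c \<epsilon>" using \<epsilon> by simp
  have QS: "Q z holomorphic_on ball c \<epsilon>" using Q_C \<epsilon> C_holomorphic_subset by blast
  define B where "B = (\<lambda>n. (deriv ^^ n) (Q z) c)"
  have B0: "B 0 \<noteq> 0" using Qc by (simp add: B_def)
  define y2 where "y2 = (w * s + B 1 * t - B 2 / 2 * s) / B 0"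
  define y3 where "y3 = (w * t + B 2 / 2 * t - B 3 / 2 * s) / B 0"
  obtain \<psi> where \<psi>: "\<psi> holomorphic_on ball c \<epsilon>" "\<And>y. y \<in> ball c \<epsilon> \<Longrightarrow> (deriv ^^ 4) \<psi> y = (z - u y) * \<psi> y"
    "\<And>i. i < 4 \<Longrightarrow> (deriv ^^ i) \<psi> c = (if i = 0 then s else if i = 1 then t else if i = 2 then y2 else y3)"
    using eigenfunction_exists[OF \<epsilon>(2,1), of z "\<lambda>i. if i = 0 then s else if i = 1 then t else if i = 2 then y2 else y3"] by blast
  have j: "(deriv ^^ 0) \<psi> c = s" "(deriv ^^ 1) \<psi> c = t" "(deriv ^^ 2) \<psi> c = y2" "(deriv ^^ 3) \<psi> c = y3"
    using \<psi>(3)[of 0] \<psi>(3)[of 1] \<psi>(3)[of 2] \<psi>(3)[of 3] by simp_all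
  have jets: "(deriv ^^ 0) (lenard_op (Q z) \<psi>) c = B 0 * y2 - B 1 * t + B 2 / 2 * s"
    "(deriv ^^ 1) (lenard_op (Q z) \<psi>) c = B 0 * y3 - B 2 / 2 * t + B 3 / 2 * s"
    using lenard_op_jets(1,2)[OF open_ball c QS \<psi>(1)] by (simp_all only: B_def j)
  have pS: "partner \<psi> holomorphic_on ball c \<epsilon>" using partner_holomorphic[OF open_ball \<epsilon>(2) \<psi>(1)] .
  have pode: "(deriv ^^ 4) (partner \<psi>) y = (z - u y) * partner \<psi> y" if "y \<in> ball c \<epsilon>" for y
    using partner_eigenfunction[OF open_ball \<epsilon>(2) \<psi>(1,2) that] .
  define \<phi> where "\<phi> = (\<lambda>y. partner \<psi> y - w * \<psi> y)"
  have w\<psi>: "(\<lambda>y. w * \<psi> y) holomorphic_on ball c \<epsilon>" using \<psi> by (intro holomorphic_intros)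
  have \<phi>S: "\<phi> holomorphic_on ball c \<epsilon>" unfolding \<phi>_def by (rule holomorphic_on_diff[OF pS w\<psi>])
  have \<phi>_deriv: "(deriv ^^ n) \<phi> y = (deriv ^^ n) (partner \<psi>) y - w * (deriv ^^ n) \<psi> y" if "y \<in> ball c \<epsilon>" for n y
    unfolding \<phi>_def higher_deriv_diff[OF pS w\<psi> open_ball that] higher_deriv_cmult[OF \<psi>(1) that open_ball] ..
  have \<phi>ode: "(deriv ^^ 4) \<phi> y = (z - u y) * \<phi> y" if "y \<in> ball c \<epsilon>" for y
    unfolding \<phi>_deriv[OF that] pode[OF that] \<psi>(2)[OF that] by (simp add: \<phi>_def algebra_simps)
  have p_eq: "(deriv ^^ n) (partner \<psi>) c = (deriv ^^ n) (lenard_op (Q z) \<psi>) c" for n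
    by (rule higher_deriv_cong_on[OF open_ball c]) (rule partner_eq_lenard_op[OF open_ball \<epsilon>(2) \<psi>(1,2)])
  have "\<phi> y = 0" if "y \<in> ball c \<epsilon>" for y
  proof (rule eigenfunction_unique[OF \<phi>S \<phi>ode _ _ _ that])
    show "partner \<phi> y = - w * \<phi> y" if y: "y \<in> ball c \<epsilon>" for y
    proof -
      have "partner \<phi> y = lenard_op (Q z) \<phi> y"
        by (rule partner_eq_lenard_op[OF open_ball \<epsilon>(2) \<phi>S \<phi>ode y])
      also have "\<dots> = lenard_op (Q z) (partner \<psi>) y - w * lenard_op (Q z) \<psi> y"
        unfolding lenard_op_def \<phi>_deriv[OF y] by (simp add: \<phi>_def algebra_simps)
      also have "lenard_op (Q z) (partner \<psi>) y = partner (partner \<psi>) y"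
        using partner_eq_lenard_op[OF open_ball \<epsilon>(2) pS pode y] by simp
      also have "\<dots> = w ^ 2 * \<psi> y" using partner_square[OF open_ball \<epsilon>(2) \<psi>(1,2) y] w by simp
      also have "lenard_op (Q z) \<psi> y = partner \<psi> y"
        using partner_eq_lenard_op[OF open_ball \<epsilon>(2) \<psi>(1,2) y] by simp
      finally show ?thesis by (simp add: \<phi>_def algebra_simps power2_eq_square)
    qed
    have "(deriv ^^ 0) \<phi> c = 0" unfolding \<phi>_deriv[OF c] p_eq jets j using B0 by (simp add: y2_def)
    then show "\<phi> c = 0" by simp
    have "(deriv ^^ 1) \<phi> c = 0" unfolding \<phi>_deriv[OF c] p_eq jets j using B0 by (simp add: y3_def)
    then show "deriv \<phi> c = 0" by simp
  qed
  then show ?thesis using that[OF \<psi>(1,2)] j by (simp add: \<phi>_def)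
qed

text \<open>The map from \<psi> to (\<psi>(c), \<psi>'(c)) is bijective onto pairs of complex
  numbers; preimages of the unit vectors form a basis.\<close>

lemma common_eigenspace_dim:
  assumes w: "w ^ 2 = poly F z"
  shows "fun_dim {\<psi>. \<psi> holomorphic_on ball c \<epsilon> \<and> (\<forall>x. x \<notin> ball c \<epsilon> \<longrightarrow> \<psi> x = 0) \<and>
    (\<forall>x\<in>ball c \<epsilon>. app (L4 u) \<psi> x = z * \<psi> x \<and> partner \<psi> x = w * \<psi> x)} = 2"
    (is "fun_dim ?E = 2")
proof -
  have c: "c \<in> ball c \<epsilon>" using \<epsilon> by simp
  have ex: "\<exists>\<psi>\<in>?E. \<psi> c = s \<and> deriv \<psi> c = t" for s t
  proof -
    obtain \<psi> where \<psi>: "\<psi> holomorphic_on ball c \<epsilon>" "\<And>y. y \<in> ball c \<epsilon> \<Longrightarrow> (deriv ^^ 4) \<psi> y = (z - u y) * \<psi> y"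
      "\<And>y. y \<in> ball c \<epsilon> \<Longrightarrow> partner \<psi> y = w * \<psi> y" "\<psi> c = s" "deriv \<psi> c = t"
      using common_eigenfunction_exists[OF w] by metis
    define \<xi> where "\<xi> = (\<lambda>x. if x \<in> ball c \<epsilon> then \<psi> x else 0)"
    have eq: "\<xi> y = \<psi> y" if "y \<in> ball c \<epsilon>" for y using that by (simp add: \<xi>_def)
    have "\<xi> holomorphic_on ball c \<epsilon> \<longleftrightarrow> \<psi> holomorphic_on ball c \<epsilon>"
      by (rule holomorphic_cong) (use eq in auto)
    moreover have "app (L4 u) \<xi> y = z * \<xi> y \<and> partner \<xi> y = w * \<xi> y" if y: "y \<in> ball c \<epsilon>" for y
    proof -
      have "app (L4 u) \<xi> y = app (L4 u) \<psi> y" by (rule app_cong_on[OF open_ball y eq])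
      moreover have "partner \<xi> y = partner \<psi> y" by (rule partner_cong_on[OF open_ball y eq])
      ultimately show ?thesis using \<psi>(2,3)[OF y] eq[OF y] by (simp add: app_L4 algebra_simps)
    qed
    ultimately have "\<xi> \<in> ?E" using \<psi>(1) by (auto simp: \<xi>_def)
    moreover have "(deriv ^^ 1) \<xi> c = (deriv ^^ 1) \<psi> c" by (rule higher_deriv_cong_on[OF open_ball c eq])
    ultimately show ?thesis using eq[OF c] \<psi>(4,5) by (intro bexI[of _ \<xi>]) auto
  qed
  have ode: "(deriv ^^ 4) \<psi> y = (z - u y) * \<psi> y" if "\<psi> \<in> ?E" "y \<in> ball c \<epsilon>" for \<psi> y
    using that by (simp add: app_L4 algebra_simps)
  have uniq: "\<psi> = (\<lambda>x. s * \<psi>1 x + t * \<psi>2 x)"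
    if "\<psi> \<in> ?E" "\<psi>1 \<in> ?E" "\<psi>2 \<in> ?E" "\<psi> c = s * \<psi>1 c + t * \<psi>2 c" "deriv \<psi> c = s * deriv \<psi>1 c + t * deriv \<psi>2 c"
    for \<psi> \<psi>1 \<psi>2 s t
  proof
    fix x
    define \<xi> where "\<xi> = (\<lambda>x. \<psi> x - (s * \<psi>1 x + t * \<psi>2 x))"
    have hol: "\<psi> holomorphic_on ball c \<epsilon>" "\<psi>1 holomorphic_on ball c \<epsilon>" "\<psi>2 holomorphic_on ball c \<epsilon>"
      using that by auto
    have \<xi>S: "\<xi> holomorphic_on ball c \<epsilon>" unfolding \<xi>_def using hol by (intro holomorphic_intros)
    have d: "(deriv ^^ n) \<xi> y = (deriv ^^ n) \<psi> y - (s * (deriv ^^ n) \<psi>1 y + t * (deriv ^^ n) \<psi>2 y)"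
      if y: "y \<in> ball c \<epsilon>" for n y
    proof -
      have h: "(\<lambda>x. s * \<psi>1 x) holomorphic_on ball c \<epsilon>" "(\<lambda>x. t * \<psi>2 x) holomorphic_on ball c \<epsilon>"
        using hol by (auto intro: holomorphic_intros)
      have "(deriv ^^ n) \<xi> y = (deriv ^^ n) \<psi> y - (deriv ^^ n) (\<lambda>x. s * \<psi>1 x + t * \<psi>2 x) y"
        unfolding \<xi>_def by (rule higher_deriv_diff[OF hol(1) holomorphic_on_add[OF h] open_ball y])
      also have "(deriv ^^ n) (\<lambda>x. s * \<psi>1 x + t * \<psi>2 x) y = s * (deriv ^^ n) \<psi>1 y + t * (deriv ^^ n) \<psi>2 y"
        unfolding higher_deriv_add[OF h open_ball y] higher_deriv_cmult[OF hol(2) y open_ball]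
          higher_deriv_cmult[OF hol(3) y open_ball] ..
      finally show ?thesis .
    qed
    have \<xi>ode: "(deriv ^^ 4) \<xi> y = (z - u y) * \<xi> y" if "y \<in> ball c \<epsilon>" for y
      unfolding d[OF that] ode[OF \<open>\<psi> \<in> ?E\<close> that] ode[OF \<open>\<psi>1 \<in> ?E\<close> that] ode[OF \<open>\<psi>2 \<in> ?E\<close> that]
      by (simp add: \<xi>_def algebra_simps)
    have \<xi>M: "partner \<xi> y = w * \<xi> y" if y: "y \<in> ball c \<epsilon>" for y
    proof -
      have l: "lenard_op (Q z) h y = w * h y" if "h \<in> ?E" for h
        using partner_eq_lenard_op[OF open_ball \<epsilon>(2) _ ode[OF that] y] that y by simp
      have "partner \<xi> y = lenard_op (Q z) \<xi> y"
        by (rule partner_eq_lenard_op[OF open_ball \<epsilon>(2) \<xi>S \<xi>ode y])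
      also have "\<dots> = lenard_op (Q z) \<psi> y - (s * lenard_op (Q z) \<psi>1 y + t * lenard_op (Q z) \<psi>2 y)"
        unfolding lenard_op_def d[OF y] by (simp add: \<xi>_def algebra_simps)
      also have "\<dots> = w * \<xi> y"
        unfolding l[OF \<open>\<psi> \<in> ?E\<close>] l[OF \<open>\<psi>1 \<in> ?E\<close>] l[OF \<open>\<psi>2 \<in> ?E\<close>] by (simp add: \<xi>_def algebra_simps)
      finally show ?thesis .
    qed
    show "\<psi> x = s * \<psi>1 x + t * \<psi>2 x"
    proof (cases "x \<in> ball c \<epsilon>")
      case True
      have "\<xi> c = 0" "deriv \<xi> c = 0" using that(4,5) d[OF c, of 0] d[OF c, of 1] by simp_all
      from eigenfunction_unique[OF \<xi>S \<xi>ode \<xi>M this True] show ?thesis by (simp add: \<xi>_def)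
    next
      case False
      then show ?thesis using that(1-3) by simp
    qed
  qed
  obtain \<psi>1 where 1: "\<psi>1 \<in> ?E" "\<psi>1 c = 1 \<and> deriv \<psi>1 c = 0" using ex[of 1 0] by (rule bexE)
  obtain \<psi>2 where 2: "\<psi>2 \<in> ?E" "\<psi>2 c = 0 \<and> deriv \<psi>2 c = 1" using ex[of 0 1] by (rule bexE)
  note \<psi> = 1(1) 1(2)[THEN conjunct1] 1(2)[THEN conjunct2] 2(1) 2(2)[THEN conjunct1] 2(2)[THEN conjunct2]
  have ne: "\<psi>1 \<noteq> \<psi>2" using \<psi> by auto
  have nz: "\<psi>2 \<noteq> 0" using \<psi>(6) by (auto simp: zero_fun_def)
  show ?thesis
  proof (rule fun_space.dim_unique[of "{\<psi>1, \<psi>2}"])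
    show "{\<psi>1, \<psi>2} \<subseteq> ?E" using \<psi> by blast
    show "?E \<subseteq> fun_space.span {\<psi>1, \<psi>2}"
    proof
      fix \<psi> assume E: "\<psi> \<in> ?E"
      have eq: "\<psi> = (\<lambda>x. \<psi> c * \<psi>1 x + deriv \<psi> c * \<psi>2 x)"
        by (rule uniq[OF E \<psi>(1,4)]) (use \<psi> in simp_all)
      have "(\<lambda>x. \<psi> c * \<psi>1 x) + (\<lambda>x. deriv \<psi> c * \<psi>2 x) \<in> fun_space.span {\<psi>1, \<psi>2}"
        by (intro fun_space.span_add fun_space.span_scale fun_space.span_base) auto
      then show "\<psi> \<in> fun_space.span {\<psi>1, \<psi>2}" by (subst eq) (simp add: plus_fun_def)
    qed
    show "fun_space.independent {\<psi>1, \<psi>2}"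
    proof -
      have "\<psi>1 \<notin> fun_space.span {\<psi>2}"
      proof
        assume "\<psi>1 \<in> fun_space.span {\<psi>2}"
        then obtain k where "\<psi>1 = (\<lambda>x. k * \<psi>2 x)" by (auto simp: fun_space.span_singleton)
        then have "\<psi>1 c = k * \<psi>2 c" by simp
        then show False using \<psi> by simp
      qed
      then show ?thesis using ne nz by (simp add: fun_space.independent_insert)
    qed
    show "card {\<psi>1, \<psi>2} = 2" using ne by simp
  qed
qed

end

end

section \<open>The chain belonging to the Laurent expansion\<close>

context single_pole_potential
begin

lemma tame_holomorphic: "tame f \<Longrightarrow> f holomorphic_on regular_pts"
  by (simp add: tame_def)

lemma coefficient_ring_tame: "coefficient_ring regular_pts (Collect tame) u"
  by unfold_locales (auto intro: open_regular tame_holomorphic tame_const tame_add tame_mult tame_deriv tame_u)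

lemma lenard_fun_tame:
  assumes f: "tame f" "(\<lambda>w. f (a + w)) has_laurent_expansion F"
  shows "tame (lenard_fun u f)"
    and "(\<lambda>w. lenard_fun u f (a + w)) has_laurent_expansion - lenard (laurent_expansion u a) F"
proof -
  note D = has_laurent_expansion_higher_deriv_at
  show "tame (lenard_fun u f)"
    unfolding lenard_fun_def by (intro tame_diff tame_cmult tame_mult tame_higher_deriv f tame_u)
  have "(\<lambda>w. lenard_fun u f (a + w)) has_laurent_expansion
    (fls_deriv ^^ 5) F - fls_const 4 * (laurent_expansion u a * (fls_deriv ^^ 1) F)
      - fls_const 2 * ((fls_deriv ^^ 1) (laurent_expansion u a) * F)"
    unfolding lenard_fun_def
    by (intro has_laurent_expansion_diff has_laurent_expansion_mult has_laurent_expansion_const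
        D f tame_laurent[OF tame_u])
  then show "(\<lambda>w. lenard_fun u f (a + w)) has_laurent_expansion - lenard (laurent_expansion u a) F"
    by (simp add: lenard_def diff_diff_eq)
qed

lemma lenard_chain_exists:
  assumes "\<forall>i< -4. laurent_expansion u a $$ i = 0" "laurent_expansion u a $$ (-4) = of_nat (crit g)" "1 \<le> g"
    "\<forall>i\<in>{-3, -2, -1, 1, 2, 3}. laurent_expansion u a $$ i = 0"
  shows "\<exists>q F. lenard_chain regular_pts (Collect tame) u g q F"
proof -
  define U where "U = laurent_expansion u a"
  obtain b where b: "\<And>j. b j \<in> tame_series" "b 0 = 1" "lenard_seq U b" "lenard U (b g) = 0"
    using lenard_seq_exists[OF assms] unfolding U_def by blast
  \<comment> \<open>For j = 0 the function is required to be 1 everywhere, also at the poles,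
    because \<open>q_top\<close> is an equality of functions while expansions determine them only
    off the poles.\<close>
  have "\<forall>j. \<exists>f. tame f \<and> (\<lambda>w. f (a + w)) has_laurent_expansion b j \<and> (j = 0 \<longrightarrow> f = (\<lambda>_. 1))"
  proof
    fix j
    show "\<exists>f. tame f \<and> (\<lambda>w. f (a + w)) has_laurent_expansion b j \<and> (j = 0 \<longrightarrow> f = (\<lambda>_. 1))"
    proof (cases "j = 0")
      case True
      then show ?thesis using b(2) tame_const by (intro exI[of _ "\<lambda>_. 1"]) auto
    next
      case False
      then show ?thesis using tame_seriesE[OF b(1)[of j]] by metis
    qed
  qed
  then obtain \<beta> where \<beta>: "\<And>j. tame (\<beta> j)" "\<And>j. (\<lambda>w. \<beta> j (a + w)) has_laurent_expansion b j" "\<beta> 0 = (\<lambda>_. 1)"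
    by metis
  define q where "q = (\<lambda>j. \<beta> (g - j))"
  have q: "tame (q j)" "(\<lambda>w. q j (a + w)) has_laurent_expansion b (g - j)" for j
    using \<beta> by (simp_all add: q_def)
  interpret coefficient_ring regular_pts "Collect tame" u by (rule coefficient_ring_tame)
  have UL: "(\<lambda>w. u (a + w)) has_laurent_expansion U" unfolding U_def by (rule tame_laurent[OF tame_u])
  \<comment> \<open>The first integral. Its expansion has derivative zero by \<open>lenG\<close>, so
    for each z it is constant on \<open>regular_pts\<close>.\<close>
  define E where "E = (\<lambda>z x. let Q = (\<lambda>n. (deriv ^^ n) (\<lambda>y. \<Sum>j\<le>g. q j y * z ^ j) x) in
        Q 0 * Q 4 - Q 1 * Q 3 + 1 / 2 * (Q 2 * Q 2) + 2 * ((z - u x) * (Q 0 * Q 0)))"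
  have E_const: "\<exists>e. \<forall>x\<in>regular_pts. E z x = e" for z
  proof -
    define G where "G = (\<Sum>j\<le>g. b (g - j) * fls_const (z ^ j))"
    have tQ: "tame (\<lambda>y. \<Sum>j\<le>g. q j y * z ^ j)"
      by (intro tame_sum tame_mult q tame_const)
    have LQ: "(\<lambda>w. (deriv ^^ n) (\<lambda>y. \<Sum>j\<le>g. q j y * z ^ j) (a + w)) has_laurent_expansion (fls_deriv ^^ n) G" for n
      unfolding G_def
      by (rule has_laurent_expansion_higher_deriv_at)
         (intro has_laurent_expansion_sum has_laurent_expansion_mult q has_laurent_expansion_const)
    have lenG: "lenard U G = 4 * (fls_const z * fls_deriv G)"
    proof -
      have "lenard U G = (\<Sum>j\<le>g. fls_const (z ^ j) * lenard U (b (g - j)))"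
        unfolding G_def mult.commute[of _ "fls_const _"] by (simp add: lenard_sum lenard_const_mult)
      also have "\<dots> = (\<Sum>j<g. fls_const (z ^ Suc j) * lenard U (b (g - Suc j)))"
        using b(4) by (simp add: sum.lessThan_Suc_shift flip: lessThan_Suc_atMost del: sum.lessThan_Suc)
      also have "\<dots> = (\<Sum>j<g. fls_const (z ^ Suc j) * (4 * fls_deriv (b (g - j))))"
      proof (rule sum.cong)
        fix j assume "j \<in> {..<g}"
        then have "Suc (g - Suc j) = g - j" by auto
        then show "fls_const (z ^ Suc j) * lenard U (b (g - Suc j)) = fls_const (z ^ Suc j) * (4 * fls_deriv (b (g - j)))"
          using b(3) unfolding lenard_seq_def by metis
      qed simp
      also have "\<dots> = (\<Sum>j\<le>g. fls_const (z ^ Suc j) * (4 * fls_deriv (b (g - j))))"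
        using b(2) by (simp flip: lessThan_Suc_atMost)
      also have "\<dots> = 4 * (fls_const z * fls_deriv G)"
      proof -
        have "fls_deriv G = (\<Sum>j\<le>g. fls_const (z ^ j) * fls_deriv (b (g - j)))"
          by (simp add: G_def fls_deriv_sum mult.commute)
        moreover have "fls_const (z ^ Suc j) = fls_const z * fls_const (z ^ j)" for j by simp
        ultimately show ?thesis by (simp only: sum_distrib_left mult_ac)
      qed
      finally show ?thesis .
    qed
    define D where "D = (fls_deriv ^^ 0) G * (fls_deriv ^^ 4) G - (fls_deriv ^^ 1) G * (fls_deriv ^^ 3) G
      + fls_const (1 / 2) * ((fls_deriv ^^ 2) G * (fls_deriv ^^ 2) G)
      + fls_const 2 * ((fls_const z - U) * ((fls_deriv ^^ 0) G * (fls_deriv ^^ 0) G))"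
    have "(\<lambda>w. E z (a + w)) has_laurent_expansion D"
      unfolding E_def D_def Let_def
      by (intro has_laurent_expansion_add has_laurent_expansion_diff has_laurent_expansion_mult
          has_laurent_expansion_const LQ UL)
    moreover have "tame (E z)"
      unfolding E_def Let_def
      by (intro tame_add tame_diff tame_mult tame_higher_deriv tQ tame_const tame_u)
    moreover have "fls_deriv D = 0"
    proof -
      have h: "fls_const (1 / 2) * 2 = (1 :: complex fls)" by (simp flip: fls_const_numeral)
      have "fls_deriv D = G * (4 * (fls_const z * fls_deriv G) - lenard U G)"
        unfolding D_def lenard_def
        using h by (simp add: eval_nat_numeral) algebra
      then show ?thesis using lenG by simp
    qed
    then have "D $$ n = 0" if "n < 0" for n
      using that by (metis fls_deriv_eq_0_iff fls_const_nth less_irrefl)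
    ultimately have "\<forall>x\<in>regular_pts. E z x = laurent_expansion (E z) a $$ 0"
      using tame_constant[of "E z"] laurent_expansion_eqI by metis
    then show ?thesis by blast
  qed
  have "\<exists>x0. x0 \<in> regular_pts"
  proof -
    obtain r where r: "r > 0" "\<And>p p'. p \<in> poles \<Longrightarrow> p' \<in> poles \<Longrightarrow> dist p p' < r \<Longrightarrow> p = p'"
      using uniformly_discrete by blast
    have "a + of_real (r / 2) \<notin> poles"
    proof
      assume "a + of_real (r / 2) \<in> poles"
      moreover have "dist (a + of_real (r / 2)) a < r" using r(1) by (simp add: dist_norm)
      ultimately have "a + of_real (r / 2) = a" using r(2) pole_in_poles by blast
      then show False using r(1) by simp
    qed
    then show ?thesis by (auto simp: regular_pts_def)
  qed
  then obtain x0 where x0: "x0 \<in> regular_pts" by blast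
  define p where "p = (\<lambda>n. \<Sum>j\<le>g. monom ((deriv ^^ n) (q j) x0) j)"
  \<comment> \<open>Evaluation at one regular point x0 shows that the constant value of the first
    integral is a polynomial in z.\<close>
  define F where "F = smult (1/2) (p 0 * p 4 - p 1 * p 3 + smult (1/2) (p 2 * p 2) + 2 * ([:- u x0, 1:] * (p 0 * p 0)))"
  have p: "(deriv ^^ n) (\<lambda>y. \<Sum>j\<le>g. q j y * z ^ j) x0 = poly (p n) z" for n z
  proof -
    have "(deriv ^^ n) (\<lambda>y. \<Sum>j\<le>g. q j y * z ^ j) x0 = (\<Sum>j\<le>g. (deriv ^^ n) (q j) x0 * z ^ j)"
      by (rule higher_deriv_sum_cmult[OF open_regular x0]) (use q(1) in \<open>auto simp: tame_def\<close>)
    then show ?thesis by (simp add: p_def poly_sum poly_monom)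
  qed
  have F: "E z x0 = 2 * poly F z" for z
    unfolding E_def Let_def p F_def by (simp add: algebra_simps)
  have "lenard_chain regular_pts (Collect tame) u g q F"
  proof unfold_locales
    show "q j \<in> Collect tame" for j using q by simp
    show "q g = (\<lambda>_. 1)" using \<beta>(3) by (simp add: q_def)
    show "lenard_fun u (q 0) x = 0" if "x \<in> regular_pts" for x
    proof -
      have "(\<lambda>w. lenard_fun u (q 0) (a + w)) has_laurent_expansion 0"
        using lenard_fun_tame(2)[OF q[of 0]] b(4) by (simp add: U_def)
      then show ?thesis
        using tame_eqI[OF lenard_fun_tame(1)[OF q[of 0]] _ tame_const[of 0] has_laurent_expansion_0 that] by blast
    qed
    show "lenard_fun u (q (Suc j)) x = - 4 * deriv (q j) x" if "j < g" "x \<in> regular_pts" for j x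
    proof (rule tame_eqI[OF lenard_fun_tame(1)[OF q] _ _ _ that(2)])
      show "(\<lambda>w. lenard_fun u (q (Suc j)) (a + w)) has_laurent_expansion - lenard U (b (g - Suc j))"
        using lenard_fun_tame(2)[OF q[of "Suc j"]] by (simp add: U_def)
      show "tame (\<lambda>x. - 4 * deriv (q j) x)" by (intro tame_cmult tame_deriv q)
      have "Suc (g - Suc j) = g - j" using that by simp
      then have "lenard U (b (g - Suc j)) = 4 * fls_deriv (b (g - j))"
        using b(3) unfolding lenard_seq_def by metis
      moreover have "(\<lambda>w. - 4 * deriv (q j) (a + w)) has_laurent_expansion fls_const (- 4) * fls_deriv (b (g - j))"
        by (intro has_laurent_expansion_mult has_laurent_expansion_const has_laurent_expansion_deriv_at q)
      moreover have "fls_const (- 4) = (- 4 :: complex fls)"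
        by (metis fls_const_numeral fls_const_uminus)
      ultimately show "(\<lambda>w. - 4 * deriv (q j) (a + w)) has_laurent_expansion - lenard U (b (g - Suc j))" by simp
    qed
    show "(let Q = \<lambda>n. (deriv ^^ n) (\<lambda>y. \<Sum>j\<le>g. q j y * z ^ j) x in
        Q 0 * Q 4 - Q 1 * Q 3 + Q 2 * Q 2 / 2 + 2 * (z - u x) * (Q 0 * Q 0)) = 2 * poly F z" if "x \<in> regular_pts" for x z
    proof -
      have "E z x = 2 * poly F z" using E_const[of z] x0 that F by metis
      then show ?thesis unfolding E_def Let_def by (simp add: algebra_simps)
    qed
  qed
  then show ?thesis by blast
qed

end

section \<open>The partner as an operator with meromorphic coefficients, its rank, and the
  equivalence\<close>

context single_pole_potential
begin

lemma regular_L4_subset: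
  assumes "open S" "u holomorphic_on S"
  shows "S \<subseteq> regular_pts"
proof
  fix x assume "x \<in> S"
  then have "u analytic_on {x}" using assms analytic_at by blast
  then have "\<not> is_pole u x" using analytic_at_imp_no_pole by blast
  then show "x \<in> regular_pts" using is_pole_iff by (simp add: regular_pts_def)
qed

lemma remove_sings_tame:
  assumes "tame f" "x \<in> regular_pts"
  shows "remove_sings f x = f x"
  using tame_holomorphic[OF assms(1)] assms(2) open_regular
  by (intro remove_sings_at_analytic) (meson analytic_at)

lemma rank2_partner_exists:
  assumes "\<forall>i< -4. laurent_expansion u a $$ i = 0" "laurent_expansion u a $$ (-4) = of_nat (crit g)" "1 \<le> g"
    "\<forall>i\<in>{-3, -2, -1, 1, 2, 3}. laurent_expansion u a $$ i = 0"
  shows "\<exists>M. rank2_partner u g M"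
proof -
  obtain q F where "lenard_chain regular_pts (Collect tame) u g q F"
    using lenard_chain_exists[OF assms] by blast
  then interpret lenard_chain regular_pts "Collect tame" u g q F .
  obtain m where m: "rep dbase partner (4 * g + 2) m" "m (4 * g + 2) = (\<lambda>_. 1)"
    using partner_rep by blast
  have m_tame: "tame (m k)" for k using m(1) by (simp add: rep_def)
  \<comment> \<open>Tame coefficients have arbitrary values at the poles;
    \<open>remove_sings\<close> normalizes them as \<open>diff_operator\<close> demands without
    changing them at regular points.\<close>
  define M where "M = map (\<lambda>k. remove_sings (m k)) [0..<4 * g + 3]"
  have len: "length M = 4 * g + 3" by (simp add: M_def)
  have M_app: "app M f x = partner f x" if "open S" "S \<subseteq> regular_pts" "f holomorphic_on S" "x \<in> S" for S f x
  proof -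
    have "x \<in> regular_pts" using that by blast
    have "app M f x = (\<Sum>k<4 * g + 3. remove_sings (m k) x * (deriv ^^ k) f x)"
      unfolding app_def len by (rule sum.cong) (simp_all add: M_def)
    also have "\<dots> = (\<Sum>k\<le>4 * g + 2. m k x * (deriv ^^ k) f x)"
      using remove_sings_tame[OF m_tame \<open>x \<in> regular_pts\<close>] by (intro sum.cong) auto
    also have "\<dots> = partner f x" using m(1)[unfolded rep_def, THEN conjunct2, THEN conjunct2, rule_format, OF that] by simp
    finally show ?thesis .
  qed
  have "diff_operator M"
    unfolding diff_operator_def
  proof (intro conjI ballI)
    show "c nicely_meromorphic_on UNIV" if "c \<in> set M" for c
    proof -
      obtain k where "c = remove_sings (m k)" using \<open>c \<in> set M\<close> by (auto simp: M_def)
      moreover have "m k meromorphic_on UNIV" using m_tame[of k] by (simp add: tame_def)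
      ultimately show ?thesis using remove_sings_nicely_meromorphic by blast
    qed
    show "M \<noteq> []" using len by auto
    have "last M = remove_sings (m (4 * g + 2))" by (simp add: M_def last_map)
    also have "\<dots> = (\<lambda>_. 1)" unfolding m(2) by (rule ext) (rule remove_sings_at_analytic, simp)
    finally show "last M \<noteq> (\<lambda>x. 0)" by (simp add: fun_eq_iff)
  qed
  moreover have "diff_order M = 4 * g + 2" by (simp add: diff_order_def len)
  moreover have "commuting (L4 u) M"
    unfolding commuting_def
  proof (intro allI impI ballI, elim conjE)
    fix S f x assume S: "open S" "regular_on (L4 u) S" "regular_on M S" "f holomorphic_on S" and x: "x \<in> S"
    have sub: "S \<subseteq> regular_pts" using regular_L4_subset S by simp
    have "app (L4 u) (app M f) x = app (L4 u) (partner f) x"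
      by (rule app_cong_on[OF S(1) x]) (rule M_app[OF S(1) sub S(4)])
    also have "\<dots> = partner (app (L4 u) f) x" by (rule partner_commutes[OF S(1) sub S(4) x])
    also have "\<dots> = app M (app (L4 u) f) x"
    proof -
      have "app (L4 u) f holomorphic_on S"
        using holomorphic_app_L4[OF S(1) u_hol[OF sub] S(4), of 1] by simp
      then show ?thesis using M_app[OF S(1) sub _ x] by simp
    qed
    finally show "app (L4 u) (app M f) x = app M (app (L4 u) f) x" .
  qed
  moreover have "has_rank (L4 u) M 2"
    unfolding has_rank_def
  proof (intro allI impI, elim conjE)
    fix c \<epsilon> assume \<epsilon>: "0 < \<epsilon>" "regular_on (L4 u) (ball c \<epsilon>)" "regular_on M (ball c \<epsilon>)"
    have sub: "ball c \<epsilon> \<subseteq> regular_pts" using regular_L4_subset \<epsilon> by simp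
    have curve: "w\<^sup>2 = poly F z" if "(z, w) \<in> spectral_curve (L4 u) M" for z w
    proof -
      \<comment> \<open>The relation w^2 = F(z). Containment of the spectral curve in its zero set
        suffices, since \<open>has_rank\<close> speaks only of points on the curve.\<close>
      define R :: "complex poly poly" where "R = [:- F, 0, 1:]"
      have R: "degree R = 2" "coeff R 0 = - F" "coeff R 1 = 0" "coeff R 2 = 1"
        by (simp_all add: R_def numeral_2_eq_2)
      have s: "{..2::nat} = {0, 1, 2}" by auto
      have "annihilates R (L4 u) M"
        unfolding annihilates_def
      proof (intro allI impI ballI, elim conjE)
        fix S f x assume S: "open S" "regular_on (L4 u) S" "regular_on M S" "f holomorphic_on S" and x: "x \<in> S"
        have sub: "S \<subseteq> regular_pts" using regular_L4_subset S by simp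
        have "app M (app M f) x = app M (partner f) x"
          by (rule app_cong_on[OF S(1) x]) (rule M_app[OF S(1) sub S(4)])
        also have "\<dots> = partner (partner f) x"
          by (rule M_app[OF S(1) sub partner_holomorphic[OF S(1) sub S(4)] x])
        also have "\<dots> = (\<Sum>i\<le>degree F. coeff F i * (app (L4 u) ^^ i) f x)"
          by (rule partner_square_eq[OF S(1) sub S(4) x])
        finally have "app M (app M f) x = \<dots>" .
        then show "eval2_op R (L4 u) M f x = 0"
          unfolding eval2_op_def R(1) s by (simp add: R(2-4) sum_negf numeral_2_eq_2[symmetric] R(3)[simplified])
             (simp add: numeral_2_eq_2)
      qed
      then have "eval2 R z w = 0" using that by (auto simp: spectral_curve_def)
      moreover have "eval2 R z w = w\<^sup>2 - poly F z"
        unfolding eval2_def R(1) s by (simp add: R(2-4) R(3)[simplified] poly_altdef sum_negf)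
      ultimately show ?thesis by simp
    qed
    \<comment> \<open>Q at the centre of the disc as a polynomial in z. Having coefficient 1 at z^g
      it is nonzero, so finitely many z are exceptional, each with at most two values of w.\<close>
    define p where "p = (\<Sum>j\<le>g. monom (q j c) j)"
    have Qp: "Q z c = poly p z" for z by (simp add: Q_def p_def poly_sum poly_monom)
    have "coeff p g = 1" by (simp add: p_def coeff_sum q_top)
    then have "p \<noteq> 0" by auto
    have dim: "fun_dim (common_eigenspace (L4 u) M (ball c \<epsilon>) z w) = 2"
      if "(z, w) \<in> spectral_curve (L4 u) M" "poly p z \<noteq> 0" for z w
    proof -
      have "common_eigenspace (L4 u) M (ball c \<epsilon>) z w = {\<psi>. \<psi> holomorphic_on ball c \<epsilon> \<and> (\<forall>x. x \<notin> ball c \<epsilon> \<longrightarrow> \<psi> x = 0) \<and>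
        (\<forall>x\<in>ball c \<epsilon>. app (L4 u) \<psi> x = z * \<psi> x \<and> partner \<psi> x = w * \<psi> x)}"
        unfolding common_eigenspace_def using M_app[OF open_ball sub] by (auto simp del: mem_ball)
      then show ?thesis
        using common_eigenspace_dim[OF \<epsilon>(1) sub _ curve[OF that(1)]] that(2) Qp by simp
    qed
    have "finite {w. w\<^sup>2 = t}" for t :: complex
    proof -
      have "{w. w\<^sup>2 = t} = {w. poly [:- t, 0, 1:] w = 0}" by (auto simp: power2_eq_square algebra_simps)
      then show ?thesis using poly_roots_finite[of "[:- t, 0, 1:]"] by simp
    qed
    then have "finite (SIGMA z : {z. poly p z = 0}. {w. w\<^sup>2 = poly F z})"
      using poly_roots_finite[OF \<open>p \<noteq> 0\<close>] by (intro finite_SigmaI) auto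
    then show "finite {(z, w) \<in> spectral_curve (L4 u) M. fun_dim (common_eigenspace (L4 u) M (ball c \<epsilon>) z w) \<noteq> 2}"
      by (rule rev_finite_subset) (use curve dim in \<open>fastforce\<close>)
  qed
  ultimately show ?thesis unfolding rank2_partner_def by blast
qed

text \<open>A partner for h yields the critical value of some k \<le> h. Forwards, k < g would give
  a partner of smaller order than the minimal one; backwards, injectivity of \<open>crit\<close>
  forces k = g, whence every partner has at least the order for g.\<close>

theorem rank2_partner_iff:
  assumes g: "1 \<le> g"
  shows "(\<exists>M. rank2_partner u g M \<and> (\<forall>h N. h \<ge> 1 \<and> rank2_partner u h N \<longrightarrow> diff_order M \<le> diff_order N))
    \<longleftrightarrow> zorder u a = -4 \<and> laurent_coeff u a (-4) = of_nat (crit g) \<and>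
      (\<forall>k\<in>{0..g}. \<forall>l\<in>{1,2,3::nat}. laurent_coeff u a (4 * int k - int l) = 0)"
    (is "?L \<longleftrightarrow> ?R")
proof -
  define U where "U = laurent_expansion u a"
  have UL: "(\<lambda>w. u (a + w)) has_laurent_expansion U" unfolding U_def by (rule tame_laurent[OF tame_u])
  have neg: "fls_subdegree U < 0" using is_pole_imp_neg_fls_subdegree[OF UL pole] .
  then have "U \<noteq> 0" by auto
  then have zorder: "zorder u a = fls_subdegree U" using has_laurent_expansion_zorder[OF UL] by blast
  have coeff: "laurent_coeff u a i = U $$ i" for i by (simp add: laurent_coeff_def U_def)
  have necessary: "fls_subdegree U = -4 \<and> (\<exists>k\<in>{1..h}. U $$ (-4) = of_nat (crit k)) \<and> (\<forall>i\<in>{-3, -2, -1, 1, 2, 3}. U $$ i = 0)"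
    if N: "rank2_partner u h N" for h N
  proof -
    have "u meromorphic_on {a}" using u_meromorphic by (rule meromorphic_on_subset) auto
    then obtain b where "lenard_seq U b" "b 0 $$ 0 \<noteq> 0" "b (Suc h) = 0"
      using commuting_imp_lenard_seq[of u a N h] N unfolding rank2_partner_def U_def by blast
    from lenard_seq_terminating[OF this neg] show ?thesis by blast
  qed
  have low: "\<forall>i< -4. U $$ i = 0" if "fls_subdegree U = -4" using that by simp
  have exists: "\<exists>M. rank2_partner u k M"
    if "fls_subdegree U = -4" "U $$ (-4) = of_nat (crit k)" "1 \<le> k" "\<forall>i\<in>{-3, -2, -1, 1, 2, 3}. U $$ i = 0" for k
    using rank2_partner_exists[folded U_def, OF low] that by blast
  have order: "diff_order M = 4 * h + 2" if "rank2_partner u h M" for h M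
    using that by (simp add: rank2_partner_def)
  show ?thesis
  proof
    assume ?L
    then obtain M where M: "rank2_partner u g M"
      "\<And>h N. h \<ge> 1 \<Longrightarrow> rank2_partner u h N \<Longrightarrow> diff_order M \<le> diff_order N" by blast
    from necessary[OF M(1)] obtain k where k: "k \<in> {1..g}" "U $$ (-4) = of_nat (crit k)"
      and U: "fls_subdegree U = -4" "\<forall>i\<in>{-3, -2, -1, 1, 2, 3}. U $$ i = 0" by blast
    obtain N where N: "rank2_partner u k N" using exists[OF U(1) k(2) _ U(2)] k(1) by auto
    have "4 * g + 2 \<le> 4 * k + 2" using M(2)[OF _ N] k(1) order[OF M(1)] order[OF N] by simp
    then have "k = g" using k(1) by simp
    have "crit k \<noteq> 0" using k(1) by (simp add: crit_def)
    then have nz: "U $$ (-4) \<noteq> 0" unfolding k(2) of_nat_eq_0_iff .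
    have "U $$ (4 * int j - int l) = 0" if "l \<in> {1, 2, 3}" for j l
    proof -
      have "\<not> 4 dvd (4 * int j - int l)" using that by (elim insertE emptyE; hypsubst) presburger+
      then show ?thesis using off_grading_vanish[folded U_def, OF low[OF U(1)] nz U(2)] by blast
    qed
    then show ?R using zorder U k \<open>k = g\<close> by (simp add: coeff)
  next
    assume R: ?R
    then have U: "fls_subdegree U = -4" "U $$ (-4) = of_nat (crit g)" using zorder by (simp_all add: coeff)
    have odd: "U $$ (4 * int k - int l) = 0" if "k \<le> g" "l \<in> {1, 2, 3}" for k l
      using R that by (auto simp: coeff)
    \<comment> \<open>k = 0 covers the exponents -1, -2, -3 and k = 1 covers 1, 2, 3; the latter is
      available because g \<ge> 1.\<close>
    have small: "\<forall>i\<in>{-3, -2, -1, 1, 2, 3}. U $$ i = 0"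
      using odd[of 0 1] odd[of 0 2] odd[of 0 3] odd[of 1 1] odd[of 1 2] odd[of 1 3] g by simp
    obtain M where M: "rank2_partner u g M" using exists[OF U g small] by blast
    have "diff_order M \<le> diff_order N" if N: "rank2_partner u h N" for h N
    proof -
      obtain k where k: "k \<in> {1..h}" "U $$ (-4) = of_nat (crit k)" using necessary[OF N] by blast
      then have "crit k = crit g" using U(2) by simp
      then have "k = g" using crit_strict_mono by (simp add: strict_mono_eq)
      then show ?thesis using order[OF M] order[OF N] k(1) by simp
    qed
    then show ?L using M by blast
  qed
qed

end

section \<open>The admissible potentials\<close>

lemma bounded_on_compact_off_poles:
  assumes nice: "u nicely_meromorphic_on UNIV" and poles: "\<And>b. is_pole u b \<Longrightarrow> b - a \<in> period_group u"
    and "compact K" "\<delta> > 0"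
  obtains B where "\<And>x. x \<in> K \<Longrightarrow> \<forall>\<omega>\<in>period_group u. \<delta> \<le> dist x (a + \<omega>) \<Longrightarrow> norm (u x) \<le> B"
proof -
  define T where "T = K \<inter> (\<Inter>\<omega>\<in>period_group u. {x. \<delta> \<le> dist x (a + \<omega>)})"
  have "closed {x. \<delta> \<le> dist x (a + \<omega>)}" for \<omega>
    by (intro closed_Collect_le continuous_intros)
  then have "compact T" unfolding T_def using assms(3) by (intro compact_Int_closed closed_INT) auto
  moreover have "u analytic_on T"
  proof (rule nicely_meromorphic_without_singularities)
    show "u nicely_meromorphic_on T" using nice by (rule nicely_meromorphic_on_subset) simp
    show "\<forall>z\<in>T. \<not> is_pole u z"
    proof (intro ballI notI)
      fix z assume z: "z \<in> T" "is_pole u z"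
      then have "\<delta> \<le> dist z (a + (z - a))" using poles unfolding T_def by blast
      then show False using assms(4) by simp
    qed
  qed
  then have "continuous_on T u" by (intro holomorphic_on_imp_continuous_on analytic_imp_holomorphic)
  ultimately have "bounded (u ` T)" using compact_continuous_image compact_imp_bounded by blast
  then obtain B where "\<And>x. x \<in> T \<Longrightarrow> norm (u x) \<le> B" unfolding bounded_iff by blast
  then show ?thesis using that unfolding T_def by blast
qed

lemma period_group_far:
  assumes "\<omega> \<in> period_group u" "\<forall>\<omega>'\<in>period_group u. \<delta> \<le> dist x (a + \<omega>')"
  shows "\<forall>\<omega>'\<in>period_group u. \<delta> \<le> dist (x - \<omega>) (a + \<omega>')"
proof
  fix \<omega>' assume "\<omega>' \<in> period_group u"
  then have "\<delta> \<le> dist x (a + (\<omega>' + \<omega>))" using assms period_group_add by blast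
  then show "\<delta> \<le> dist (x - \<omega>) (a + \<omega>')" by (simp add: dist_norm algebra_simps)
qed

lemma period_group_diff:
  assumes "\<omega> \<in> period_group u" shows "u (x - \<omega>) = u x"
  using period_group_uminus[OF assms] by (simp add: period_group_def)

text \<open>\<open>D\<close> is a domain that periods reach from every point, and outside a compact
  set u is bounded on it. On the compact set, u is continuous once neighbourhoods of the poles are
  removed.\<close>

lemma single_pole_potentialI:
  assumes nice: "u nicely_meromorphic_on UNIV" and D: "unique_pole_in u D a"
    and reduce: "\<And>x. \<exists>\<omega>\<in>period_group u. x - \<omega> \<in> D"
    and bounded: "\<exists>K B. compact K \<and> (\<forall>x\<in>D. x \<notin> K \<longrightarrow> norm (u x) \<le> B)"
  shows "single_pole_potential u a"
proof
  show "u nicely_meromorphic_on UNIV" by fact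
  show "is_pole u a" using D by (simp add: unique_pole_in_def)
  show poles: "b - a \<in> period_group u" if "is_pole u b" for b
  proof -
    obtain \<omega> where \<omega>: "\<omega> \<in> period_group u" "b - \<omega> \<in> D" using reduce by blast
    have "is_pole u (b - \<omega>)" using is_pole_period[OF \<omega>(1), of "b - \<omega>"] that by simp
    then have "b - \<omega> = a" using D \<omega>(2) by (simp add: unique_pole_in_def)
    then have "b - a = \<omega>" by (simp add: algebra_simps)
    then show ?thesis using \<omega>(1) by simp
  qed
  fix \<delta> :: real assume \<delta>: "\<delta> > 0"
  obtain K B where K: "compact K" "\<And>x. x \<in> D \<Longrightarrow> x \<notin> K \<Longrightarrow> norm (u x) \<le> B" using bounded by blast
  obtain B' where B': "\<And>x. x \<in> K \<Longrightarrow> \<forall>\<omega>\<in>period_group u. \<delta> \<le> dist x (a + \<omega>) \<Longrightarrow> norm (u x) \<le> B'"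
    using bounded_on_compact_off_poles[OF nice poles K(1) \<delta>] by blast
  have "norm (u x) \<le> max B B'" if x: "\<forall>\<omega>\<in>period_group u. \<delta> \<le> dist x (a + \<omega>)" for x
  proof -
    obtain \<omega> where \<omega>: "\<omega> \<in> period_group u" "x - \<omega> \<in> D" using reduce by blast
    have "norm (u (x - \<omega>)) \<le> max B B'"
      using K(2)[OF \<omega>(2)] B'[OF _ period_group_far[OF \<omega>(1) x]] by (cases "x - \<omega> \<in> K") auto
    then show ?thesis unfolding period_group_diff[OF \<omega>(1)] .
  qed
  then show "\<exists>B. \<forall>x. (\<forall>\<omega>\<in>period_group u. \<delta> \<le> dist x (a + \<omega>)) \<longrightarrow> norm (u x) \<le> B" by blast
qed

lemma single_pole_potential_elliptic:
  assumes "elliptic u \<omega>\<^sub>1 \<omega>\<^sub>2" "unique_pole_in u (fundamental_parallelogram c \<omega>\<^sub>1 \<omega>\<^sub>2) a"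
  shows "single_pole_potential u a"
proof (rule single_pole_potentialI[OF _ assms(2)])
  have \<omega>: "\<omega>\<^sub>1 \<noteq> 0" "Im (\<omega>\<^sub>2 / \<omega>\<^sub>1) \<noteq> 0"
    and per: "period_group u = {of_int m * \<omega>\<^sub>1 + of_int n * \<omega>\<^sub>2 | m n. True}"
    using assms(1) by (simp_all add: elliptic_def)
  show "u nicely_meromorphic_on UNIV" using assms(1) by (simp add: elliptic_def)
  show "\<exists>\<omega>\<in>period_group u. x - \<omega> \<in> fundamental_parallelogram c \<omega>\<^sub>1 \<omega>\<^sub>2" for x
  proof -
    define y \<tau> where "y = (x - c) / \<omega>\<^sub>1" and "\<tau> = \<omega>\<^sub>2 / \<omega>\<^sub>1"
    define t where "t = Im y / Im \<tau>"
    define s where "s = Re (y - of_real t * \<tau>)"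
    have "y = of_real s + of_real t * \<tau>"
    proof -
      have "Im \<tau> \<noteq> 0" using \<omega>(2) by (simp add: \<tau>_def)
      then show ?thesis by (simp add: complex_eq_iff s_def t_def)
    qed
    then have "x - c = of_real s * \<omega>\<^sub>1 + of_real t * \<omega>\<^sub>2"
      using \<omega>(1) by (simp add: y_def \<tau>_def field_simps)
    then have "x - (of_int \<lfloor>s\<rfloor> * \<omega>\<^sub>1 + of_int \<lfloor>t\<rfloor> * \<omega>\<^sub>2)
        = c + of_real (frac s) * \<omega>\<^sub>1 + of_real (frac t) * \<omega>\<^sub>2"
      by (simp add: frac_def algebra_simps)
    then have "x - (of_int \<lfloor>s\<rfloor> * \<omega>\<^sub>1 + of_int \<lfloor>t\<rfloor> * \<omega>\<^sub>2) \<in> fundamental_parallelogram c \<omega>\<^sub>1 \<omega>\<^sub>2"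
      unfolding fundamental_parallelogram_def using frac_ge_0 frac_lt_1 by blast
    then show ?thesis unfolding per by blast
  qed
  define f where "f = (\<lambda>(s, t). c + of_real s * \<omega>\<^sub>1 + of_real t * \<omega>\<^sub>2)"
  have "compact (f ` ({0..1} \<times> {0..1}))"
    unfolding f_def by (intro compact_continuous_image compact_Times compact_Icc)
      (auto simp: case_prod_unfold intro!: continuous_intros)
  moreover have "fundamental_parallelogram c \<omega>\<^sub>1 \<omega>\<^sub>2 \<subseteq> f ` ({0..1} \<times> {0..1})"
    unfolding fundamental_parallelogram_def f_def by force
  ultimately show "\<exists>K B. compact K \<and> (\<forall>x\<in>fundamental_parallelogram c \<omega>\<^sub>1 \<omega>\<^sub>2. x \<notin> K \<longrightarrow> norm (u x) \<le> B)"
    by blast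
qed

lemma analytic_at_0_bounded:
  fixes h :: "complex \<Rightarrow> complex"
  assumes "h analytic_on {0}"
  obtains r C where "r > 0" "\<And>t. norm t < r \<Longrightarrow> norm (h t) \<le> C"
proof -
  have "isCont h 0" using assms analytic_at_imp_isCont by blast
  then have "\<forall>\<^sub>F t in nhds 0. dist (h t) (h 0) < 1"
    unfolding isCont_def tendsto_at_iff_tendsto_nhds by (rule tendstoD) simp
  then obtain r where r: "r > 0" "\<And>t. dist t 0 < r \<Longrightarrow> dist (h t) (h 0) < 1"
    unfolding eventually_nhds_metric by blast
  have "norm (h t) \<le> norm (h 0) + 1" if "norm t < r" for t
    using r(2)[of t] that norm_triangle_ineq2[of "h t" "h 0"] by (simp add: dist_norm)
  then show ?thesis using that r(1) by blast
qed

lemma norm_exp_2pi: "norm (exp (2 * pi * \<i> * x / \<omega>)) = exp (- 2 * pi * Im (x / \<omega>))"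
  and norm_exp_2pi_uminus: "norm (exp (- (2 * pi * \<i> * x / \<omega>))) = exp (2 * pi * Im (x / \<omega>))"
proof -
  have "norm (exp (2 * pi * \<i> * t)) = exp (- 2 * pi * Im t)" "norm (exp (- (2 * pi * \<i> * t))) = exp (2 * pi * Im t)" for t
    by (simp_all add: norm_exp_eq_Re)
  from this[of "x / \<omega>"] show "norm (exp (2 * pi * \<i> * x / \<omega>)) = exp (- 2 * pi * Im (x / \<omega>))"
    "norm (exp (- (2 * pi * \<i> * x / \<omega>))) = exp (2 * pi * Im (x / \<omega>))"
    by (simp_all only: times_divide_eq_right)
qed

lemma single_pole_potential_simply_periodic:
  assumes "simply_periodic u \<omega>" "holomorphic_at_strip_ends u \<omega>" "unique_pole_in u (period_strip c \<omega>) a"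
  shows "single_pole_potential u a"
proof (rule single_pole_potentialI[OF _ assms(3)])
  have \<omega>: "\<omega> \<noteq> 0" and per: "period_group u = {of_int m * \<omega> | m. True}"
    using assms(1) by (simp_all add: simply_periodic_def)
  show "u nicely_meromorphic_on UNIV" using assms(1) by (simp add: simply_periodic_def)
  show "\<exists>\<omega>'\<in>period_group u. x - \<omega>' \<in> period_strip c \<omega>" for x
  proof -
    define s where "s = (x - c) / \<omega>"
    have "x - of_int \<lfloor>Re s\<rfloor> * \<omega> = c + (s - of_int \<lfloor>Re s\<rfloor>) * \<omega>"
      using \<omega> by (simp add: s_def field_simps)
    moreover have "0 \<le> Re (s - of_int \<lfloor>Re s\<rfloor>)" "Re (s - of_int \<lfloor>Re s\<rfloor>) < 1" by (simp_all, linarith+)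
    ultimately have "x - of_int \<lfloor>Re s\<rfloor> * \<omega> \<in> period_strip c \<omega>" unfolding period_strip_def by blast
    then show ?thesis unfolding per by blast
  qed
  obtain h1 B1 where h1: "h1 analytic_on {0}" "\<And>x. Im (x / \<omega>) > B1 \<Longrightarrow> u x = h1 (exp (2 * pi * \<i> * x / \<omega>))"
    using assms(2) unfolding holomorphic_at_strip_ends_def by blast
  obtain h2 B2 where h2: "h2 analytic_on {0}" "\<And>x. Im (x / \<omega>) < B2 \<Longrightarrow> u x = h2 (exp (- (2 * pi * \<i> * x / \<omega>)))"
    using assms(2) unfolding holomorphic_at_strip_ends_def by blast
  obtain r1 C1 where C1: "r1 > 0" "\<And>t. norm t < r1 \<Longrightarrow> norm (h1 t) \<le> C1" using analytic_at_0_bounded[OF h1(1)] by blast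
  obtain r2 C2 where C2: "r2 > 0" "\<And>t. norm t < r2 \<Longrightarrow> norm (h2 t) \<le> C2" using analytic_at_0_bounded[OF h2(1)] by blast
  \<comment> \<open>Beyond these heights the exponentials lie in the discs around 0 on which
    \<open>h1\<close> and \<open>h2\<close> are bounded.\<close>
  define T1 where "T1 = max B1 (- ln r1 / (2 * pi))"
  define T2 where "T2 = min B2 (ln r2 / (2 * pi))"
  have up: "norm (u x) \<le> C1" if "Im (x / \<omega>) > T1" for x
  proof -
    have "- ln r1 / (2 * pi) < Im (x / \<omega>)" using that by (simp add: T1_def)
    then have "- 2 * pi * Im (x / \<omega>) < ln r1" by (simp add: field_simps)
    then have "exp (- 2 * pi * Im (x / \<omega>)) < r1" using C1(1) by (metis exp_less_mono exp_ln)
    then show ?thesis using C1(2) h1(2) that norm_exp_2pi[of x \<omega>] by (simp add: T1_def)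
  qed
  have down: "norm (u x) \<le> C2" if "Im (x / \<omega>) < T2" for x
  proof -
    have "Im (x / \<omega>) < ln r2 / (2 * pi)" using that by (simp add: T2_def)
    then have "2 * pi * Im (x / \<omega>) < ln r2" by (simp add: field_simps)
    then have "exp (2 * pi * Im (x / \<omega>)) < r2" using C2(1) by (metis exp_less_mono exp_ln)
    then show ?thesis using C2(2) h2(2) that norm_exp_2pi_uminus[of x \<omega>] by (simp add: T2_def)
  qed
  \<comment> \<open>In the coordinate x / \<omega> this is the strip cut off at the heights
    \<open>T2\<close> and \<open>T1\<close>.\<close>
  define K where "K = (\<lambda>y. y * \<omega>) ` cbox (Complex (Re (c / \<omega>)) T2) (Complex (Re (c / \<omega>) + 1) T1)"
  have "compact K"
    unfolding K_def by (intro compact_continuous_image compact_cbox continuous_intros)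
  moreover have "norm (u x) \<le> max C1 C2" if x: "x \<in> period_strip c \<omega>" "x \<notin> K" for x
  proof -
    obtain s where s: "x = c + s * \<omega>" "0 \<le> Re s" "Re s < 1" using x(1) by (auto simp: period_strip_def)
    have "x / \<omega> = c / \<omega> + s" using \<omega> by (simp add: s(1) field_simps)
    then have "Re (c / \<omega>) \<le> Re (x / \<omega>)" "Re (x / \<omega>) \<le> Re (c / \<omega>) + 1" using s by simp_all
    then have "x / \<omega> * \<omega> \<in> K" if "T2 \<le> Im (x / \<omega>)" "Im (x / \<omega>) \<le> T1"
      unfolding K_def using that by (intro imageI) (simp add: in_cbox_complex_iff)
    moreover have "x / \<omega> * \<omega> = x" using \<omega> by simp
    ultimately have "\<not> (T2 \<le> Im (x / \<omega>) \<and> Im (x / \<omega>) \<le> T1)" using x(2) by metis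
    then have "Im (x / \<omega>) > T1 \<or> Im (x / \<omega>) < T2" by auto
    then show ?thesis using up down by (meson max.coboundedI1 max.coboundedI2)
  qed
  ultimately show "\<exists>K B. compact K \<and> (\<forall>x\<in>period_strip c \<omega>. x \<notin> K \<longrightarrow> norm (u x) \<le> B)" by blast
qed

text \<open>The domain is the whole plane, reached by the period 0; holomorphy at infinity bounds u
  outside a disc.\<close>

lemma single_pole_potential_rational:
  assumes "rational_function u" "holomorphic_at_infinity u" "unique_pole_in u UNIV a"
  shows "single_pole_potential u a"
proof (rule single_pole_potentialI[OF _ assms(3)])
  show "u nicely_meromorphic_on UNIV" using assms(1) by (simp add: rational_function_def)
  show "\<exists>\<omega>\<in>period_group u. x - \<omega> \<in> UNIV" for x using period_group_0 by auto
  obtain h where h: "h analytic_on {0}" "\<forall>\<^sub>F t in at 0. u (1 / t) = h t"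
    using assms(2) unfolding holomorphic_at_infinity_def by blast
  obtain r C where C: "r > 0" "\<And>t. norm t < r \<Longrightarrow> norm (h t) \<le> C" using analytic_at_0_bounded[OF h(1)] by blast
  obtain d where d: "d > 0" "\<And>t. t \<noteq> 0 \<Longrightarrow> norm t < d \<Longrightarrow> u (1 / t) = h t"
    using h(2) unfolding eventually_at by (auto simp: dist_norm)
  have "norm (u x) \<le> C" if "x \<notin> cball 0 (1 / min r d)" for x
  proof -
    define m where "m = min r d"
    have m: "m > 0" "1 / m < norm x" using that C(1) d(1) by (auto simp: m_def)
    have "0 < 1 / m" using m(1) by simp
    then have x: "0 < norm x" using m(2) by linarith
    then have "norm (1 / x) < m" using m by (simp add: norm_divide field_simps)
    then have n: "norm (1 / x) < min r d" "x \<noteq> 0" using x by (auto simp: m_def)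
    show ?thesis using n d(2)[of "1 / x"] C(2)[of "1 / x"] by simp
  qed
  then show "\<exists>K B. compact K \<and> (\<forall>x\<in>UNIV. x \<notin> K \<longrightarrow> norm (u x) \<le> B)"
    using compact_cball by blast
qed

theorem corollary1p2:
  fixes u :: "complex \<Rightarrow> complex" and a\<^sub>1 :: complex and g :: nat
  assumes "admissible_potential u a\<^sub>1"
    and "g \<ge> 1"
  shows "(\<exists>M. rank2_partner u g M \<and>
             (\<forall>h N. h \<ge> 1 \<and> rank2_partner u h N \<longrightarrow> diff_order M \<le> diff_order N))
         \<longleftrightarrow>
         (is_pole u a\<^sub>1 \<and> zorder u a\<^sub>1 = -4 \<and>
          laurent_coeff u a\<^sub>1 (-4) = of_nat (g * (4 * g + 1) * (4 * g + 3) * (4 * g + 4)) \<and>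
          (\<forall>k\<in>{0..g}. \<forall>l\<in>{1,2,3::nat}. laurent_coeff u a\<^sub>1 (4 * int k - int l) = 0))"
proof -
  have "single_pole_potential u a\<^sub>1"
    using assms(1) single_pole_potential_elliptic single_pole_potential_simply_periodic
      single_pole_potential_rational unfolding admissible_potential_def by blast
  then interpret single_pole_potential u a\<^sub>1 .
  show ?thesis using rank2_partner_iff[OF assms(2)] pole unfolding crit_def by blast
qed

end
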